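(* Let $\mu$ be a non-zero, finite, compactly supported Borel measure on $\mathbb{R}^d$ with $\dim_{\mathrm{Fr}}\mu=\alpha$ for some $0<\alpha<d$. If $$q>2+2\inf_{\substack{\theta\in[0,1]\\ \dim^\theta_{\mathrm F}\mu>d\theta}}\frac{(d-\alpha)(2-\theta)}{\dim^\theta_{\mathrm F}\mu-\alpha\theta},$$ then for all $f\in L^2(\mu)$, $$\|\widehat{f\mu}\|_{L^q(\mathbb{R}^d)}\lesssim\|f\|_{L^2(\mu)}.$$ Equivalently, if $$1\leq q'<1+\sup_{\substack{\theta\in[0,1]\\ \dim^\theta_{\mathrm F}\mu>d\theta}}\frac{\dim^\theta_{\mathrm F}\mu-\alpha\theta}{\dim^\theta_{\mathrm F}\mu+4(d-\alpha)-\theta(2d-\alpha)},$$ then for all $f\in L^{q'}(\mathbb{R}^d)$, $$\|\widehat f\,\|_{L^2(\mu)}\lesssim\|f\|_{L^{q'}(\mathbb{R}^d)}.$$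
   Context: $A\lesssim B$ means $A\leq CB$ with a constant $C>0$ independent of $f$. $q'$ denotes the conjugate exponent of $q$: $\frac1q+\frac1{q'}=1$. Fourier transforms: $\widehat f(\xi)=\int_{\mathbb{R}^d}e^{-2\pi i\xi\cdot x}f(x)\,dx$, $\widehat\mu(\xi)=\int e^{-2\pi i\xi\cdot x}\,d\mu(x)$, $\widehat{f\mu}(\xi)=\int e^{-2\pi i\xi\cdot x}f(x)\,d\mu(x)$. The estimate for $\|\widehat f\,\|_{L^2(\mu)}$ is understood as an estimate for Schwartz functions $f$, extended to $L^{q'}(\mathbb{R}^d)$ by density. Frostman dimension: $\dim_{\mathrm{Fr}}\mu=\sup\{\alpha\in\mathbb{R}: \mu(B(x,r))\lesssim r^\alpha\ \ \forall r>0,\ x\in\mathbb{R}^d\}$. Fourier spectrum: for $\theta\in(0,1]$ let $\mathcal{J}_{s,\theta}(\mu)=\Big(\int_{\mathbb{R}^d}|\widehat\mu(\xi)|^{2/\theta}|\xi|^{s/\theta-d}\,d\xi\Big)^\theta$ and for $\theta=0$ let $\mathcal{J}_{s,0}(\mu)=\sup_{\xi\in\mathbb{R}^d}|\widehat\mu(\xi)|^2|\xi|^s$. Then $\dim^\theta_{\mathrm F}\mu=\sup\{s\in\mathbb{R}:\mathcal{J}_{s,\theta}(\mu)<\infty\}$ (with value $0$ if the set is empty). An infimum over an empty set of $\theta$ is $+\infty$, and if there is no admissible $\theta$ the statement is vacuous. *)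

theory Defs
  imports "HOL-Probability.Probability"
begin

section \<open>Norms of Lebesgue spaces\<close>

text \<open>Only used with exponents \<open>a > 0\<close>, whence the value \<open>\<infinity>\<close> at \<open>x = \<infinity>\<close>.\<close>

definition epowr :: "ennreal \<Rightarrow> real \<Rightarrow> ennreal" where
  "epowr x a = (if x = \<infinity> then \<infinity> else ennreal (enn2real x powr a))"

definition Lp_norm :: "ereal \<Rightarrow> 'a measure \<Rightarrow> ('a \<Rightarrow> complex) \<Rightarrow> ennreal" where
  "Lp_norm p M f =
     (if p = \<infinity> then esssup M (\<lambda>x. ennreal (norm (f x)))
      else epowr (\<integral>\<^sup>+ x. ennreal (norm (f x) powr real_of_ereal p) \<partial>M) (1 / real_of_ereal p))"

definition Lp_space :: "ereal \<Rightarrow> 'a measure \<Rightarrow> ('a \<Rightarrow> complex) set" where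
  "Lp_space p M = {f \<in> borel_measurable M. Lp_norm p M f < \<infinity>}"

text \<open>In \<open>ereal\<close> we have \<open>1 / \<infinity> = 0\<close>, so \<open>1\<close> and \<open>\<infinity>\<close> are conjugate.\<close>

definition conjugate_exponents :: "ereal \<Rightarrow> ereal \<Rightarrow> bool" where
  "conjugate_exponents p q \<longleftrightarrow> 1 \<le> p \<and> 1 \<le> q \<and> 1 / p + 1 / q = 1"


section \<open>Fourier transforms and Schwartz functions\<close>

text \<open>
  \<open>fourier \<mu> f\<close> is the Fourier transform of the complex measure \<open>f \<mu>\<close>. The transform of a
  function \<open>f\<close> on the whole space is \<open>fourier lborel f\<close>, that of \<open>\<mu>\<close> itself is
  \<open>fourier \<mu> (\<lambda>_. 1)\<close>.
\<close>

definition fourier :: "'a::euclidean_space measure \<Rightarrow> ('a \<Rightarrow> complex) \<Rightarrow> 'a \<Rightarrow> complex" where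
  "fourier M f \<xi> = (LINT x|M. cis (- (2 * pi * (\<xi> \<bullet> x))) * f x)"

fun iterated_partial :: "'a::euclidean_space list \<Rightarrow> ('a \<Rightarrow> complex) \<Rightarrow> 'a \<Rightarrow> complex" where
  "iterated_partial [] f = f"
| "iterated_partial (v # vs) f = (\<lambda>x. frechet_derivative (iterated_partial vs f) (at x) v)"

definition schwartz :: "('a::euclidean_space \<Rightarrow> complex) \<Rightarrow> bool" where
  "schwartz f \<longleftrightarrow>
     (\<forall>vs. set vs \<subseteq> Basis \<longrightarrow>
        (\<forall>x. iterated_partial vs f differentiable (at x)) \<and>
        (\<forall>k::nat. bounded (range (\<lambda>x. norm x ^ k * norm (iterated_partial vs f x)))))"

text \<open>
  \<open>F\<close> is the value at \<open>f\<close> of the extension by density to \<open>L\<^sup>p\<close> of the map sending a Schwartz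
  function \<open>\<phi>\<close> to its Fourier transform in \<open>L\<^sup>2(\<mu>)\<close>: along every sequence of Schwartz functions
  tending to \<open>f\<close> in \<open>L\<^sup>p\<close>, the transforms tend to \<open>F\<close> in \<open>L\<^sup>2(\<mu>)\<close>. Since Schwartz functions are
  dense in \<open>L\<^sup>p\<close> for \<open>1 \<le> p < \<infinity>\<close>, this determines \<open>F\<close> up to a \<open>\<mu>\<close>-null set.
\<close>

definition fourier_extension ::
  "'a::euclidean_space measure \<Rightarrow> ereal \<Rightarrow> ('a \<Rightarrow> complex) \<Rightarrow> ('a \<Rightarrow> complex) \<Rightarrow> bool" where
  "fourier_extension \<mu> p f F \<longleftrightarrow>
     F \<in> Lp_space 2 \<mu> \<and>
     (\<forall>\<phi> :: nat \<Rightarrow> 'a \<Rightarrow> complex.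
        (\<forall>n. schwartz (\<phi> n)) \<and> (\<lambda>n. Lp_norm p lborel (\<lambda>x. \<phi> n x - f x)) \<longlonglongrightarrow> 0 \<longrightarrow>
        (\<lambda>n. Lp_norm 2 \<mu> (\<lambda>\<xi>. fourier lborel (\<phi> n) \<xi> - F \<xi>)) \<longlonglongrightarrow> 0)"


section \<open>Dimensions of measures\<close>

definition frostman_dim :: "'a::euclidean_space measure \<Rightarrow> ereal" where
  "frostman_dim \<mu> =
     (SUP a \<in> {a::real. \<exists>C>0. \<forall>x. \<forall>r>0. measure \<mu> (ball x r) \<le> C * r powr a}. ereal a)"

text \<open>
  Since \<open>0 powr s = 0\<close> in HOL, the point \<open>\<xi> = 0\<close> contributes nothing to the supremum for
  \<open>\<theta> = 0\<close>. For finite measures this affects neither finiteness nor, hence, the Fourier spectrum: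
  the transform of \<open>\<mu>\<close> is continuous, so the neighbouring points give the same supremum.
\<close>

definition fourier_energy :: "real \<Rightarrow> real \<Rightarrow> 'a::euclidean_space measure \<Rightarrow> ennreal" where
  "fourier_energy s \<theta> \<mu> =
     (if \<theta> = 0
      then (SUP \<xi>. ennreal (norm (fourier \<mu> (\<lambda>_. 1) \<xi>) ^ 2 * norm \<xi> powr s))
      else epowr (\<integral>\<^sup>+ \<xi>. ennreal (norm (fourier \<mu> (\<lambda>_. 1) \<xi>) powr (2 / \<theta>)
                             * norm \<xi> powr (s / \<theta> - real DIM('a))) \<partial>lborel) \<theta>)"

definition fourier_spectrum :: "'a::euclidean_space measure \<Rightarrow> real \<Rightarrow> ereal" where
  "fourier_spectrum \<mu> \<theta> =
     (if {s::real. fourier_energy s \<theta> \<mu> < \<infinity>} = {} then 0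
      else (SUP s \<in> {s::real. fourier_energy s \<theta> \<mu> < \<infinity>}. ereal s))"


section \<open>The ranges of exponents\<close>

text \<open>
  Infima and suprema are taken in \<open>ereal\<close>, so over an empty set of \<open>\<theta>\<close> they are \<open>\<infinity>\<close> and \<open>-\<infinity>\<close>
  respectively, and both ranges of exponents are then empty.
\<close>

definition admissible_thetas :: "'a::euclidean_space measure \<Rightarrow> real set" where
  "admissible_thetas \<mu> = {\<theta> \<in> {0..1}. fourier_spectrum \<mu> \<theta> > ereal (real DIM('a) * \<theta>)}"

definition extension_range :: "'a::euclidean_space measure \<Rightarrow> real \<Rightarrow> ereal set" where
  "extension_range \<mu> \<alpha> =
     {q. q > 2 + 2 * (INF \<theta> \<in> admissible_thetas \<mu>.
           ereal ((real DIM('a) - \<alpha>) * (2 - \<theta>)) / (fourier_spectrum \<mu> \<theta> - ereal (\<alpha> * \<theta>)))}"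

definition restriction_range :: "'a::euclidean_space measure \<Rightarrow> real \<Rightarrow> ereal set" where
  "restriction_range \<mu> \<alpha> =
     {p. 1 \<le> p \<and> p < 1 + (SUP \<theta> \<in> admissible_thetas \<mu>.
           (fourier_spectrum \<mu> \<theta> - ereal (\<alpha> * \<theta>)) /
           (fourier_spectrum \<mu> \<theta> + ereal (4 * (real DIM('a) - \<alpha>))
              - ereal (\<theta> * (2 * real DIM('a) - \<alpha>))))}"

end

(*
  Idea.  Testing against unimodular functions g supported on the superlevel set E of the transform
  of f mu, the extension estimate reduces to bounding the integral of |g^|^2 d mu, which is the
  quadratic form of g with kernel mu^(x - y).  Split mu^ by a Gaussian cutoff at frequency R.  The
  low part is the transform of a smoothed measure with density O(R^(d - a)) by the Frostman bound,
  and Plancherel gives O(R^(d - a)) |E|.  The high part K is bounded pointwise by b + b^(1 - p) |K|^p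
  with p = 2 / theta, and the energy controls the L^p norm of K, giving
  b |E|^2 + O(b^(1 - p) R^(-A)) |E| with A = s / theta - d.  For b = l^2 / 2 the first term is absorbed
  and the optimal R yields a weak type bound at the endpoint exponent.  As the transform is bounded,
  the strong type bound holds for every larger exponent without interpolation.  Restriction follows
  by duality.
*)

theory Submission
  imports Defs "HOL-Real_Asymp.Real_Asymp"
begin

section \<open>Fourier transforms of finite measures\<close>

text \<open>Three obstacles shape the details. The factor
  \<open>1 - exp (- (pi * (norm v)\<^sup>2 / R\<^sup>2))\<close> vanishes only to second order at
  the origin, while the energy asks for order (s - d \<theta>) / 2, which may be larger. So the high
  part carries the k-th power of this factor, and the low part becomes a combination of Gaussians of
  different widths, each of which is smoothed and estimated separately. Next, neither the Frostman
  dimension nor the Fourier spectrum has to be attained: the endpoint bound is proved for admissible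
  parameters slightly below both suprema, and the strict inequality on q pays for the loss. Finally,
  the spectrum is an extended real, and the two exponent ranges correspond only where it is finite.
  Finiteness comes from the extension estimate itself: an infinite value would give the estimate for
  every q > 2, and testing it on balls would then yield Frostman exponents arbitrarily close to d,
  hence above \<alpha>.\<close>

lemma norm_fourier_le: "norm (fourier M f \<xi>) \<le> (LINT x|M. norm (f x))"
proof -
  have "norm (fourier M f \<xi>) \<le> (LINT x|M. norm (cis (- (2 * pi * (\<xi> \<bullet> x))) * f x))"
    unfolding fourier_def by (rule integral_norm_bound)
  then show ?thesis by (simp add: norm_mult)
qed

lemma borel_measurable_cis [measurable]: "cis \<in> borel_measurable borel"
  by (intro borel_measurable_continuous_onI continuous_intros)

lemma borel_measurable_cnj [measurable]: "cnj \<in> borel_measurable borel"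
  by (intro borel_measurable_continuous_onI continuous_intros)

lemma borel_measurable_fourier [measurable (raw)]:
  assumes "sigma_finite_measure M" and [measurable_cong]: "sets M = sets borel"
    and [measurable]: "f \<in> borel_measurable M"
  shows "fourier M f \<in> borel_measurable borel"
proof -
  interpret sigma_finite_measure M by fact
  have [measurable]: "f \<in> borel_measurable borel"
    using assms(3) measurable_cong_sets[OF assms(2) refl] by blast
  show ?thesis
    unfolding fourier_def by measurable
qed

text \<open>Fubini for an absolutely integrable kernel. Allowing two different measures lets the
  same formula move a transform between \<mu> and Lebesgue measure, which is the duality between
  extension and restriction.\<close>

lemma fourier_multiplication:
  fixes M N :: "'a::euclidean_space measure"
  assumes M: "sigma_finite_measure M" "sets M = sets borel" "integrable M f"
    and N: "sigma_finite_measure N" "sets N = sets borel" "integrable N g"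
  shows "(LINT y|M. fourier N g y * f y) = (LINT x|N. g x * fourier M f x)"
proof -
  interpret M: sigma_finite_measure M by fact
  interpret N: sigma_finite_measure N by fact
  interpret pair_sigma_finite M N ..
  note [measurable_cong] = M(2) N(2)
  have [measurable]: "f \<in> borel_measurable borel" "g \<in> borel_measurable borel"
    using borel_measurable_integrable[OF M(3)] measurable_cong_sets[OF M(2) refl]
      borel_measurable_integrable[OF N(3)] measurable_cong_sets[OF N(2) refl] by blast+
  have int: "integrable (M \<Otimes>\<^sub>M N) (\<lambda>(y, x). cis (- (2 * pi * (y \<bullet> x))) * g x * f y)"
  proof (rule Bochner_Integration.integrable_bound)
    have "integrable (M \<Otimes>\<^sub>M N) (\<lambda>(y, x). norm (f y) * norm (g x))"
      using M(3) N(3) by (intro Fubini_integrable) auto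
    then show "integrable (M \<Otimes>\<^sub>M N) (\<lambda>p. norm (f (fst p)) * norm (g (snd p)))"
      by (simp add: case_prod_unfold)
  qed (measurable, auto simp: norm_mult mult.commute)
  have "(LINT y|M. fourier N g y * f y) = (LINT y|M. LINT x|N. cis (- (2 * pi * (y \<bullet> x))) * g x * f y)"
    by (simp add: fourier_def)
  also have "\<dots> = (LINT x|N. LINT y|M. cis (- (2 * pi * (y \<bullet> x))) * g x * f y)"
    using Fubini_integral[OF int] by simp
  also have "\<dots> = (LINT x|N. LINT y|M. g x * (cis (- (2 * pi * (x \<bullet> y))) * f y))"
    by (simp add: inner_commute mult_ac)
  also have "\<dots> = (LINT x|N. g x * fourier M f x)"
    by (simp add: fourier_def)
  finally show ?thesis .
qed

text \<open>The quadratic form of \<open>g\<close> with a convolution kernel. When \<open>k\<close>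
  is the transform of a positive measure, cnj (k (y - x)) = k (x - y), so conjugating the whole
  inner integral gives the usual form; this is the shape that the multiplication formula
  produces.\<close>

definition kernel_form :: "('a::euclidean_space \<Rightarrow> complex) \<Rightarrow> ('a \<Rightarrow> complex) \<Rightarrow> complex" where
  "kernel_form g k = (LINT x|lborel. g x * cnj (LINT y|lborel. g y * k (y - x)))"

text \<open>Write the squared norm as a product with the conjugate and apply the multiplication
  formula twice, once to each factor.\<close>

lemma integral_norm_fourier_square:
  fixes \<nu> :: "'a::euclidean_space measure"
  assumes "finite_measure \<nu>" and sets: "sets \<nu> = sets borel" and g: "integrable lborel g"
  shows "complex_of_real (LINT \<xi>|\<nu>. (norm (fourier lborel g \<xi>))\<^sup>2)
    = kernel_form g (fourier \<nu> (\<lambda>_. 1))"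
    and "integrable \<nu> (\<lambda>\<xi>. (norm (fourier lborel g \<xi>))\<^sup>2)"
proof -
  interpret finite_measure \<nu> by fact
  note [measurable_cong] = sets
  have sf: "sigma_finite_measure \<nu>" by unfold_locales
  have [measurable]: "g \<in> borel_measurable borel" using borel_measurable_integrable[OF g] by simp
  have gm [measurable]: "fourier lborel g \<in> borel_measurable borel"
    by (rule borel_measurable_fourier) (auto intro: lborel.sigma_finite_measure_axioms)
  define B where "B = (LINT x|lborel. norm (g x))"
  have le: "norm (fourier lborel g \<xi>) \<le> B" for \<xi>
    unfolding B_def by (rule norm_fourier_le)
  have B0: "B \<ge> 0" using le[of 0] norm_ge_zero order_trans by blast
  show "integrable \<nu> (\<lambda>\<xi>. (norm (fourier lborel g \<xi>))\<^sup>2)"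
    by (rule integrable_const_bound[where B="B\<^sup>2"]) (auto intro!: power_mono le)
  have int: "integrable \<nu> (\<lambda>\<xi>. cnj (fourier lborel g \<xi>))"
    by (rule integrable_const_bound[where B=B]) (auto intro!: le)
  \<comment> \<open>Second use of the formula: modulating \<nu> by
    \<open>cis (2 * pi * (x \<bullet> \<xi>))\<close> translates its transform by \<open>x\<close>,
    which turns the result into a convolution.\<close>
  have inner: "fourier \<nu> (\<lambda>\<xi>. cnj (fourier lborel g \<xi>)) x
      = cnj (LINT y|lborel. g y * fourier \<nu> (\<lambda>_. 1) (y - x))" for x
  proof -
    have int1: "integrable \<nu> (\<lambda>\<xi>. cis (2 * pi * (x \<bullet> \<xi>)))"
      by (rule integrable_const_bound[where B=1]) auto
    have "cnj (fourier \<nu> (\<lambda>\<xi>. cnj (fourier lborel g \<xi>)) x)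
        = (LINT \<xi>|\<nu>. fourier lborel g \<xi> * cis (2 * pi * (x \<bullet> \<xi>)))"
      unfolding fourier_def[of \<nu>]
      by (simp only: Bochner_Integration.integral_cnj[symmetric] complex_cnj_mult complex_cnj_cnj cis_cnj)
         (simp add: mult.commute)
    also have "\<dots> = (LINT y|lborel. g y * fourier \<nu> (\<lambda>\<xi>. cis (2 * pi * (x \<bullet> \<xi>))) y)"
      by (rule fourier_multiplication[OF sf sets int1 lborel.sigma_finite_measure_axioms _ g]) simp
    also have "\<dots> = (LINT y|lborel. g y * fourier \<nu> (\<lambda>_. 1) (y - x))"
      unfolding fourier_def by (simp add: cis_mult inner_diff_left algebra_simps)
    finally show ?thesis by (metis complex_cnj_cnj)
  qed
  have "complex_of_real (LINT \<xi>|\<nu>. (norm (fourier lborel g \<xi>))\<^sup>2)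
      = (LINT \<xi>|\<nu>. fourier lborel g \<xi> * cnj (fourier lborel g \<xi>))"
    by (simp only: complex_norm_square[symmetric] integral_complex_of_real)
  also have "\<dots> = (LINT x|lborel. g x * fourier \<nu> (\<lambda>\<xi>. cnj (fourier lborel g \<xi>)) x)"
    by (rule fourier_multiplication[OF sf sets int lborel.sigma_finite_measure_axioms _ g]) simp
  finally show "complex_of_real (LINT \<xi>|\<nu>. (norm (fourier lborel g \<xi>))\<^sup>2)
      = kernel_form g (fourier \<nu> (\<lambda>_. 1))"
    unfolding kernel_form_def inner .
qed

text \<open>The common bound \<open>B\<close> makes the inner and the outer integral converge
  absolutely, so that both split. The form is conjugate linear in the kernel, hence the real scalar
  \<open>c\<close>.\<close>

lemma kernel_form_diff:
  fixes g :: "'a::euclidean_space \<Rightarrow> complex"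
  assumes g: "integrable lborel g"
    and [measurable]: "h \<in> borel_measurable borel" "k \<in> borel_measurable borel"
    and bound: "\<And>x. norm (h x) \<le> B" "\<And>x. norm (k x) \<le> B"
  shows "kernel_form g (\<lambda>x. h x - complex_of_real c * k x)
    = kernel_form g h - of_real c * kernel_form g k"
proof -
  have [measurable]: "g \<in> borel_measurable borel" using borel_measurable_integrable[OF g] by simp
  have bd_int: "integrable lborel (\<lambda>y. g y * f (y - x))"
    if [measurable]: "f \<in> borel_measurable borel" and "\<And>x. norm (f x) \<le> B" for f :: "'a \<Rightarrow> complex" and x
  proof (rule Bochner_Integration.integrable_bound[OF integrable_mult_right[OF integrable_norm[OF g], of B]])
    show "AE y in lborel. norm (g y * f (y - x)) \<le> norm (B * norm (g y))"
      using that(2) by (auto simp: norm_mult abs_mult mult.commute[of "norm (g _)"] intro!: mult_right_mono order_trans[OF _ abs_ge_self])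
  qed measurable
  have B0: "B \<ge> 0" using bound(1)[of 0] norm_ge_zero order_trans by blast
  have inner_le: "norm (LINT y|lborel. g y * f (y - x)) \<le> (LINT y|lborel. norm (g y) * B)"
    if "f \<in> borel_measurable borel" and "\<And>x. norm (f x) \<le> B" for f :: "'a \<Rightarrow> complex" and x
  proof (rule order_trans[OF integral_norm_bound integral_mono])
    show "integrable lborel (\<lambda>y. norm (g y * f (y - x)))" using bd_int[OF that] by auto
    show "norm (g y * f (y - x)) \<le> norm (g y) * B" for y
      using that(2) by (simp add: norm_mult mult_left_mono)
  qed (use g in auto)
  have out_int: "integrable lborel (\<lambda>x. g x * cnj (LINT y|lborel. g y * f (y - x)))"
    if [measurable]: "f \<in> borel_measurable borel" and "\<And>x. norm (f x) \<le> B" for f :: "'a \<Rightarrow> complex"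
  proof (rule Bochner_Integration.integrable_bound
      [OF integrable_mult_right[OF integrable_norm[OF g], of "LINT y|lborel. norm (g y) * B"]])
    have "(\<lambda>(x, y). g y * f (y - x)) \<in> borel_measurable (borel \<Otimes>\<^sub>M lborel)"
      by measurable
    then have "(\<lambda>x. LINT y|lborel. g y * f (y - x)) \<in> borel_measurable borel"
      by (intro lborel.borel_measurable_lebesgue_integral) auto
    then show "(\<lambda>x. g x * cnj (LINT y|lborel. g y * f (y - x))) \<in> borel_measurable lborel"
      by measurable
    show "AE x in lborel. norm (g x * cnj (LINT y|lborel. g y * f (y - x)))
      \<le> norm ((LINT y|lborel. norm (g y) * B) * norm (g x))"
      using inner_le[OF that] B0 by (auto simp: norm_mult abs_mult mult.commute[of "norm (g _)"] intro!: mult_right_mono order_trans[OF _ abs_ge_self])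
  qed
  have "(LINT y|lborel. g y * (h (y - x) - complex_of_real c * k (y - x)))
     = (LINT y|lborel. g y * h (y - x)) - of_real c * (LINT y|lborel. g y * k (y - x))" for x
    using bd_int[of h x] bd_int[of k x] bound
    by (simp add: right_diff_distrib mult.left_commute[of _ "complex_of_real c"])
  then have "kernel_form g (\<lambda>x. h x - complex_of_real c * k x)
     = (LINT x|lborel. g x * cnj (LINT y|lborel. g y * h (y - x)) - of_real c * (g x * cnj (LINT y|lborel. g y * k (y - x))))"
    unfolding kernel_form_def by (simp only:) (simp add: right_diff_distrib mult.left_commute)
  also have "\<dots> = kernel_form g h - of_real c * kernel_form g k"
    unfolding kernel_form_def using out_int[of h] out_int[of k] bound by simp
  finally show "kernel_form g (\<lambda>x. h x - complex_of_real c * k x)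
    = kernel_form g h - of_real c * kernel_form g k" .
qed

text \<open>Integrability is not assumed: the Bochner integral of a non-integrable function is 0 by
  convention.\<close>

lemma ennreal_norm_integral_le:
  fixes f :: "'a \<Rightarrow> 'b::{banach, second_countable_topology}"
  shows "ennreal (norm (integral\<^sup>L M f)) \<le> (\<integral>\<^sup>+x. ennreal (norm (f x)) \<partial>M)"
  by (cases "integrable M f") (auto simp: not_integrable_integral_eq integral_norm_bound_ennreal)

lemma norm_kernel_form_le:
  fixes g :: "'a::euclidean_space \<Rightarrow> complex"
  assumes [measurable]: "g \<in> borel_measurable borel" "k \<in> borel_measurable borel"
  shows "ennreal (norm (kernel_form g k))
    \<le> (\<integral>\<^sup>+x. \<integral>\<^sup>+y. ennreal (norm (g x) * norm (g y) * norm (k (y - x))) \<partial>lborel \<partial>lborel)"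
  unfolding kernel_form_def
proof (rule order_trans[OF ennreal_norm_integral_le nn_integral_mono])
  fix x
  have "ennreal (norm (g x * cnj (LINT y|lborel. g y * k (y - x))))
      = ennreal (norm (g x)) * ennreal (norm (LINT y|lborel. g y * k (y - x)))"
    by (simp add: norm_mult ennreal_mult)
  also have "\<dots> \<le> ennreal (norm (g x)) * (\<integral>\<^sup>+y. ennreal (norm (g y * k (y - x))) \<partial>lborel)"
    by (intro mult_left_mono ennreal_norm_integral_le) simp
  also have "\<dots> = (\<integral>\<^sup>+y. ennreal (norm (g x) * norm (g y) * norm (k (y - x))) \<partial>lborel)"
    by (subst nn_integral_cmult[symmetric]) (auto simp: norm_mult ennreal_mult mult.assoc)
  finally show "ennreal (norm (g x * cnj (LINT y|lborel. g y * k (y - x))))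
    \<le> (\<integral>\<^sup>+y. ennreal (norm (g x) * norm (g y) * norm (k (y - x))) \<partial>lborel)" .
qed

section \<open>Gaussians\<close>

lemma nn_integral_lborel_translate:
  fixes f :: "'a::euclidean_space \<Rightarrow> ennreal"
  assumes [measurable]: "f \<in> borel_measurable borel"
  shows "(\<integral>\<^sup>+x. f (x - c) \<partial>lborel) = (\<integral>\<^sup>+x. f x \<partial>lborel)"
proof -
  have "(\<integral>\<^sup>+x. f x \<partial>lborel) = (\<integral>\<^sup>+x. f x \<partial>distr lborel borel ((+) (- c)))"
    by (simp add: lborel_distr_plus)
  also have "\<dots> = (\<integral>\<^sup>+x. f (x - c) \<partial>lborel)"
    by (subst nn_integral_distr) auto
  finally show ?thesis by simp
qed

lemma integral_lborel_translate:
  fixes f :: "'a::euclidean_space \<Rightarrow> complex"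
  assumes [measurable]: "f \<in> borel_measurable borel"
  shows "(LINT x|lborel. f (x - c)) = (LINT x|lborel. f x)"
proof -
  have "(LINT x|lborel. f x) = (LINT x|distr lborel borel ((+) (- c)). f x)"
    by (simp add: lborel_distr_plus)
  also have "\<dots> = (LINT x|lborel. f (x - c))"
    by (subst integral_distr) auto
  finally show ?thesis by simp
qed

text \<open>Normalised to total mass 1 and concentrated at scale 1 / T; its transform is the cutoff
  \<open>exp (- (pi * (norm v)\<^sup>2 / T\<^sup>2))\<close> at frequency \<open>T\<close>.\<close>

definition gaussian :: "real \<Rightarrow> 'a::euclidean_space \<Rightarrow> real" where
  "gaussian T x = T ^ DIM('a) * exp (- (pi * T\<^sup>2 * (norm x)\<^sup>2))"

lemma borel_measurable_gaussian [measurable]: "gaussian T \<in> borel_measurable borel"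
  unfolding gaussian_def[abs_def] by measurable

lemma gaussian_nonneg: "T > 0 \<Longrightarrow> gaussian T x \<ge> 0"
  by (simp add: gaussian_def)

lemma gaussian_minus_commute: "gaussian T (x - y) = gaussian T (y - x)"
  by (simp add: gaussian_def norm_minus_commute)

text \<open>A rescaling of the characteristic function of the standard normal distribution.\<close>

lemma fourier_gaussian_real:
  fixes T s :: real
  assumes "T > 0"
  shows "(LINT u|lborel. cis (- (2 * pi * (s * u))) * complex_of_real (T * exp (- (pi * T\<^sup>2 * u\<^sup>2))))
    = complex_of_real (exp (- (pi * s\<^sup>2 / T\<^sup>2)))"
proof -
  define c where "c = sqrt (2 * pi) * T"
  define t where "t = - (sqrt (2 * pi) * s / T)"
  have c: "c > 0" using assms by (simp add: c_def)
  have c2: "c\<^sup>2 = 2 * pi * T\<^sup>2" by (simp add: c_def power_mult_distrib)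
  have tc: "t * c = - (2 * pi * s)"
    using assms by (simp add: t_def c_def)
  have t2: "t\<^sup>2 / 2 = pi * s\<^sup>2 / T\<^sup>2"
    using assms by (simp add: t_def power_divide power_mult_distrib)
  have "complex_of_real (exp (- (pi * s\<^sup>2 / T\<^sup>2))) = char std_normal_distribution t"
    by (simp add: char_std_normal_distribution t2[symmetric])
  also have "\<dots> = (LINT x|lborel. std_normal_density x *\<^sub>R iexp (t * x))"
    unfolding char_def by (subst integral_density) (auto simp: normal_density_nonneg)
  also have "\<dots> = \<bar>c\<bar> *\<^sub>R (LINT u|lborel. std_normal_density (0 + c * u) *\<^sub>R iexp (t * (0 + c * u)))"
    using c by (intro lborel_integral_real_affine) simp
  also have "\<dots> = (LINT u|lborel. c *\<^sub>R (std_normal_density (c * u) *\<^sub>R iexp (t * (c * u))))"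
    using c by (simp only: integral_scaleR_right abs_of_pos add_0)
  also have "\<dots> = (LINT u|lborel. cis (- (2 * pi * (s * u))) * complex_of_real (T * exp (- (pi * T\<^sup>2 * u\<^sup>2))))"
  proof (rule Bochner_Integration.integral_cong[OF refl])
    fix u
    have "c * std_normal_density (c * u) = T * exp (- (pi * T\<^sup>2 * u\<^sup>2))"
      by (simp add: std_normal_density_def power_mult_distrib c2) (simp add: c_def)
    moreover have "iexp (t * (c * u)) = cis (- (2 * pi * (s * u)))"
      using tc by (simp add: cis_conv_exp mult.assoc[symmetric])
    ultimately show "c *\<^sub>R (std_normal_density (c * u) *\<^sub>R iexp (t * (c * u)))
      = cis (- (2 * pi * (s * u))) * complex_of_real (T * exp (- (pi * T\<^sup>2 * u\<^sup>2)))"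
      by (simp add: scaleR_conv_of_real mult.commute flip: of_real_mult)
  qed
  finally show ?thesis by simp
qed

lemma norm_square_eq_sum: "(norm x)\<^sup>2 = (\<Sum>b\<in>Basis. (x \<bullet> b)\<^sup>2)"
  by (simp only: power2_norm_eq_inner euclidean_inner[of x x]) (simp add: power2_eq_square)

text \<open>Both the Gaussian and the character factor over the coordinates, and Lebesgue measure is
  the image of a product of one-dimensional ones.\<close>

lemma fourier_gaussian:
  fixes v :: "'a::euclidean_space"
  assumes "T > 0"
  shows "fourier lborel (\<lambda>x. complex_of_real (gaussian T x)) v
    = complex_of_real (exp (- (pi * (norm v)\<^sup>2 / T\<^sup>2)))"
proof -
  interpret product_sigma_finite "\<lambda>_::'a. lborel :: real measure" ..
  define h where "h b u = cis (- (2 * pi * ((v \<bullet> b) * u))) * complex_of_real (T * exp (- (pi * T\<^sup>2 * u\<^sup>2)))"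
    for b :: 'a and u :: real
  have h: "(LINT u|lborel. h b u) = complex_of_real (exp (- (pi * (v \<bullet> b)\<^sup>2 / T\<^sup>2)))" for b
    unfolding h_def by (rule fourier_gaussian_real[OF assms])
  \<comment> \<open>Integrability is read off from the value: a non-integrable function would have
    integral 0, but an exponential is never 0.\<close>
  then have int: "integrable lborel (h b)" for b
    using not_integrable_integral_eq[of lborel "h b"] by fastforce
  have prod_cis: "(\<Prod>b\<in>A. cis (w b)) = cis (\<Sum>b\<in>A. w b)" if "finite A" for A :: "'a set" and w
    using that by induction (auto simp: cis_mult)
  have eq: "cis (- (2 * pi * (v \<bullet> x))) * complex_of_real (gaussian T x) = (\<Prod>b\<in>Basis. h b (x \<bullet> b))" for x :: 'a
  proof -
    have "(\<Prod>b\<in>Basis. h b (x \<bullet> b)) = cis (\<Sum>b\<in>Basis. - (2 * pi * ((v \<bullet> b) * (x \<bullet> b))))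
       * complex_of_real (\<Prod>b\<in>Basis. T * exp (- (pi * T\<^sup>2 * (x \<bullet> b)\<^sup>2)))"
      by (simp add: h_def prod.distrib prod_cis)
    also have "(\<Sum>b\<in>Basis. - (2 * pi * ((v \<bullet> b) * (x \<bullet> b)))) = - (2 * pi * (v \<bullet> x))"
      by (simp add: euclidean_inner[of v x] sum_distrib_left sum_negf)
    also have "(\<Prod>b\<in>Basis. T * exp (- (pi * T\<^sup>2 * (x \<bullet> b)\<^sup>2))) = gaussian T x"
      by (simp add: gaussian_def prod.distrib sum_negf norm_square_eq_sum[of x] sum_distrib_left flip: exp_sum)
    finally show ?thesis by simp
  qed
  have [measurable]: "h b \<in> borel_measurable borel" for b
    unfolding h_def by measurable
  have "fourier lborel (\<lambda>x. complex_of_real (gaussian T x)) v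
      = (LINT x|(distr (\<Pi>\<^sub>M b\<in>Basis. lborel) borel (\<lambda>f. \<Sum>b\<in>Basis. f b *\<^sub>R b)). (\<Prod>b\<in>Basis. h b (x \<bullet> b)))"
    unfolding fourier_def eq by (subst lborel_eq) simp
  also have "\<dots> = (LINT f|(\<Pi>\<^sub>M b\<in>Basis. lborel). (\<Prod>b\<in>Basis. h b ((\<Sum>i\<in>Basis. f i *\<^sub>R i) \<bullet> b)))"
    by (subst integral_distr) auto
  also have "\<dots> = (LINT f|(\<Pi>\<^sub>M b\<in>Basis. lborel). (\<Prod>b\<in>Basis. h b (f b)))"
    by (intro Bochner_Integration.integral_cong prod.cong) auto
  also have "\<dots> = (\<Prod>b\<in>Basis. complex_of_real (exp (- (pi * (v \<bullet> b)\<^sup>2 / T\<^sup>2))))"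
    by (subst product_integral_prod) (auto simp: int h)
  also have "\<dots> = complex_of_real (exp (\<Sum>b\<in>Basis. - (pi * (v \<bullet> b)\<^sup>2 / T\<^sup>2)))"
    by (simp add: exp_sum)
  also have "(\<Sum>b\<in>Basis. - (pi * (v \<bullet> b)\<^sup>2 / T\<^sup>2)) = - (pi * (norm v)\<^sup>2 / T\<^sup>2)"
    by (simp add: norm_square_eq_sum[of v] sum_distrib_left sum_divide_distrib sum_negf)
  finally show ?thesis .
qed

lemma gaussian_integral:
  assumes "T > 0"
  shows "integrable lborel (gaussian T :: 'a::euclidean_space \<Rightarrow> real)"
    and "(\<integral>\<^sup>+x. ennreal (gaussian T (x::'a)) \<partial>lborel) = 1"
proof -
  have *: "(LINT x::'a|lborel. complex_of_real (gaussian T x)) = 1"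
    using fourier_gaussian[OF assms, of "0::'a"] by (simp add: fourier_def)
  \<comment> \<open>Again the non-zero value of the integral forces integrability.\<close>
  then have "integrable lborel (\<lambda>x::'a. complex_of_real (gaussian T x))"
    using not_integrable_integral_eq by fastforce
  then show int: "integrable lborel (gaussian T :: 'a \<Rightarrow> real)"
    by (simp only: complex_of_real_integrable_eq)
  have "(LINT x::'a|lborel. gaussian T x) = 1"
    using * by (simp add: integral_complex_of_real)
  then show "(\<integral>\<^sup>+x. ennreal (gaussian T (x::'a)) \<partial>lborel) = 1"
    by (subst nn_integral_eq_integral[OF int]) (auto simp: gaussian_nonneg[OF assms])
qed


text \<open>Schur's test: bound the product of the two values of \<open>g\<close> by half the sum of
  their squares and integrate the Gaussian, of mass 1, in the other variable.\<close>

lemma gaussian_form_le: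
  fixes g :: "'a::euclidean_space \<Rightarrow> complex"
  assumes "T > 0" and [measurable]: "g \<in> borel_measurable borel"
  shows "(\<integral>\<^sup>+x. \<integral>\<^sup>+y. ennreal (norm (g x) * norm (g y) * gaussian T (y - x)) \<partial>lborel \<partial>lborel)
    \<le> (\<integral>\<^sup>+x. ennreal ((norm (g x))\<^sup>2) \<partial>lborel)" (is "?L \<le> ?I")
proof -
  note nonneg = gaussian_nonneg[OF assms(1)]
  define u where "u x y = ennreal (1/2) * (ennreal ((norm (g x))\<^sup>2) * ennreal (gaussian T (y - x)))" for x y
  have [measurable]: "(\<lambda>(x, y). u x y) \<in> borel_measurable (borel \<Otimes>\<^sub>M borel)"
    unfolding u_def by measurable
  have le: "ennreal (norm (g x) * norm (g y) * gaussian T (y - x)) \<le> u x y + u y x" for x y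
  proof -
    have "norm (g x) * norm (g y) \<le> 1/2 * (norm (g x))\<^sup>2 + 1/2 * (norm (g y))\<^sup>2"
      using sum_squares_bound[of "norm (g x)" "norm (g y)"] by simp
    then have "norm (g x) * norm (g y) * gaussian T (y - x)
      \<le> (1/2 * (norm (g x))\<^sup>2 + 1/2 * (norm (g y))\<^sup>2) * gaussian T (y - x)"
      by (rule mult_right_mono[OF _ nonneg])
    also have "ennreal \<dots> = u x y + u y x"
      by (simp only: u_def gaussian_minus_commute[of T x y] ennreal_mult'[symmetric]
          ennreal_plus[symmetric] nonneg zero_le_mult_iff zero_le_power2 mult_nonneg_nonneg
          distrib_right mult.assoc ennreal_mult[symmetric]) (auto simp: nonneg simp flip: ennreal_mult ennreal_plus)
    finally show ?thesis using ennreal_leI by blast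
  qed
  have u1: "(\<integral>\<^sup>+x. \<integral>\<^sup>+y. u x y \<partial>lborel \<partial>lborel) = ennreal (1/2) * ?I"
  proof -
    have "(\<integral>\<^sup>+y. u x y \<partial>lborel) = ennreal (1/2) * ennreal ((norm (g x))\<^sup>2)" for x
      unfolding u_def
      using nn_integral_lborel_translate[of "\<lambda>y. ennreal (gaussian T y)" x] gaussian_integral(2)[OF assms(1), where 'a='a]
      by (simp add: nn_integral_cmult)
    then show ?thesis by (simp add: nn_integral_cmult)
  qed
  have u2: "(\<integral>\<^sup>+x. \<integral>\<^sup>+y. u y x \<partial>lborel \<partial>lborel) = ennreal (1/2) * ?I"
    by (subst lborel_pair.Fubini') (auto simp: u1)
  have "?L \<le> (\<integral>\<^sup>+x. \<integral>\<^sup>+y. u x y + u y x \<partial>lborel \<partial>lborel)"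
    by (intro nn_integral_mono le)
  also have "\<dots> = ennreal (1/2) * ?I + ennreal (1/2) * ?I"
    by (simp add: nn_integral_add u1 u2)
  also have "\<dots> = (ennreal (1/2) + ennreal (1/2)) * ?I"
    by (simp only: distrib_right)
  also have "ennreal (1/2) + ennreal (1/2) = 1"
    by (subst ennreal_plus[symmetric]) auto
  finally show ?thesis by simp
qed

text \<open>The weight \<open>e n\<close> makes Lebesgue measure finite, and the transform of the
  weighted measure is a Gaussian of mass 1. The quadratic form identity and Schur's test bound the
  weighted integral uniformly in \<open>n\<close>, and Fatou's lemma removes the weight.\<close>

lemma plancherel_le:
  fixes g :: "'a::euclidean_space \<Rightarrow> complex"
  assumes g: "integrable lborel g"
  shows "(\<integral>\<^sup>+\<xi>. ennreal ((norm (fourier lborel g \<xi>))\<^sup>2) \<partial>lborel) \<le> (\<integral>\<^sup>+x. ennreal ((norm (g x))\<^sup>2) \<partial>lborel)"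
    (is "_ \<le> ?I")
proof -
  have [measurable]: "g \<in> borel_measurable borel" using borel_measurable_integrable[OF g] by simp
  have [measurable]: "fourier lborel g \<in> borel_measurable borel"
    by (rule borel_measurable_fourier) (auto intro: lborel.sigma_finite_measure_axioms)
  define e where "e n \<xi> = exp (- (pi * (norm \<xi>)\<^sup>2 / (real (Suc n))\<^sup>2))" for n and \<xi> :: 'a
  have [measurable]: "e n \<in> borel_measurable borel" for n
    unfolding e_def by measurable
  define F where "F n \<xi> = ennreal (e n \<xi>) * ennreal ((norm (fourier lborel g \<xi>))\<^sup>2)" for n \<xi>
  have F_le: "(\<integral>\<^sup>+\<xi>. F n \<xi> \<partial>lborel) \<le> ?I" for n
  proof -
    define T where "T = real (Suc n)"
    have T: "T > 0" by (simp add: T_def)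
    have e: "e n \<xi> = T ^ DIM('a) * gaussian (1 / T) \<xi>" for \<xi>
      using T unfolding e_def gaussian_def T_def[symmetric] by (simp add: power_divide)
    define \<nu> where "\<nu> = density lborel (\<lambda>\<xi>::'a. ennreal (e n \<xi>))"
    have fin: "finite_measure \<nu>"
    proof
      have "emeasure \<nu> (space \<nu>) = (\<integral>\<^sup>+\<xi>. ennreal (e n \<xi>) \<partial>lborel)"
        by (simp add: \<nu>_def emeasure_density)
      also have "\<dots> = ennreal (T ^ DIM('a)) * (\<integral>\<^sup>+\<xi>. ennreal (gaussian (1 / T) (\<xi>::'a)) \<partial>lborel)"
        unfolding e using T by (subst nn_integral_cmult[symmetric]) (auto simp: ennreal_mult gaussian_nonneg)
      finally show "emeasure \<nu> (space \<nu>) \<noteq> \<infinity>"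
        using gaussian_integral(2)[of "1 / T", where 'a='a] T by simp
    qed
    have ft: "fourier \<nu> (\<lambda>_. 1) v = complex_of_real (gaussian T v)" for v
    proof -
      have "fourier \<nu> (\<lambda>_. 1) v = (LINT \<xi>|lborel. e n \<xi> *\<^sub>R cis (- (2 * pi * (v \<bullet> \<xi>))))"
        unfolding fourier_def \<nu>_def by (subst integral_density) (auto simp: e_def)
      also have "\<dots> = (LINT \<xi>|lborel. complex_of_real (T ^ DIM('a)) * (cis (- (2 * pi * (v \<bullet> \<xi>))) * complex_of_real (gaussian (1 / T) \<xi>)))"
        by (simp add: e scaleR_conv_of_real mult_ac)
      also have "\<dots> = complex_of_real (T ^ DIM('a)) * fourier lborel (\<lambda>\<xi>. complex_of_real (gaussian (1 / T) \<xi>)) v"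
        unfolding fourier_def by (rule integral_mult_right_zero)
      also have "\<dots> = complex_of_real (gaussian T v)"
        by (subst fourier_gaussian) (use T in \<open>auto simp: gaussian_def power_divide mult_ac\<close>)
      finally show ?thesis .
    qed
    have sets: "sets \<nu> = sets borel" by (simp add: \<nu>_def)
    have "(\<integral>\<^sup>+\<xi>. F n \<xi> \<partial>lborel) = (\<integral>\<^sup>+\<xi>. ennreal ((norm (fourier lborel g \<xi>))\<^sup>2) \<partial>\<nu>)"
      unfolding \<nu>_def F_def by (subst nn_integral_density) auto
    also have "\<dots> = ennreal (LINT \<xi>|\<nu>. (norm (fourier lborel g \<xi>))\<^sup>2)"
      by (rule nn_integral_eq_integral[OF integral_norm_fourier_square(2)[OF fin sets g]]) simp
    also have "\<dots> = ennreal (norm (complex_of_real (LINT \<xi>|\<nu>. (norm (fourier lborel g \<xi>))\<^sup>2)))"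
      by (simp only: norm_of_real) (simp add: abs_of_nonneg)
    also have "\<dots> = ennreal (norm (kernel_form g (\<lambda>v. complex_of_real (gaussian T v))))"
      unfolding integral_norm_fourier_square(1)[OF fin sets g] ft[abs_def] ..
    also have "\<dots> \<le> (\<integral>\<^sup>+x. \<integral>\<^sup>+y. ennreal (norm (g x) * norm (g y) * norm (complex_of_real (gaussian T (y - x)))) \<partial>lborel \<partial>lborel)"
      by (rule norm_kernel_form_le) auto
    also have "\<dots> = (\<integral>\<^sup>+x. \<integral>\<^sup>+y. ennreal (norm (g x) * norm (g y) * gaussian T (y - x)) \<partial>lborel \<partial>lborel)"
      by (simp add: gaussian_nonneg[OF T] abs_of_nonneg)
    also have "\<dots> \<le> ?I" by (rule gaussian_form_le[OF T]) simp
    finally show ?thesis .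
  qed
  have lim: "(\<lambda>n. F n \<xi>) \<longlonglongrightarrow> ennreal ((norm (fourier lborel g \<xi>))\<^sup>2)" for \<xi>
  proof -
    have "(\<lambda>n. 1 / (real (Suc n))\<^sup>2) \<longlonglongrightarrow> 0" by real_asymp
    then have "(\<lambda>n. - (pi * (norm \<xi>)\<^sup>2 * (1 / (real (Suc n))\<^sup>2))) \<longlonglongrightarrow> - (pi * (norm \<xi>)\<^sup>2 * 0)"
      by (intro tendsto_intros)
    then have "(\<lambda>n. e n \<xi>) \<longlonglongrightarrow> 1"
      unfolding e_def using tendsto_exp by fastforce
    then have "(\<lambda>n. ennreal (e n \<xi> * (norm (fourier lborel g \<xi>))\<^sup>2)) \<longlonglongrightarrow> ennreal (1 * (norm (fourier lborel g \<xi>))\<^sup>2)"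
      by (intro tendsto_intros)
    then show ?thesis by (simp add: F_def ennreal_mult e_def)
  qed
  have "(\<integral>\<^sup>+\<xi>. ennreal ((norm (fourier lborel g \<xi>))\<^sup>2) \<partial>lborel) = (\<integral>\<^sup>+\<xi>. liminf (\<lambda>n. F n \<xi>) \<partial>lborel)"
    using lim_imp_Liminf[OF sequentially_bot lim] by simp
  also have "\<dots> \<le> liminf (\<lambda>n. \<integral>\<^sup>+\<xi>. F n \<xi> \<partial>lborel)"
    unfolding F_def by (rule nn_integral_liminf) measurable
  also have "\<dots> \<le> liminf (\<lambda>n. ?I)"
    by (intro Liminf_mono) (auto simp: F_le)
  also have "\<dots> = ?I" by (simp add: Liminf_const)
  finally show ?thesis .
qed

section \<open>Measures with a Frostman bound\<close>

text \<open>Cut space into shells of width \<open>t\<close> around \<open>x\<close>: on the n-th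
  shell the integrand is at most \<open>h (real n)\<close>, and the shell lies in the ball of radius
  (n + 1) t. This serves both for averages of \<mu> and, with Lebesgue measure, for the decay of
  Schwartz functions.\<close>

lemma nn_integral_radial_le:
  fixes M :: "'a::euclidean_space measure" and h :: "real \<Rightarrow> real"
  assumes [measurable_cong]: "sets M = sets borel"
    and ball: "\<And>x r. r > 0 \<Longrightarrow> emeasure M (ball x r) \<le> ennreal (C * r powr a)" and C: "C \<ge> 0"
    and nonneg: "\<And>u. h u \<ge> 0" and decr: "\<And>u v. 0 \<le> u \<Longrightarrow> u \<le> v \<Longrightarrow> h v \<le> h u"
    and sum: "summable (\<lambda>n. h (real n) * (real n + 1) powr a)"
    and t: "t > 0"
  shows "(\<integral>\<^sup>+y. ennreal (h (dist x y / t)) \<partial>M)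
    \<le> ennreal (C * (\<Sum>n. h (real n) * (real n + 1) powr a) * t powr a)"
proof -
  define S where "S = (\<Sum>n. h (real n) * (real n + 1) powr a)"
  have [measurable]: "ball x r \<in> sets M" for r
    by (simp add: assms(1))
  have single: "F n \<le> (\<Sum>n. F n)" for F :: "nat \<Rightarrow> ennreal" and n
    using sum_le_suminf[of F "{n}"] by simp
  have le: "ennreal (h (dist x y / t)) \<le> (\<Sum>n. ennreal (h (real n)) * indicator (ball x ((real n + 1) * t)) y)" for y
  proof -
    define n where "n = nat \<lfloor>dist x y / t\<rfloor>"
    have n: "real n \<le> dist x y / t" "dist x y / t < real n + 1"
      using t by (simp_all add: n_def of_nat_floor)
    then have "ennreal (h (dist x y / t)) \<le> ennreal (h (real n)) * indicator (ball x ((real n + 1) * t)) y"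
      using t by (auto simp: field_simps intro!: ennreal_leI decr)
    also have "\<dots> \<le> (\<Sum>n. ennreal (h (real n)) * indicator (ball x ((real n + 1) * t)) y)"
      by (rule single)
    finally show ?thesis .
  qed
  have "(\<integral>\<^sup>+y. ennreal (h (dist x y / t)) \<partial>M)
      \<le> (\<integral>\<^sup>+y. (\<Sum>n. ennreal (h (real n)) * indicator (ball x ((real n + 1) * t)) y) \<partial>M)"
    by (intro nn_integral_mono le)
  also have "\<dots> = (\<Sum>n. ennreal (h (real n)) * emeasure M (ball x ((real n + 1) * t)))"
    by (subst nn_integral_suminf, measurable) (simp add: nn_integral_cmult_indicator)
  also have "\<dots> \<le> (\<Sum>n. ennreal (C * t powr a * (h (real n) * (real n + 1) powr a)))"
  proof (intro suminf_le summableI)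
    fix n
    have "ennreal (h (real n)) * emeasure M (ball x ((real n + 1) * t))
      \<le> ennreal (h (real n)) * ennreal (C * ((real n + 1) * t) powr a)"
      using t by (intro mult_left_mono ball) auto
    also have "\<dots> = ennreal (C * t powr a * (h (real n) * (real n + 1) powr a))"
      using t C nonneg by (simp add: powr_mult mult_ac flip: ennreal_mult)
    finally show "ennreal (h (real n)) * emeasure M (ball x ((real n + 1) * t))
      \<le> ennreal (C * t powr a * (h (real n) * (real n + 1) powr a))" .
  qed
  also have "\<dots> = ennreal (C * t powr a * S)"
    unfolding S_def using sum C nonneg
    by (subst suminf_ennreal2) (auto intro: summable_mult simp: suminf_mult)
  finally show ?thesis by (simp add: S_def mult_ac)
qed

text \<open>The Gaussian has height T ^ d and lives on a ball of radius 1 / T, which has mass O(T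
  powr (- a)); the tails contribute a convergent series.\<close>

lemma frostman_gaussian_average:
  fixes \<mu> :: "'a::euclidean_space measure"
  assumes fin: "finite_measure \<mu>" and sets: "sets \<mu> = sets borel"
    and ball: "\<And>x r. r > 0 \<Longrightarrow> measure \<mu> (ball x r) \<le> C * r powr a" and C: "C \<ge> 0"
  obtains B where "B > 0"
    "\<And>T x. T > 0 \<Longrightarrow> (LINT y|\<mu>. gaussian T (x - y)) \<le> B * T powr (real DIM('a) - a)"
proof -
  interpret finite_measure \<mu> by fact
  note [measurable_cong] = sets
  define h where "h u = exp (- (pi * u\<^sup>2))" for u :: real
  define S where "S = (\<Sum>n. h (real n) * (real n + 1) powr a)"
  have sum: "summable (\<lambda>n. h (real n) * (real n + 1) powr a)"
  proof (rule summable_comparison_test_bigo[where g = "\<lambda>n. 1 / real n ^ 2"])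
    show "summable (\<lambda>n. norm (1 / real n ^ 2))"
      using inverse_power_summable[of 2, where 'a=real] by (simp add: inverse_eq_divide)
    show "(\<lambda>n. h (real n) * (real n + 1) powr a) \<in> O(\<lambda>n. 1 / real n ^ 2)"
      unfolding h_def by real_asymp
  qed
  have decr: "h v \<le> h u" if "0 \<le> u" "u \<le> v" for u v
    using that by (simp add: h_def power_mono)
  have S: "S \<ge> 0" unfolding S_def using sum by (intro suminf_nonneg) (auto simp: h_def)
  show thesis
  proof
    show "C * S + 1 > 0" using C S by (simp add: add_nonneg_pos)
    fix T :: real and x :: 'a assume T: "T > 0"
    have int: "integrable \<mu> (\<lambda>y. gaussian T (x - y))"
      by (rule integrable_const_bound[where B="T ^ DIM('a)"]) (use T in \<open>auto simp: gaussian_def abs_mult\<close>)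
    have g: "gaussian T (x - y) = T ^ DIM('a) * h (dist x y / (1 / T))" for y
      by (simp add: gaussian_def h_def dist_norm power_mult_distrib mult_ac)
    have "ennreal (LINT y|\<mu>. gaussian T (x - y)) = (\<integral>\<^sup>+y. ennreal (gaussian T (x - y)) \<partial>\<mu>)"
      by (rule nn_integral_eq_integral[OF int, symmetric]) (auto simp: gaussian_nonneg[OF T])
    also have "\<dots> = ennreal (T ^ DIM('a)) * (\<integral>\<^sup>+y. ennreal (h (dist x y / (1 / T))) \<partial>\<mu>)"
      unfolding g using T by (subst nn_integral_cmult[symmetric]) (auto simp: ennreal_mult h_def)
    also have "\<dots> \<le> ennreal (T ^ DIM('a)) * ennreal (C * S * (1 / T) powr a)"
      unfolding S_def using T C ball sum decr
      by (intro mult_left_mono nn_integral_radial_le[OF sets]) (auto simp: emeasure_eq_measure h_def intro!: ennreal_leI)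
    also have "\<dots> = ennreal (C * S * T powr (real DIM('a) - a))"
      using T C S by (simp add: powr_diff powr_realpow powr_divide mult_ac flip: ennreal_mult)
    also have "\<dots> \<le> ennreal ((C * S + 1) * T powr (real DIM('a) - a))"
      by (intro ennreal_leI mult_right_mono) auto
    finally show "(LINT y|\<mu>. gaussian T (x - y)) \<le> (C * S + 1) * T powr (real DIM('a) - a)"
      using C S by (subst (asm) ennreal_le_iff) auto
  qed
qed

text \<open>Smoothing \<open>\<mu>\<close> at scale \<open>1 / T\<close> gives a measure with a bounded density, to which Plancherel applies.\<close>

lemma frostman_low_frequency:
  fixes \<mu> :: "'a::euclidean_space measure"
  assumes fin: "finite_measure \<mu>" and sets: "sets \<mu> = sets borel"
    and ball: "\<And>x r. r > 0 \<Longrightarrow> measure \<mu> (ball x r) \<le> C * r powr a" and C: "C \<ge> 0"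
  obtains B where "B > 0"
    "\<And>T g. T > 0 \<Longrightarrow> integrable lborel g \<Longrightarrow>
       ennreal (norm (kernel_form g (\<lambda>v. complex_of_real (exp (- (pi * (norm v)\<^sup>2 / T\<^sup>2))) * fourier \<mu> (\<lambda>_. 1) v)))
       \<le> ennreal (B * T powr (real DIM('a) - a)) * (\<integral>\<^sup>+x. ennreal ((norm (g x))\<^sup>2) \<partial>lborel)"
proof -
  interpret finite_measure \<mu> by fact
  note [measurable_cong] = sets
  obtain B where B: "B > 0"
    and w_le: "\<And>T x. T > 0 \<Longrightarrow> (LINT y|\<mu>. gaussian T (x - y)) \<le> B * T powr (real DIM('a) - a)"
    using frostman_gaussian_average[OF fin sets ball C] by blast
  show thesis
  proof (rule that[OF B])
    fix T :: real and g :: "'a \<Rightarrow> complex" assume T: "T > 0" and g: "integrable lborel g"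
    interpret pair_sigma_finite \<mu> "lborel :: 'a measure" ..
    have [measurable]: "g \<in> borel_measurable borel" using borel_measurable_integrable[OF g] by simp
    have [measurable]: "fourier lborel g \<in> borel_measurable borel"
      by (rule borel_measurable_fourier) (auto intro: lborel.sigma_finite_measure_axioms)
    define w where "w x = (LINT y|\<mu>. gaussian T (x - y))" for x :: 'a
    have [measurable]: "w \<in> borel_measurable borel"
      unfolding w_def by measurable
    have w_nonneg: "w x \<ge> 0" for x
      unfolding w_def by (simp add: gaussian_nonneg[OF T])
    have int: "integrable \<mu> (\<lambda>y. gaussian T (x - y))" for x
      by (rule integrable_const_bound[where B="T ^ DIM('a)"]) (use T in \<open>auto simp: gaussian_def abs_mult\<close>)
    have ew: "ennreal (w x) = (\<integral>\<^sup>+y. ennreal (gaussian T (x - y)) \<partial>\<mu>)" for x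
      unfolding w_def by (rule nn_integral_eq_integral[OF int, symmetric]) (auto simp: gaussian_nonneg[OF T])
    define \<nu> where "\<nu> = density lborel (\<lambda>x. ennreal (w x))"
    have sets\<nu>: "sets \<nu> = sets borel" by (simp add: \<nu>_def)
    have trans: "(\<integral>\<^sup>+x. ennreal (gaussian T (x - y)) \<partial>lborel) = 1" for y :: 'a
      using nn_integral_lborel_translate[of "\<lambda>x. ennreal (gaussian T x)" y] gaussian_integral(2)[OF T, where 'a='a] by simp
    have fin\<nu>: "finite_measure \<nu>"
    proof
      have "emeasure \<nu> (space \<nu>) = (\<integral>\<^sup>+x. ennreal (w x) \<partial>lborel)"
        by (simp add: \<nu>_def emeasure_density)
      also have "\<dots> = (\<integral>\<^sup>+y. \<integral>\<^sup>+x. ennreal (gaussian T (x - y)) \<partial>lborel \<partial>\<mu>)"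
        unfolding ew by (rule Fubini') measurable
      also have "\<dots> = emeasure \<mu> (space \<mu>)" by (simp add: trans)
      finally show "emeasure \<nu> (space \<nu>) \<noteq> \<infinity>" by (simp add: emeasure_eq_measure)
    qed
    have ft: "fourier \<nu> (\<lambda>_. 1) v = complex_of_real (exp (- (pi * (norm v)\<^sup>2 / T\<^sup>2))) * fourier \<mu> (\<lambda>_. 1) v" for v
    proof -
      define F where "F y x = cis (- (2 * pi * (v \<bullet> x))) * complex_of_real (gaussian T (x - y))" for x y
      have intF: "integrable lborel (\<lambda>x. F y x)" for y
      proof (rule integrableI_bounded)
        have "(\<integral>\<^sup>+x. ennreal (norm (F y x)) \<partial>lborel) = 1"
          unfolding trans[of y, symmetric] by (simp add: gaussian_nonneg[OF T] F_def norm_mult abs_of_nonneg)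
        then show "(\<integral>\<^sup>+x. ennreal (norm (F y x)) \<partial>lborel) < \<infinity>" by simp
      qed (simp add: F_def)
      have normF: "(LINT x|lborel. norm (F y x)) = 1" for y
      proof -
        have "ennreal (LINT x|lborel. norm (F y x)) = (\<integral>\<^sup>+x. ennreal (norm (F y x)) \<partial>lborel)"
          by (rule nn_integral_eq_integral[symmetric]) (use intF in auto)
        also have "\<dots> = 1"
          unfolding trans[of y, symmetric] by (simp add: gaussian_nonneg[OF T] F_def norm_mult abs_of_nonneg)
        finally show ?thesis by simp
      qed
      have intP: "integrable (\<mu> \<Otimes>\<^sub>M lborel) (\<lambda>(y, x). F y x)"
        by (rule Fubini_integrable) (auto simp: normF intF, simp add: F_def)
      have inner: "(LINT x|lborel. F y x) = cis (- (2 * pi * (v \<bullet> y))) * complex_of_real (exp (- (pi * (norm v)\<^sup>2 / T\<^sup>2)))" for y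
      proof -
        have "(LINT x|lborel. F y x)
            = (LINT x|lborel. (\<lambda>x. cis (- (2 * pi * (v \<bullet> y))) * (cis (- (2 * pi * (v \<bullet> x))) * complex_of_real (gaussian T x))) (x - y))"
        proof (rule Bochner_Integration.integral_cong[OF refl])
          fix x
          have "cis (- (2 * pi * (v \<bullet> y))) * cis (- (2 * pi * (v \<bullet> (x - y)))) = cis (- (2 * pi * (v \<bullet> x)))"
            by (simp add: cis_mult inner_diff_right right_diff_distrib)
          then show "F y x = (\<lambda>x. cis (- (2 * pi * (v \<bullet> y))) * (cis (- (2 * pi * (v \<bullet> x))) * complex_of_real (gaussian T x))) (x - y)"
            by (simp add: F_def flip: mult.assoc)
        qed
        also have "\<dots> = (LINT x|lborel. cis (- (2 * pi * (v \<bullet> y))) * (cis (- (2 * pi * (v \<bullet> x))) * complex_of_real (gaussian T x)))"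
          by (rule integral_lborel_translate) measurable
        also have "\<dots> = cis (- (2 * pi * (v \<bullet> y))) * fourier lborel (\<lambda>x. complex_of_real (gaussian T x)) v"
          unfolding fourier_def by (rule integral_mult_right_zero)
        finally show ?thesis by (simp add: fourier_gaussian[OF T])
      qed
      have "fourier \<nu> (\<lambda>_. 1) v = (LINT x|lborel. w x *\<^sub>R cis (- (2 * pi * (v \<bullet> x))))"
        unfolding fourier_def \<nu>_def by (subst integral_density) (auto simp: w_nonneg)
      also have "\<dots> = (LINT x|lborel. LINT y|\<mu>. F y x)"
        by (simp add: w_def F_def scaleR_conv_of_real mult.commute[of "complex_of_real _"])
      also have "\<dots> = (LINT y|\<mu>. LINT x|lborel. F y x)"
        using Fubini_integral[OF intP] by simp
      also have "\<dots> = complex_of_real (exp (- (pi * (norm v)\<^sup>2 / T\<^sup>2))) * fourier \<mu> (\<lambda>_. 1) v"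
        unfolding inner fourier_def by (simp add: mult.commute)
      finally show ?thesis .
    qed
    have "ennreal (norm (kernel_form g (\<lambda>v. complex_of_real (exp (- (pi * (norm v)\<^sup>2 / T\<^sup>2))) * fourier \<mu> (\<lambda>_. 1) v)))
        = ennreal (norm (complex_of_real (LINT \<xi>|\<nu>. (norm (fourier lborel g \<xi>))\<^sup>2)))"
      unfolding integral_norm_fourier_square(1)[OF fin\<nu> sets\<nu> g] ft[abs_def] ..
    also have "\<dots> = ennreal (LINT \<xi>|\<nu>. (norm (fourier lborel g \<xi>))\<^sup>2)"
      by (simp only: norm_of_real) (simp add: abs_of_nonneg)
    also have "\<dots> = (\<integral>\<^sup>+\<xi>. ennreal ((norm (fourier lborel g \<xi>))\<^sup>2) \<partial>\<nu>)"
      by (rule nn_integral_eq_integral[OF integral_norm_fourier_square(2)[OF fin\<nu> sets\<nu> g], symmetric]) simp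
    also have "\<dots> = (\<integral>\<^sup>+\<xi>. ennreal (w \<xi>) * ennreal ((norm (fourier lborel g \<xi>))\<^sup>2) \<partial>lborel)"
      unfolding \<nu>_def by (subst nn_integral_density) auto
    also have "\<dots> \<le> (\<integral>\<^sup>+\<xi>. ennreal (B * T powr (real DIM('a) - a)) * ennreal ((norm (fourier lborel g \<xi>))\<^sup>2) \<partial>lborel)"
      by (intro nn_integral_mono mult_right_mono ennreal_leI) (auto simp: w_def w_le[OF T])
    also have "\<dots> = ennreal (B * T powr (real DIM('a) - a)) * (\<integral>\<^sup>+\<xi>. ennreal ((norm (fourier lborel g \<xi>))\<^sup>2) \<partial>lborel)"
      by (simp add: nn_integral_cmult)
    also have "\<dots> \<le> ennreal (B * T powr (real DIM('a) - a)) * (\<integral>\<^sup>+x. ennreal ((norm (g x))\<^sup>2) \<partial>lborel)"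
      by (intro mult_left_mono plancherel_le g) simp
    finally show "ennreal (norm (kernel_form g (\<lambda>v. complex_of_real (exp (- (pi * (norm v)\<^sup>2 / T\<^sup>2))) * fourier \<mu> (\<lambda>_. 1) v)))
       \<le> ennreal (B * T powr (real DIM('a) - a)) * (\<integral>\<^sup>+x. ennreal ((norm (g x))\<^sup>2) \<partial>lborel)" .
  qed
qed

section \<open>The high frequencies\<close>

text \<open>Since 1 - exp (- u) is at most u and at most 1, its k-th power is dominated by every
  power of u of order between 0 and k. The case u = 0 uses \<open>0 < k\<close>, because
  \<open>0 powr \<kappa>\<close> is 0 even for \<kappa> = 0.\<close>

lemma one_minus_exp_power_le:
  fixes u :: real
  assumes "0 \<le> u" "0 \<le> \<kappa>" "\<kappa> \<le> real k" "0 < k"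
  shows "(1 - exp (- u)) ^ k \<le> u powr \<kappa>"
proof (cases "u = 0")
  case False
  have e: "0 \<le> 1 - exp (- u)" "1 - exp (- u) \<le> u" "1 - exp (- u) \<le> 1"
    using assms(1) exp_ge_add_one_self[of "- u"] by auto
  show ?thesis
  proof (cases "u \<le> 1")
    case True
    have "(1 - exp (- u)) ^ k \<le> u ^ k" by (intro power_mono e)
    also have "\<dots> = u powr real k" using False assms by (simp add: powr_realpow)
    also have "\<dots> \<le> u powr \<kappa>" using True assms by (intro powr_mono') auto
    finally show ?thesis .
  next
    case False
    have "(1 - exp (- u)) ^ k \<le> 1" by (intro power_le_one e)
    also have "\<dots> \<le> u powr \<kappa>" using False assms by (intro ge_one_powr_ge_zero) auto
    finally show ?thesis .
  qed
qed (use assms in \<open>simp add: zero_power\<close>)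

lemma power2_powr: "x \<ge> 0 \<Longrightarrow> (x\<^sup>2) powr \<kappa> = x powr (2 * \<kappa>)" for x \<kappa> :: real
proof (cases "x = 0")
  case False
  assume "x \<ge> 0"
  with False have "x\<^sup>2 = x powr 2" by simp
  then show ?thesis by (simp only: powr_powr)
qed simp

text \<open>Above the threshold, x = x powr (1 - p) * x powr p, and the first factor decreases in x
  because 1 - p \<le> 0.\<close>

lemma young_threshold:
  fixes b p x :: real
  assumes "b > 0" "p \<ge> 1" "x \<ge> 0"
  shows "x \<le> b + b powr (1 - p) * x powr p"
proof (cases "x \<le> b")
  case True
  then show ?thesis using assms by (simp add: add_increasing2)
next
  case False
  have "x = x powr (1 - p) * x powr p" using False assms by (simp flip: powr_add)
  also have "x powr (1 - p) \<le> b powr (1 - p)" using False assms by (intro powr_mono2') auto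
  finally have "x \<le> b powr (1 - p) * x powr p" by (simp add: mult_right_mono)
  then show ?thesis using assms by simp
qed

text \<open>The constant part of the kernel bound costs \<open>b\<close> on each pair in E x E. For
  the part \<open>h\<close>, only |g y| \<le> 1 is used: integrating over all y gives
  \<open>H\<close> for each x in \<open>E\<close>, which makes that term linear in
  \<open>N\<close>.\<close>

lemma restricted_form_le:
  fixes g k :: "'a::euclidean_space \<Rightarrow> complex"
  assumes [measurable]: "E \<in> sets borel" "g \<in> borel_measurable borel" "k \<in> borel_measurable borel"
    and E: "emeasure lborel E = ennreal N" "N \<ge> 0"
    and g: "\<And>x. norm (g x) \<le> indicator E x"
    and k: "\<And>v. norm (k v) \<le> b + h v" and b: "b \<ge> 0" and h: "\<And>v. h v \<ge> 0"
    and [measurable]: "h \<in> borel_measurable borel"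
    and I: "(\<integral>\<^sup>+v. ennreal (h v) \<partial>lborel) \<le> ennreal H" and H: "H \<ge> 0"
  shows "norm (kernel_form g k) \<le> b * N\<^sup>2 + H * N"
proof -
  define i where "i x = (indicator E x :: ennreal)" for x
  have [measurable]: "i \<in> borel_measurable borel" unfolding i_def by measurable
  have int_i: "(\<integral>\<^sup>+x. i x \<partial>lborel) = ennreal N"
    unfolding i_def using E by simp
  have "ennreal (norm (kernel_form g k))
    \<le> (\<integral>\<^sup>+x. \<integral>\<^sup>+y. ennreal (norm (g x) * norm (g y) * norm (k (y - x))) \<partial>lborel \<partial>lborel)"
    by (rule norm_kernel_form_le) auto
  also have "\<dots> \<le> (\<integral>\<^sup>+x. \<integral>\<^sup>+y. i x * (ennreal b * i y + ennreal (h (y - x))) \<partial>lborel \<partial>lborel)"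
  proof (intro nn_integral_mono)
    fix x y
    have "norm (g y) \<le> 1" using g[of y] by (auto split: split_indicator_asm)
    then have "norm (g y) * norm (k (y - x)) \<le> norm (g y) * b + h (y - x)"
      using mult_left_mono[OF k[of "y - x"] norm_ge_zero[of "g y"]] mult_right_mono[of "norm (g y)" 1 "h (y - x)"] h[of "y - x"]
      by (simp add: distrib_left)
    also have "norm (g y) * b \<le> indicator E y * b"
      by (intro mult_right_mono g b)
    finally have "norm (g y) * norm (k (y - x)) \<le> b * indicator E y + h (y - x)"
      by (simp add: mult.commute)
    with g[of x] have "norm (g x) * (norm (g y) * norm (k (y - x))) \<le> indicator E x * (b * indicator E y + h (y - x))"
      by (intro mult_mono) auto
    then have "ennreal (norm (g x) * norm (g y) * norm (k (y - x))) \<le> ennreal (indicator E x * (b * indicator E y + h (y - x)))"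
      by (intro ennreal_leI) (simp add: mult.assoc)
    also have "\<dots> = i x * (ennreal b * i y + ennreal (h (y - x)))"
      using b h by (simp add: i_def ennreal_mult ennreal_plus ennreal_indicator)
    finally show "ennreal (norm (g x) * norm (g y) * norm (k (y - x))) \<le> i x * (ennreal b * i y + ennreal (h (y - x)))" .
  qed
  also have "\<dots> = (\<integral>\<^sup>+x. i x * (ennreal b * ennreal N + (\<integral>\<^sup>+v. ennreal (h v) \<partial>lborel)) \<partial>lborel)"
    using nn_integral_lborel_translate[of "\<lambda>v. ennreal (h v)"]
    by (simp add: nn_integral_cmult nn_integral_add int_i)
  also have "\<dots> = ennreal N * (ennreal b * ennreal N + (\<integral>\<^sup>+v. ennreal (h v) \<partial>lborel))"
    by (simp add: nn_integral_multc int_i)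
  also have "\<dots> \<le> ennreal N * (ennreal b * ennreal N + ennreal H)"
    by (intro mult_left_mono add_mono I) auto
  also have "\<dots> = ennreal (b * N\<^sup>2 + H * N)"
    using E b H by (simp add: power2_eq_square algebra_simps flip: ennreal_mult ennreal_plus)
  finally show ?thesis
    using E b H by (subst (asm) ennreal_le_iff) auto
qed

text \<open>
  With \<open>p = 2 / \<theta>\<close> and \<open>A = s / \<theta> - d\<close>, the choice of \<open>R\<close> balances the cost \<open>R powr (d - a)\<close> of the
  low frequencies against the cost \<open>l powr (2 - 2 * p) / R powr A\<close> of the high ones.
\<close>

lemma fourier_energy_high_frequency:
  fixes \<mu> :: "'a::euclidean_space measure"
  assumes fin: "finite_measure \<mu>" and sets: "sets \<mu> = sets borel"
    and \<theta>: "0 \<le> \<theta>" "\<theta> \<le> 1" and s: "s > real DIM('a) * \<theta>" and a: "a < real DIM('a)"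
    and energy: "fourier_energy s \<theta> \<mu> < \<infinity>"
    and q0: "q0 = 2 + 2 * ((real DIM('a) - a) * (2 - \<theta>) / (s - a * \<theta>))"
  obtains k B where "k > 0" "B > 0"
    "\<And>l. l > 0 \<Longrightarrow> \<exists>R>0. R powr (real DIM('a) - a) \<le> B * l powr (2 - q0) \<and>
       (\<forall>E g N. E \<in> sets borel \<longrightarrow> g \<in> borel_measurable borel \<longrightarrow> emeasure lborel E = ennreal N \<longrightarrow> N \<ge> 0 \<longrightarrow>
         (\<forall>x. norm (g x) \<le> indicator E x) \<longrightarrow>
         norm (kernel_form g (\<lambda>v. complex_of_real ((1 - exp (- (pi * (norm v)\<^sup>2 / R\<^sup>2))) ^ k) * fourier \<mu> (\<lambda>_. 1) v))
           \<le> l\<^sup>2 / 2 * N\<^sup>2 + B * l powr (2 - q0) * N)"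
proof -
  interpret finite_measure \<mu> by fact
  define d where "d = real DIM('a)"
  define m where "m = fourier \<mu> (\<lambda>_. 1)"
  have [measurable]: "m \<in> borel_measurable borel"
    unfolding m_def by (rule borel_measurable_fourier) (auto intro: sigma_finite_measure_axioms simp: sets)
  have d: "d > 0" by (simp add: d_def)
  have e01: "0 \<le> 1 - exp (- (pi * (norm v)\<^sup>2 / R\<^sup>2))" for v :: 'a and R
    by simp
  \<comment> \<open>Trades the high-pass factor for the weight |v| powr (2 \<kappa>) at the price R
    powr (- 2 \<kappa>); \<kappa> is chosen later to match the weight in the energy.\<close>
  have split: "(1 - exp (- (pi * (norm v)\<^sup>2 / R\<^sup>2))) ^ j \<le> pi powr \<kappa> * R powr (- (2 * \<kappa>)) * norm v powr (2 * \<kappa>)"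
    if "0 \<le> \<kappa>" "\<kappa> \<le> real j" "0 < j" "R > 0" for v :: 'a and R \<kappa> j
  proof -
    have "(1 - exp (- (pi * (norm v)\<^sup>2 / R\<^sup>2))) ^ j \<le> (pi * (norm v)\<^sup>2 / R\<^sup>2) powr \<kappa>"
      using that by (intro one_minus_exp_power_le) auto
    also have "\<dots> = pi powr \<kappa> * R powr (- (2 * \<kappa>)) * norm v powr (2 * \<kappa>)"
      using that by (simp add: powr_divide powr_mult power2_powr powr_minus_divide)
    finally show ?thesis .
  qed
  show thesis
  proof (cases "\<theta> = 0")
    case True
    have s0: "s > 0" using s True by simp
    have q0': "q0 = 2 + 4 * (d - a) / s" using q0 True by (simp add: d_def)
    obtain J where J: "J > 0" "\<And>v. norm (m v) * norm v powr (s / 2) \<le> J"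
    proof -
      define J where "J = enn2real (fourier_energy s 0 \<mu>)"
      have "norm (m v) * norm v powr (s / 2) \<le> sqrt J + 1" for v
      proof -
        have "ennreal (norm (m v) ^ 2 * norm v powr s) \<le> fourier_energy s 0 \<mu>"
          unfolding fourier_energy_def m_def by (auto intro: SUP_upper)
        also have "\<dots> = ennreal J"
          using energy True by (simp add: J_def less_top)
        finally have "norm (m v) ^ 2 * norm v powr s \<le> J"
          by (subst (asm) ennreal_le_iff) (auto simp: J_def)
        then have "(norm (m v) * norm v powr (s / 2))\<^sup>2 \<le> J"
          by (simp add: power_mult_distrib power2_eq_square[of "_ powr _"] flip: powr_add)
        then show ?thesis using real_le_rsqrt by fastforce
      qed
      then show thesis using that[of "sqrt J + 1"] by (simp add: J_def add_nonneg_pos)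
    qed
    define k where "k = nat \<lceil>s\<rceil>"
    have k: "k > 0" "s / 4 \<le> real k" using s0 by (auto simp: k_def) linarith
    define c where "c = 2 * pi powr (s / 4) * J"
    have c: "c > 0" using J by (simp add: c_def)
    show thesis
    proof (rule that[OF k(1), of "c powr (2 / s * (d - a))"])
      show "c powr (2 / s * (d - a)) > 0" using c by simp
      fix l :: real assume l: "l > 0"
      define R where "R = c powr (2 / s) * l powr (- (4 / s))"
      have R: "R > 0" using c l by (simp add: R_def)
      have Rs: "R powr (- (s / 2)) = l\<^sup>2 / c"
      proof -
        have "R powr (- (s / 2)) = c powr (- 1) * l powr 2"
          using c l s0 by (simp add: R_def powr_mult powr_powr)
        then show ?thesis using c l by (simp add: powr_minus_divide)
      qed
      have Rd: "R powr (d - a) = c powr (2 / s * (d - a)) * l powr (2 - q0)"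
        using c l s0 by (simp add: R_def powr_mult powr_powr q0')
      have form: "norm (kernel_form g (\<lambda>v. complex_of_real ((1 - exp (- (pi * (norm v)\<^sup>2 / R\<^sup>2))) ^ k) * m v))
           \<le> l\<^sup>2 / 2 * N\<^sup>2 + 0 * N"
        if "E \<in> sets borel" "g \<in> borel_measurable borel" "emeasure lborel E = ennreal N" "N \<ge> 0"
          "\<And>x. norm (g x) \<le> indicator E x" for E and g :: "'a \<Rightarrow> complex" and N
      proof (rule restricted_form_le[where h="\<lambda>_. 0" and E=E])
        fix v
        have "norm (complex_of_real ((1 - exp (- (pi * (norm v)\<^sup>2 / R\<^sup>2))) ^ k) * m v)
          = (1 - exp (- (pi * (norm v)\<^sup>2 / R\<^sup>2))) ^ k * norm (m v)"
          using e01 by (simp add: norm_mult norm_power flip: of_real_diff exp_of_real)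
        also have "\<dots> \<le> (pi powr (s / 4) * R powr (- (2 * (s / 4))) * norm v powr (2 * (s / 4))) * norm (m v)"
          using s0 k R by (intro mult_right_mono split) auto
        also have "\<dots> = pi powr (s / 4) * R powr (- (s / 2)) * (norm (m v) * norm v powr (s / 2))"
          by simp
        also have "\<dots> \<le> pi powr (s / 4) * R powr (- (s / 2)) * J"
          by (intro mult_left_mono J) auto
        also have "\<dots> = l\<^sup>2 / 2" unfolding Rs using c J by (simp add: c_def)
        finally show "norm (complex_of_real ((1 - exp (- (pi * (norm v)\<^sup>2 / R\<^sup>2))) ^ k) * m v) \<le> l\<^sup>2 / 2 + 0"
          by simp
      qed (use that in auto)
      show "\<exists>R>0. R powr (real DIM('a) - a) \<le> c powr (2 / s * (d - a)) * l powr (2 - q0) \<and>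
       (\<forall>E g N. E \<in> sets borel \<longrightarrow> g \<in> borel_measurable borel \<longrightarrow> emeasure lborel E = ennreal N \<longrightarrow> N \<ge> 0 \<longrightarrow>
         (\<forall>x. norm (g x) \<le> indicator E x) \<longrightarrow>
         norm (kernel_form g (\<lambda>v. complex_of_real ((1 - exp (- (pi * (norm v)\<^sup>2 / R\<^sup>2))) ^ k) * fourier \<mu> (\<lambda>_. 1) v))
           \<le> l\<^sup>2 / 2 * N\<^sup>2 + c powr (2 / s * (d - a)) * l powr (2 - q0) * N)"
      proof (intro exI[of _ R] conjI allI impI R)
        show "R powr (real DIM('a) - a) \<le> c powr (2 / s * (d - a)) * l powr (2 - q0)"
          using Rd by (simp add: d_def)
        fix E and g :: "'a \<Rightarrow> complex" and N
        assume *: "E \<in> sets borel" "g \<in> borel_measurable borel" "emeasure lborel E = ennreal N" "N \<ge> 0"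
          "\<forall>x. norm (g x) \<le> indicator E x"
        have "norm (kernel_form g (\<lambda>v. complex_of_real ((1 - exp (- (pi * (norm v)\<^sup>2 / R\<^sup>2))) ^ k) * m v))
           \<le> l\<^sup>2 / 2 * N\<^sup>2 + 0 * N"
          using * by (intro form) auto
        also have "\<dots> \<le> l\<^sup>2 / 2 * N\<^sup>2 + c powr (2 / s * (d - a)) * l powr (2 - q0) * N"
          using c *(4) by simp
        finally show "norm (kernel_form g (\<lambda>v. complex_of_real ((1 - exp (- (pi * (norm v)\<^sup>2 / R\<^sup>2))) ^ k) * fourier \<mu> (\<lambda>_. 1) v))
           \<le> l\<^sup>2 / 2 * N\<^sup>2 + c powr (2 / s * (d - a)) * l powr (2 - q0) * N"
          unfolding m_def .
      qed
    qed
  next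
    case False
    then have \<theta>0: "\<theta> > 0" using \<theta> by simp
    define p where "p = 2 / \<theta>"
    define A where "A = s / \<theta> - d"
    have p: "p \<ge> 2" using \<theta> \<theta>0 by (simp add: p_def field_simps)
    have A: "A > 0" using s \<theta>0 by (simp add: A_def d_def field_simps)
    have da: "d - a + A > 0" using a A by (simp add: d_def)
    \<comment> \<open>Dividing numerator and denominator by \<theta> rewrites (2 - \<theta>) / (s -
      a \<theta>) as (p - 1) / (d - a + A).\<close>
    have q0': "2 - q0 = - (2 * (p - 1) / (d - a + A)) * (d - a)"
    proof -
      have "(p - 1) / (d - a + A) = (2 - \<theta>) / (s - a * \<theta>)"
      proof -
        have "p - 1 = (2 - \<theta>) / \<theta>" "d - a + A = (s - a * \<theta>) / \<theta>"
          using \<theta>0 by (simp_all add: p_def A_def field_simps)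
        then show ?thesis using \<theta>0 by simp
      qed
      moreover have "2 - q0 = - (2 * ((d - a) * ((2 - \<theta>) / (s - a * \<theta>))))"
        by (simp add: q0 d_def)
      ultimately have "2 - q0 = - (2 * ((d - a) * ((p - 1) / (d - a + A))))" by (simp only:)
      then show ?thesis by (simp add: mult_ac)
    qed
    define I where "I = enn2real (\<integral>\<^sup>+v. ennreal (norm (m v) powr p * norm v powr A) \<partial>lborel)"
    have I: "(\<integral>\<^sup>+v. ennreal (norm (m v) powr p * norm v powr A) \<partial>lborel) = ennreal I"
    proof -
      have "(\<integral>\<^sup>+v. ennreal (norm (m v) powr p * norm v powr A) \<partial>lborel) \<noteq> \<infinity>"
        using energy False by (auto simp: fourier_energy_def epowr_def m_def p_def A_def d_def)
      then show ?thesis by (simp add: I_def less_top)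
    qed
    have I0: "I \<ge> 0" by (simp add: I_def)
    define k where "k = nat \<lceil>A\<rceil>"
    have k: "k > 0" "A \<le> real k" using A by (auto simp: k_def)
    have \<kappa>: "A / 2 / p \<le> real k"
    proof -
      have "A * 1 \<le> A * (2 * p)" using A p by (intro mult_left_mono) auto
      then have "A / 2 / p \<le> A" using p by (simp add: divide_le_eq)
      with k show ?thesis by simp
    qed
    define c where "c = 2 powr (p - 1) * pi powr (A / 2) * I"
    have c: "c \<ge> 0" using I0 by (simp add: c_def)
    show thesis
    proof (rule that[OF k(1), of "c + 1"])
      show "c + 1 > 0" using c by simp
      fix l :: real assume l: "l > 0"
      \<comment> \<open>Solves R powr (d - a) = l powr (2 - 2 p) * R powr (- A); the common value of
        both sides is l powr (2 - q0).\<close>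
      define R where "R = l powr (- (2 * (p - 1) / (d - a + A)))"
      have R: "R > 0" using l by (simp add: R_def)
      have Rd: "R powr (d - a) = l powr (2 - q0)"
        unfolding R_def q0' by (simp add: powr_powr)
      have bR: "(l\<^sup>2 / 2) powr (1 - p) * R powr (- A) = 2 powr (p - 1) * l powr (2 - q0)"
      proof -
        have e1: "(l\<^sup>2 / 2) powr (1 - p) = l powr (2 * (1 - p)) * 2 powr (p - 1)"
          using l powr_minus_divide[of 2 "1 - p"] by (simp add: powr_divide power2_powr)
        have e2: "l powr (2 * (1 - p)) * R powr (- A) = l powr (2 * (1 - p) + 2 * (p - 1) / (d - a + A) * A)"
          by (simp add: R_def powr_powr powr_add)
        have e3: "2 * (1 - p) + 2 * (p - 1) / (d - a + A) * A = 2 - q0"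
          unfolding q0' using da by (simp add: field_simps)
        have e4: "l powr (2 * (1 - p)) * R powr (- A) = l powr (2 - q0)" using e2 e3 by (simp only:)
        have "(l\<^sup>2 / 2) powr (1 - p) * R powr (- A) = 2 powr (p - 1) * (l powr (2 * (1 - p)) * R powr (- A))"
          unfolding e1 by (simp only: mult_ac)
        then show ?thesis by (simp only: e4)
      qed
      have form: "norm (kernel_form g (\<lambda>v. complex_of_real ((1 - exp (- (pi * (norm v)\<^sup>2 / R\<^sup>2))) ^ k) * m v))
           \<le> l\<^sup>2 / 2 * N\<^sup>2 + c * l powr (2 - q0) * N"
        if "E \<in> sets borel" "g \<in> borel_measurable borel" "emeasure lborel E = ennreal N" "N \<ge> 0"
          "\<And>x. norm (g x) \<le> indicator E x" for E and g :: "'a \<Rightarrow> complex" and N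
      proof (rule restricted_form_le[where E=E and
            h="\<lambda>v. (l\<^sup>2 / 2) powr (1 - p) * (pi powr (A / 2) * R powr (- A)) * (norm (m v) powr p * norm v powr A)"])
        fix v
        define x where "x = norm (complex_of_real ((1 - exp (- (pi * (norm v)\<^sup>2 / R\<^sup>2))) ^ k) * m v)"
        have x: "x = (1 - exp (- (pi * (norm v)\<^sup>2 / R\<^sup>2))) ^ k * norm (m v)"
          unfolding x_def using e01 by (simp add: norm_mult norm_power flip: of_real_diff exp_of_real)
        have "x \<le> l\<^sup>2 / 2 + (l\<^sup>2 / 2) powr (1 - p) * x powr p"
          using l p by (intro young_threshold) (auto simp: x_def)
        \<comment> \<open>The order \<kappa> = A / (2 p) is the one whose p-th power restores
          exactly the weight |v| powr A of the energy.\<close>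
        also have "x powr p \<le> (pi powr (A / 2 / p) * R powr (- (2 * (A / 2 / p))) * norm v powr (2 * (A / 2 / p)) * norm (m v)) powr p"
        proof (intro powr_mono2)
          have "(1 - exp (- (pi * (norm v)\<^sup>2 / R\<^sup>2))) ^ k
              \<le> pi powr (A / 2 / p) * R powr (- (2 * (A / 2 / p))) * norm v powr (2 * (A / 2 / p))"
            by (rule split[OF _ \<kappa> k(1) R]) (use A p in simp)
          then show "x \<le> pi powr (A / 2 / p) * R powr (- (2 * (A / 2 / p))) * norm v powr (2 * (A / 2 / p)) * norm (m v)"
            unfolding x by (rule mult_right_mono) simp
        qed (use p in \<open>auto simp: x_def\<close>)
        also have "\<dots> = (pi powr (A / 2) * R powr (- A)) * (norm (m v) powr p * norm v powr A)"
          using p by (simp add: powr_mult powr_powr mult_ac)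
        finally show "norm (complex_of_real ((1 - exp (- (pi * (norm v)\<^sup>2 / R\<^sup>2))) ^ k) * m v) \<le> l\<^sup>2 / 2 +
          (l\<^sup>2 / 2) powr (1 - p) * (pi powr (A / 2) * R powr (- A)) * (norm (m v) powr p * norm v powr A)"
          by (simp add: x_def mult.assoc mult_left_mono)
      next
        have "(\<integral>\<^sup>+v. ennreal ((l\<^sup>2 / 2) powr (1 - p) * (pi powr (A / 2) * R powr (- A)) * (norm (m v) powr p * norm v powr A)) \<partial>lborel)
            = ennreal ((l\<^sup>2 / 2) powr (1 - p) * (pi powr (A / 2) * R powr (- A))) * ennreal I"
          unfolding I[symmetric] by (subst nn_integral_cmult[symmetric]) (auto simp flip: ennreal_mult)
        also have "\<dots> = ennreal (pi powr (A / 2) * ((l\<^sup>2 / 2) powr (1 - p) * R powr (- A)) * I)"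
          using I0 by (simp add: mult_ac flip: ennreal_mult)
        also have "\<dots> = ennreal (c * l powr (2 - q0))"
          unfolding bR by (simp add: c_def mult_ac)
        finally show "(\<integral>\<^sup>+v. ennreal ((l\<^sup>2 / 2) powr (1 - p) * (pi powr (A / 2) * R powr (- A)) * (norm (m v) powr p * norm v powr A)) \<partial>lborel)
          \<le> ennreal (c * l powr (2 - q0))" by simp
      qed (use that c in auto)
      have mono: "c * l powr (2 - q0) * N \<le> (c + 1) * l powr (2 - q0) * N" if "N \<ge> 0" for N
        using that by (intro mult_right_mono) auto
      show "\<exists>R>0. R powr (real DIM('a) - a) \<le> (c + 1) * l powr (2 - q0) \<and>
       (\<forall>E g N. E \<in> sets borel \<longrightarrow> g \<in> borel_measurable borel \<longrightarrow> emeasure lborel E = ennreal N \<longrightarrow> N \<ge> 0 \<longrightarrow>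
         (\<forall>x. norm (g x) \<le> indicator E x) \<longrightarrow>
         norm (kernel_form g (\<lambda>v. complex_of_real ((1 - exp (- (pi * (norm v)\<^sup>2 / R\<^sup>2))) ^ k) * fourier \<mu> (\<lambda>_. 1) v))
           \<le> l\<^sup>2 / 2 * N\<^sup>2 + (c + 1) * l powr (2 - q0) * N)"
      proof (intro exI[of _ R] conjI allI impI R)
        show "R powr (real DIM('a) - a) \<le> (c + 1) * l powr (2 - q0)"
          using Rd c by (simp add: d_def distrib_right)
        fix E and g :: "'a \<Rightarrow> complex" and N
        assume *: "E \<in> sets borel" "g \<in> borel_measurable borel" "emeasure lborel E = ennreal N" "N \<ge> 0"
          "\<forall>x. norm (g x) \<le> indicator E x"
        have "norm (kernel_form g (\<lambda>v. complex_of_real ((1 - exp (- (pi * (norm v)\<^sup>2 / R\<^sup>2))) ^ k) * m v))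
           \<le> l\<^sup>2 / 2 * N\<^sup>2 + c * l powr (2 - q0) * N"
          using * by (intro form) auto
        also have "\<dots> \<le> l\<^sup>2 / 2 * N\<^sup>2 + (c + 1) * l powr (2 - q0) * N"
          using mono *(4) by simp
        finally show "norm (kernel_form g (\<lambda>v. complex_of_real ((1 - exp (- (pi * (norm v)\<^sup>2 / R\<^sup>2))) ^ k) * fourier \<mu> (\<lambda>_. 1) v))
           \<le> l\<^sup>2 / 2 * N\<^sup>2 + (c + 1) * l powr (2 - q0) * N"
          unfolding m_def .
      qed
    qed
  qed
qed

section \<open>Recombining low and high frequencies\<close>

text \<open>By repeated use of (1 - e) ^ (n + 1) = (1 - e) ^ n - e (1 - e) ^ n, the difference 1 -
  (1 - e) ^ n is a combination of powers e ^ j with j \<ge> 1 whose coefficients have absolute sum 2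
  ^ n - 1. For a Gaussian \<open>e\<close> each of these powers is again a Gaussian, so the
  low-frequency bound covers all of them.\<close>

lemma kernel_form_telescope:
  fixes g m :: "'a::euclidean_space \<Rightarrow> complex" and e :: "'a \<Rightarrow> real"
  assumes g: "integrable lborel g"
    and [measurable]: "m \<in> borel_measurable borel" "e \<in> borel_measurable borel"
    and m: "\<And>v. norm (m v) \<le> B" and e: "\<And>v. 0 \<le> e v" "\<And>v. e v \<le> 1"
    and L: "L \<ge> 0" "\<And>j. j > 0 \<Longrightarrow> norm (kernel_form g (\<lambda>v. complex_of_real (e v ^ j) * m v)) \<le> L"
  shows "norm (kernel_form g m) \<le> norm (kernel_form g (\<lambda>v. complex_of_real ((1 - e v) ^ n) * m v)) + 2 ^ n * L"
proof -
  define K where "K j n v = complex_of_real (e v ^ j * (1 - e v) ^ n) * m v" for j n v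
  have [measurable]: "K j n \<in> borel_measurable borel" for j n
    unfolding K_def by measurable
  have bound: "norm (K j n v) \<le> B" for j n v
  proof -
    have "norm (K j n v) = (e v ^ j * (1 - e v) ^ n) * norm (m v)"
      unfolding K_def norm_mult norm_of_real using e by (simp add: abs_of_nonneg)
    also have "\<dots> \<le> 1 * norm (m v)"
      using e by (intro mult_right_mono mult_le_one power_le_one) auto
    finally show ?thesis using m[of v] by simp
  qed
  have step: "kernel_form g (K j (Suc n)) = kernel_form g (K j n) - kernel_form g (K (Suc j) n)" for j n
  proof -
    have "K j (Suc n) = (\<lambda>v. K j n v - complex_of_real 1 * K (Suc j) n v)"
      by (simp add: K_def fun_eq_iff algebra_simps)
    then show ?thesis
      using kernel_form_diff[where h="K j n" and k="K (Suc j) n" and c=1, OF g _ _ bound bound] by simp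
  qed
  \<comment> \<open>Each step in \<open>n\<close> splits one term into two, hence the factor 2 ^
    n.\<close>
  have low: "norm (kernel_form g (K j n)) \<le> 2 ^ n * L" if "j > 0" for j n
    using that
  proof (induction n arbitrary: j)
    case 0
    then show ?case using L(2)[of j] by (simp add: K_def[abs_def])
  next
    case (Suc n)
    have "norm (kernel_form g (K j (Suc n))) \<le> norm (kernel_form g (K j n)) + norm (kernel_form g (K (Suc j) n))"
      unfolding step by (rule norm_triangle_ineq4)
    also have "\<dots> \<le> 2 ^ n * L + 2 ^ n * L"
      using Suc by (intro add_mono) auto
    finally show ?case by (simp add: mult_ac)
  qed
  have "norm (kernel_form g (K 0 0)) \<le> norm (kernel_form g (K 0 n)) + 2 ^ n * L" for n
  proof (induction n)
    case (Suc n)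
    have "kernel_form g (K 0 n) = kernel_form g (K 0 (Suc n)) + kernel_form g (K (Suc 0) n)"
      by (simp add: step)
    then have "norm (kernel_form g (K 0 n)) \<le> norm (kernel_form g (K 0 (Suc n))) + norm (kernel_form g (K (Suc 0) n))"
      by (simp add: norm_triangle_ineq)
    with Suc low[of "Suc 0" n] show ?case by simp
  qed (use L in simp)
  from this[of n] show ?thesis by (simp add: K_def[abs_def])
qed

text \<open>With \<open>R\<close> as chosen for the given \<open>l\<close>, the low and the high
  frequencies cost the same power l powr (2 - q0). The quadratic term keeps the explicit constant
  1/2, so that it can be absorbed when \<open>l\<close> is the height of a superlevel set.\<close>

lemma restricted_estimate:
  fixes \<mu> :: "'a::euclidean_space measure"
  assumes fin: "finite_measure \<mu>" and sets: "sets \<mu> = sets borel"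
    and ball: "\<And>x r. r > 0 \<Longrightarrow> measure \<mu> (ball x r) \<le> C * r powr a" and C: "C \<ge> 0"
    and \<theta>: "0 \<le> \<theta>" "\<theta> \<le> 1" and s: "s > real DIM('a) * \<theta>" and a: "a < real DIM('a)"
    and energy: "fourier_energy s \<theta> \<mu> < \<infinity>"
    and q0: "q0 = 2 + 2 * ((real DIM('a) - a) * (2 - \<theta>) / (s - a * \<theta>))"
  obtains D where "D > 0"
    "\<And>l E g. l > 0 \<Longrightarrow> E \<in> sets borel \<Longrightarrow> emeasure lborel E < \<infinity> \<Longrightarrow> g \<in> borel_measurable borel \<Longrightarrow>
       (\<And>x. norm (g x) \<le> indicator E x) \<Longrightarrow>
       (LINT \<xi>|\<mu>. (norm (fourier lborel g \<xi>))\<^sup>2)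
         \<le> l\<^sup>2 / 2 * (measure lborel E)\<^sup>2 + D * l powr (2 - q0) * measure lborel E"
proof -
  interpret finite_measure \<mu> by fact
  define m where "m = fourier \<mu> (\<lambda>_. 1)"
  have [measurable]: "m \<in> borel_measurable borel"
    unfolding m_def by (rule borel_measurable_fourier) (auto intro: sigma_finite_measure_axioms simp: sets)
  have m_le: "norm (m v) \<le> measure \<mu> (space \<mu>)" for v
    unfolding m_def using norm_fourier_le[of \<mu> "\<lambda>_. 1" v] by simp
  obtain B where B: "B > 0"
    and low: "\<And>T g. T > 0 \<Longrightarrow> integrable lborel g \<Longrightarrow>
       ennreal (norm (kernel_form g (\<lambda>v. complex_of_real (exp (- (pi * (norm v)\<^sup>2 / T\<^sup>2))) * m v)))
       \<le> ennreal (B * T powr (real DIM('a) - a)) * (\<integral>\<^sup>+x. ennreal ((norm (g x))\<^sup>2) \<partial>lborel)"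
    using frostman_low_frequency[OF fin sets ball C, folded m_def] by blast
  obtain k B' where k: "k > 0" and B': "B' > 0" and
    high: "\<And>l. l > 0 \<Longrightarrow> \<exists>R>0. R powr (real DIM('a) - a) \<le> B' * l powr (2 - q0) \<and>
       (\<forall>E g N. E \<in> sets borel \<longrightarrow> g \<in> borel_measurable borel \<longrightarrow> emeasure lborel E = ennreal N \<longrightarrow> N \<ge> 0 \<longrightarrow>
         (\<forall>x. norm (g x) \<le> indicator E x) \<longrightarrow>
         norm (kernel_form g (\<lambda>v. complex_of_real ((1 - exp (- (pi * (norm v)\<^sup>2 / R\<^sup>2))) ^ k) * m v))
           \<le> l\<^sup>2 / 2 * N\<^sup>2 + B' * l powr (2 - q0) * N)"
    using fourier_energy_high_frequency[OF fin sets \<theta> s a energy q0, folded m_def] by blast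
  show thesis
  proof (rule that[of "B' + 2 ^ k * (B * B')"])
    show "B' + 2 ^ k * (B * B') > 0" using B B' by (simp add: add_pos_pos)
    fix l :: real and E :: "'a set" and g :: "'a \<Rightarrow> complex"
    assume l: "l > 0" and [measurable]: "E \<in> sets borel" "g \<in> borel_measurable borel"
      and finE: "emeasure lborel E < \<infinity>" and g: "\<And>x. norm (g x) \<le> indicator E x"
    define N where "N = measure lborel E"
    have N: "emeasure lborel E = ennreal N" "N \<ge> 0"
      using finE by (auto simp: N_def emeasure_eq_ennreal_measure)
    have int: "integrable lborel g"
    proof (rule Bochner_Integration.integrable_bound)
      show "integrable lborel (indicator E :: 'a \<Rightarrow> real)" using finE by simp
    qed (use g in auto)
    have g2: "(\<integral>\<^sup>+x. ennreal ((norm (g x))\<^sup>2) \<partial>lborel) \<le> ennreal N"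
    proof -
      have "(\<integral>\<^sup>+x. ennreal ((norm (g x))\<^sup>2) \<partial>lborel) \<le> (\<integral>\<^sup>+x. indicator E x \<partial>lborel)"
      proof (rule nn_integral_mono)
        fix x
        have "(norm (g x))\<^sup>2 \<le> indicator E x"
          using g[of x] by (auto split: split_indicator_asm split_indicator simp: power_le_one)
        then show "ennreal ((norm (g x))\<^sup>2) \<le> indicator E x"
          by (metis ennreal_indicator ennreal_leI)
      qed
      then show ?thesis using N by simp
    qed
    obtain R where R: "R > 0" "R powr (real DIM('a) - a) \<le> B' * l powr (2 - q0)"
      and highR: "norm (kernel_form g (\<lambda>v. complex_of_real ((1 - exp (- (pi * (norm v)\<^sup>2 / R\<^sup>2))) ^ k) * m v))
           \<le> l\<^sup>2 / 2 * N\<^sup>2 + B' * l powr (2 - q0) * N"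
    proof -
      obtain R where "R > 0" "R powr (real DIM('a) - a) \<le> B' * l powr (2 - q0)"
        and *: "\<forall>E g N. E \<in> sets borel \<longrightarrow> g \<in> borel_measurable borel \<longrightarrow> emeasure lborel E = ennreal N \<longrightarrow> N \<ge> 0 \<longrightarrow>
         (\<forall>x. norm (g x) \<le> indicator E x) \<longrightarrow>
         norm (kernel_form g (\<lambda>v. complex_of_real ((1 - exp (- (pi * (norm v)\<^sup>2 / R\<^sup>2))) ^ k) * m v))
           \<le> l\<^sup>2 / 2 * N\<^sup>2 + B' * l powr (2 - q0) * N"
        using high[OF l] by blast
      moreover note *[rule_format, of E g N]
      ultimately show thesis using N g by (intro that[of R]) simp_all
    qed
    define L where "L = B * (B' * l powr (2 - q0)) * N"
    have L0: "L \<ge> 0" using B B' N by (simp add: L_def)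
    have lowR: "norm (kernel_form g (\<lambda>v. complex_of_real (exp (- (pi * (norm v)\<^sup>2 / R\<^sup>2)) ^ j) * m v)) \<le> L"
      if "j > 0" for j
    proof -
      \<comment> \<open>The j-th power of the Gaussian cutoff at frequency \<open>R\<close> is the
        cutoff at frequency R / sqrt j \<le> R, and this costs no more because d - a is
        positive.\<close>
      define T where "T = R / sqrt (real j)"
      have T: "T > 0" "T \<le> R" using R that by (auto simp: T_def divide_le_eq)
      have "exp (- (pi * (norm v)\<^sup>2 / R\<^sup>2)) ^ j = exp (- (pi * (norm v)\<^sup>2 / T\<^sup>2))" for v :: 'a
        by (simp add: T_def power_divide flip: exp_of_nat_mult)
      then have "ennreal (norm (kernel_form g (\<lambda>v. complex_of_real (exp (- (pi * (norm v)\<^sup>2 / R\<^sup>2)) ^ j) * m v)))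
        \<le> ennreal (B * T powr (real DIM('a) - a)) * (\<integral>\<^sup>+x. ennreal ((norm (g x))\<^sup>2) \<partial>lborel)"
        using low[OF T(1) int] by simp
      also have "\<dots> \<le> ennreal (B * (B' * l powr (2 - q0))) * ennreal N"
      proof (intro mult_mono g2 ennreal_leI mult_left_mono)
        have "T powr (real DIM('a) - a) \<le> R powr (real DIM('a) - a)"
          using T a by (intro powr_mono2) auto
        with R show "T powr (real DIM('a) - a) \<le> B' * l powr (2 - q0)" by simp
      qed (use B in auto)
      also have "\<dots> = ennreal L" using B B' N by (simp add: L_def flip: ennreal_mult)
      finally show ?thesis using L0 by simp
    qed
    have "(LINT \<xi>|\<mu>. (norm (fourier lborel g \<xi>))\<^sup>2) = norm (kernel_form g m)"
      unfolding m_def integral_norm_fourier_square(1)[OF fin sets int, symmetric] norm_of_real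
      by (simp add: abs_of_nonneg)
    also have "\<dots> \<le> norm (kernel_form g (\<lambda>v. complex_of_real ((1 - exp (- (pi * (norm v)\<^sup>2 / R\<^sup>2))) ^ k) * m v)) + 2 ^ k * L"
      by (rule kernel_form_telescope[OF int _ _ m_le _ _ L0 lowR]) auto
    also have "\<dots> \<le> l\<^sup>2 / 2 * N\<^sup>2 + B' * l powr (2 - q0) * N + 2 ^ k * L"
      using highR by simp
    also have "\<dots> = l\<^sup>2 / 2 * N\<^sup>2 + (B' + 2 ^ k * (B * B')) * l powr (2 - q0) * N"
      by (simp add: L_def algebra_simps)
    finally show "(LINT \<xi>|\<mu>. (norm (fourier lborel g \<xi>))\<^sup>2)
         \<le> l\<^sup>2 / 2 * (measure lborel E)\<^sup>2 + (B' + 2 ^ k * (B * B')) * l powr (2 - q0) * measure lborel E"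
      unfolding N_def .
  qed
qed

section \<open>From the restricted estimate to the extension estimate\<close>

lemma finite_measure_integrable_of_square:
  fixes f :: "'a \<Rightarrow> complex"
  assumes "finite_measure M" and [measurable]: "f \<in> borel_measurable M"
    and "integrable M (\<lambda>x. (norm (f x))\<^sup>2)"
  shows "integrable M f"
proof -
  interpret finite_measure M by fact
  show ?thesis
  proof (rule Bochner_Integration.integrable_bound)
    show "integrable M (\<lambda>x. 1 + (norm (f x))\<^sup>2)" using assms(3) by simp
    have "norm (f x) \<le> 1 + (norm (f x))\<^sup>2" for x
      using zero_le_power2[of "norm (f x) - 1/2"] by (simp add: power2_eq_square algebra_simps)
    then show "AE x in M. norm (f x) \<le> norm (1 + (norm (f x))\<^sup>2)" by simp
  qed simp
qed

lemma superlevel_measure_le: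
  fixes \<mu> :: "'a::euclidean_space measure"
  assumes fin: "finite_measure \<mu>" and sets: "sets \<mu> = sets borel"
    and [measurable]: "f \<in> borel_measurable \<mu>" and f2: "integrable \<mu> (\<lambda>x. (norm (f x))\<^sup>2)"
    and S: "S = (LINT x|\<mu>. (norm (f x))\<^sup>2)" "S > 0" and l: "l > 0" and D: "D > 0"
    and est: "\<And>E g. E \<in> sets borel \<Longrightarrow> emeasure lborel E < \<infinity> \<Longrightarrow> g \<in> borel_measurable borel \<Longrightarrow>
       (\<And>x. norm (g x) \<le> indicator E x) \<Longrightarrow>
       (LINT \<xi>|\<mu>. (norm (fourier lborel g \<xi>))\<^sup>2)
         \<le> l\<^sup>2 / 2 * (measure lborel E)\<^sup>2 + D * l powr (2 - q0) * measure lborel E"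
  shows "emeasure lborel {x. norm (fourier \<mu> f x) > sqrt S * l} \<le> ennreal (2 * D * l powr (- q0))"
proof -
  interpret finite_measure \<mu> by fact
  define F where "F = fourier \<mu> f"
  have [measurable]: "F \<in> borel_measurable borel"
    unfolding F_def by (rule borel_measurable_fourier) (auto intro: sigma_finite_measure_axioms simp: sets)
  have f: "integrable \<mu> f" by (rule finite_measure_integrable_of_square[OF fin _ f2]) simp
  \<comment> \<open>Absorption and cancellation require finite measure, which is not known in
    advance for the superlevel set. The bound on each truncation does not depend on \<open>n\<close>
    and passes to the union.\<close>
  define E where "E n = {x. norm (F x) > sqrt S * l} \<inter> ball 0 (real n)" for n :: nat
  have [measurable]: "E n \<in> sets borel" for n unfolding E_def by measurable
  have En: "emeasure lborel (E n) \<le> ennreal (2 * D * l powr (- q0))" for n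
  proof -
    have finE: "emeasure lborel (E n) < \<infinity>"
      by (rule order_le_less_trans[OF emeasure_mono[of _ "ball 0 (real n)"] emeasure_bounded_finite[OF bounded_ball]])
        (auto simp: E_def)
    define N where "N = measure lborel (E n)"
    have N: "emeasure lborel (E n) = ennreal N" "N \<ge> 0"
      using finE by (auto simp: N_def emeasure_eq_ennreal_measure)
    define g where "g x = indicator (E n) x * (cnj (F x) / complex_of_real (norm (F x)))" for x
    have [measurable]: "g \<in> borel_measurable borel" unfolding g_def by measurable
    have g: "norm (g x) \<le> indicator (E n) x" for x
      by (auto simp: g_def norm_mult norm_divide split: split_indicator)
    have intg: "integrable lborel g"
    proof (rule Bochner_Integration.integrable_bound)
      show "integrable lborel (indicator (E n) :: 'a \<Rightarrow> real)" using finE by simp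
    qed (use g in auto)
    have [measurable]: "fourier lborel g \<in> borel_measurable borel"
      by (rule borel_measurable_fourier) (auto intro: lborel.sigma_finite_measure_axioms)
    have [measurable]: "fourier lborel g \<in> borel_measurable \<mu>"
      by (simp add: measurable_cong_sets[OF sets refl])
    have gF: "g x * F x = complex_of_real (indicator (E n) x * norm (F x))" for x
      by (auto simp: g_def complex_norm_square[symmetric] power2_eq_square mult.commute split: split_indicator)
    define X where "X = (LINT \<xi>|\<mu>. (norm (fourier lborel g \<xi>))\<^sup>2)"
    have X: "integrable \<mu> (\<lambda>\<xi>. (norm (fourier lborel g \<xi>))\<^sup>2)"
      by (rule integral_norm_fourier_square(2)[OF fin sets intg])
    have intF: "integrable lborel (\<lambda>x. indicator (E n) x * norm (F x))"
    proof (rule Bochner_Integration.integrable_bound)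
      show "integrable lborel (\<lambda>x. (LINT x|\<mu>. norm (f x)) * indicator (E n) x)" using finE by simp
      show "AE x in lborel. norm (indicator (E n) x * norm (F x)) \<le> norm ((LINT x|\<mu>. norm (f x)) * indicator (E n) x)"
        using norm_fourier_le[of \<mu> f] by (auto simp: F_def split: split_indicator intro: order_trans[OF _ abs_ge_self])
    qed simp
    have "sqrt S * l * N = (LINT x|lborel. sqrt S * l * indicator (E n) x)"
      using finE by (simp add: N_def)
    also have "\<dots> \<le> (LINT x|lborel. indicator (E n) x * norm (F x))"
      by (rule integral_mono) (use finE intF in \<open>auto simp: E_def split: split_indicator\<close>)
    also have "\<dots> \<le> norm (LINT x|lborel. g x * F x)"
      unfolding gF integral_complex_of_real norm_of_real by simp
    also have "(LINT x|lborel. g x * F x) = (LINT \<xi>|\<mu>. fourier lborel g \<xi> * f \<xi>)"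
      unfolding F_def
      by (rule fourier_multiplication[OF sigma_finite_measure_axioms sets f lborel.sigma_finite_measure_axioms _ intg, symmetric]) simp
    finally have le1: "sqrt S * l * N \<le> norm (LINT \<xi>|\<mu>. fourier lborel g \<xi> * f \<xi>)" .
    have le2: "norm (LINT \<xi>|\<mu>. fourier lborel g \<xi> * f \<xi>) \<le> (t * X + S / t) / 2" if t: "t > 0" for t
    proof -
      have "norm (LINT \<xi>|\<mu>. fourier lborel g \<xi> * f \<xi>)
        \<le> (LINT \<xi>|\<mu>. (t * (norm (fourier lborel g \<xi>))\<^sup>2 + (norm (f \<xi>))\<^sup>2 / t) / 2)"
      proof (rule order_trans[OF integral_norm_bound integral_mono])
        have pt: "norm (fourier lborel g \<xi> * f \<xi>) \<le> (t * (norm (fourier lborel g \<xi>))\<^sup>2 + (norm (f \<xi>))\<^sup>2 / t) / 2" for \<xi>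
        proof -
          have "0 \<le> (t * norm (fourier lborel g \<xi>) - norm (f \<xi>))\<^sup>2 / t" using t by simp
          also have "\<dots> = t * (norm (fourier lborel g \<xi>))\<^sup>2 + (norm (f \<xi>))\<^sup>2 / t - 2 * (norm (fourier lborel g \<xi>) * norm (f \<xi>))"
            using t by (simp add: power2_diff field_simps power2_eq_square)
          finally show ?thesis by (simp add: norm_mult)
        qed
        then show "norm (fourier lborel g \<xi> * f \<xi>) \<le> (t * (norm (fourier lborel g \<xi>))\<^sup>2 + (norm (f \<xi>))\<^sup>2 / t) / 2" for \<xi> .
        show int: "integrable \<mu> (\<lambda>\<xi>. (t * (norm (fourier lborel g \<xi>))\<^sup>2 + (norm (f \<xi>))\<^sup>2 / t) / 2)"
          using X f2 by simp
        show "integrable \<mu> (\<lambda>\<xi>. norm (fourier lborel g \<xi> * f \<xi>))"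
          by (rule Bochner_Integration.integrable_bound[OF int])
            (measurable, rule AE_I2, simp only: real_norm_def abs_norm_cancel, rule order_trans[OF pt abs_ge_self])
      qed
      also have "\<dots> = (t * X + S / t) / 2"
        using X f2 by (simp add: X_def S)
      finally show ?thesis .
    qed
    show ?thesis
    proof (cases "N = 0")
      case False
      then have N0: "N > 0" using N by simp
      define t where "t = sqrt S / (l * N)"
      have t: "t > 0" using S l N0 by (simp add: t_def)
      have "sqrt S * l * N \<le> (t * X + S / t) / 2" using le1 le2[OF t] by simp
      also have "S / t = sqrt S * l * N"
        using S(2) l N0 by (simp add: t_def field_simps)
      finally have "sqrt S * (l * N) \<le> sqrt S * (X / (l * N))" by (simp add: t_def mult_ac)
      then have "l * N \<le> X / (l * N)" using S by (simp only: mult_le_cancel_left_pos real_sqrt_gt_zero)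
      then have "(l * N) * (l * N) \<le> X" using l N0 by (simp add: pos_le_divide_eq)
      also have "X \<le> l\<^sup>2 / 2 * N\<^sup>2 + D * l powr (2 - q0) * N"
        unfolding X_def N_def by (rule est) (use finE g in auto)
      finally have "l\<^sup>2 / 2 * N * N \<le> D * l powr (2 - q0) * N"
        by (simp add: power2_eq_square algebra_simps)
      then have "l\<^sup>2 / 2 * N \<le> D * l powr (2 - q0)" using N0 by simp
      also have "l powr (2 - q0) = l\<^sup>2 * l powr (- q0)"
        using l by (simp add: powr_diff powr_minus divide_inverse)
      finally have "l\<^sup>2 * N \<le> l\<^sup>2 * (2 * D * l powr (- q0))" by (simp add: mult_ac)
      then have "N \<le> 2 * D * l powr (- q0)" using l by simp
      then show ?thesis unfolding N by (rule ennreal_leI)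
    qed (simp add: N)
  qed
  have "emeasure lborel {x. norm (F x) > sqrt S * l} = emeasure lborel (\<Union>n. E n)"
  proof -
    have "(\<Union>n. E n) = {x. norm (F x) > sqrt S * l}"
      using reals_Archimedean2 by (auto simp: E_def)
    then show ?thesis by simp
  qed
  also have "\<dots> = (SUP n. emeasure lborel (E n))"
    by (rule SUP_emeasure_incseq[symmetric]) (auto simp: E_def incseq_def)
  also have "\<dots> \<le> ennreal (2 * D * l powr (- q0))"
    by (intro SUP_least En)
  finally show ?thesis unfolding F_def .
qed

section \<open>Lebesgue norms, and strong type from weak type and boundedness\<close>

lemma epowr_le_iff:
  assumes "p > 0" "K \<ge> 0"
  shows "epowr x (1 / p) \<le> ennreal K \<longleftrightarrow> x \<le> ennreal (K powr p)"
proof (cases x rule: ennreal_cases)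
  case (real r)
  have "r powr (1 / p) \<le> K \<longleftrightarrow> r \<le> K powr p"
  proof
    assume "r powr (1 / p) \<le> K"
    then have "(r powr (1 / p)) powr p \<le> K powr p" using assms by (intro powr_mono2) auto
    then show "r \<le> K powr p" using assms real by (simp add: powr_powr)
  next
    assume "r \<le> K powr p"
    then have "r powr (1 / p) \<le> (K powr p) powr (1 / p)" using assms real by (intro powr_mono2) auto
    then show "r powr (1 / p) \<le> K" using assms by (simp add: powr_powr)
  qed
  with real assms show ?thesis by (simp add: epowr_def)
qed (simp add: epowr_def top_unique)

lemma Lp_norm_le_iff:
  assumes "p > 0" "K \<ge> 0"
  shows "Lp_norm (ereal p) M f \<le> ennreal K \<longleftrightarrow> (\<integral>\<^sup>+x. ennreal (norm (f x) powr p) \<partial>M) \<le> ennreal (K powr p)"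
  using epowr_le_iff[OF assms] by (simp add: Lp_norm_def)

lemma Lp_norm_2:
  "Lp_norm 2 M f = epowr (\<integral>\<^sup>+x. ennreal ((norm (f x))\<^sup>2) \<partial>M) (1 / 2)"
proof -
  have "norm (f x) powr 2 = (norm (f x))\<^sup>2" for x
    by (cases "f x = 0") auto
  then show ?thesis by (simp add: Lp_norm_def)
qed

lemma Lp_space_2:
  assumes "f \<in> Lp_space 2 M"
  shows "f \<in> borel_measurable M" "integrable M (\<lambda>x. (norm (f x))\<^sup>2)"
    "Lp_norm 2 M f = ennreal (sqrt (LINT x|M. (norm (f x))\<^sup>2))"
proof -
  show [measurable]: "f \<in> borel_measurable M" using assms by (simp add: Lp_space_def)
  have "Lp_norm 2 M f < \<infinity>" using assms by (simp add: Lp_space_def)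
  then have "(\<integral>\<^sup>+x. ennreal ((norm (f x))\<^sup>2) \<partial>M) \<noteq> \<infinity>"
    unfolding Lp_norm_2 by (auto simp: epowr_def)
  then show int: "integrable M (\<lambda>x. (norm (f x))\<^sup>2)"
    by (intro integrableI_bounded) (auto simp: less_top)
  show "Lp_norm 2 M f = ennreal (sqrt (LINT x|M. (norm (f x))\<^sup>2))"
    unfolding Lp_norm_2 by (subst nn_integral_eq_integral[OF int]) (auto simp: epowr_def powr_half_sqrt)
qed

text \<open>Cauchy-Schwarz against the constant 1. The bound supplies the boundedness behind the
  strong type estimate and is itself the case q = \<infinity>. Adding 1 to the mass keeps the
  constant positive.\<close>

lemma norm_fourier_le_L2:
  assumes fin: "finite_measure \<mu>" and f: "f \<in> Lp_space 2 \<mu>"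
  shows "norm (fourier \<mu> f \<xi>) \<le> sqrt (measure \<mu> (space \<mu>) + 1) * sqrt (LINT x|\<mu>. (norm (f x))\<^sup>2)"
proof -
  interpret finite_measure \<mu> by fact
  define M where "M = measure \<mu> (space \<mu>) + 1"
  define S where "S = (LINT x|\<mu>. (norm (f x))\<^sup>2)"
  have M: "M > 0" by (simp add: M_def add_nonneg_pos)
  note [measurable] = Lp_space_2(1)[OF f] and f2 = Lp_space_2(2)[OF f]
  have int: "integrable \<mu> f" by (rule finite_measure_integrable_of_square[OF fin _ f2]) simp
  have "norm (fourier \<mu> f \<xi>) \<le> sqrt M * sqrt S"
  proof (cases "S = 0")
    case True
    have "AE x in \<mu>. (norm (f x))\<^sup>2 = 0"
      using True f2 by (simp add: S_def integral_nonneg_eq_0_iff_AE)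
    then have "fourier \<mu> f \<xi> = 0"
      unfolding fourier_def by (intro integral_eq_zero_AE) auto
    then show ?thesis using True by simp
  next
    case False
    moreover have "S \<ge> 0" by (simp add: S_def)
    ultimately have S: "S > 0" by simp
    \<comment> \<open>The minimiser of t S + M / t, at which half of the sum equals sqrt M * sqrt
      S.\<close>
    define t where "t = sqrt M / sqrt S"
    have t: "t > 0" using M S by (simp add: t_def)
    have "norm (fourier \<mu> f \<xi>) \<le> (LINT x|\<mu>. norm (f x))" by (rule norm_fourier_le)
    also have "\<dots> \<le> (LINT x|\<mu>. (t * (norm (f x))\<^sup>2 + 1 / t) / 2)"
    proof (rule integral_mono)
      fix x
      have "0 \<le> (t * norm (f x) - 1)\<^sup>2 / t" using t by simp
      also have "\<dots> = t * (norm (f x))\<^sup>2 + 1 / t - 2 * norm (f x)"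
        using t by (simp add: power2_diff field_simps power2_eq_square)
      finally show "norm (f x) \<le> (t * (norm (f x))\<^sup>2 + 1 / t) / 2" by simp
    qed (use int f2 in auto)
    also have "\<dots> = (t * S + (M - 1) / t) / 2"
      using f2 by (simp add: S_def M_def)
    also have "\<dots> \<le> (t * S + M / t) / 2"
      using t by (simp add: divide_right_mono)
    also have "\<dots> = sqrt M * sqrt S"
    proof -
      have "t * S = sqrt M * (S / sqrt S)" "M / t = (M / sqrt M) * sqrt S"
        by (simp_all add: t_def)
      then show ?thesis using M S by (simp only: real_div_sqrt order_less_imp_le) simp
    qed
    finally show ?thesis .
  qed
  then show ?thesis unfolding M_def S_def .
qed

text \<open>Decompose by the levels B 2 powr (- j). As \<open>F\<close> is at most \<open>B\<close>,
  only j \<ge> 0 occurs, and the level contributions form a geometric series of ratio 2 powr (q0 -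
  q) < 1. The factor 2 powr q0 arises because the weak bound is applied at the lower end of each
  dyadic range.\<close>

lemma weak_type_bounded_imp_strong_type:
  fixes F :: "'a \<Rightarrow> real"
  assumes [measurable]: "F \<in> borel_measurable M"
    and F: "\<And>x. 0 \<le> F x" "\<And>x. F x \<le> B" and B: "B > 0" and q: "q > q0" "q > 0" and D: "D \<ge> 0"
    and weak: "\<And>l. l > 0 \<Longrightarrow> emeasure M {x \<in> space M. F x > l} \<le> ennreal (D * l powr (- q0))"
  shows "(\<integral>\<^sup>+x. ennreal (F x powr q) \<partial>M)
    \<le> ennreal (D * B powr (q - q0) * 2 powr q0 / (1 - 2 powr (q0 - q)))"
proof -
  define l where "l j = B * 2 powr (- real j)" for j
  have l: "l j > 0" for j using B by (simp add: l_def)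
  define G where "G j = {x \<in> space M. F x > l (Suc j)}" for j
  have [measurable]: "G j \<in> sets M" for j unfolding G_def by measurable
  have single: "H n \<le> (\<Sum>n. H n)" for H :: "nat \<Rightarrow> ennreal" and n
    using sum_le_suminf[of H "{n}"] by simp
  have pointwise: "ennreal (F x powr q) \<le> (\<Sum>j. ennreal (l j powr q) * indicator (G j) x)"
    if x: "x \<in> space M" for x
  proof (cases "F x = 0")
    case False
    then have pos: "F x > 0" using F(1)[of x] by simp
    have "l \<longlonglongrightarrow> 0" unfolding l_def by real_asymp
    then have "\<forall>\<^sub>F j in sequentially. l j < F x" using pos by (rule order_tendstoD)
    then obtain i where i: "l i < F x" by (auto dest: eventually_happens)
    \<comment> \<open>The least level below F x is not level 0, which is \<open>B\<close> itself;
      its predecessor therefore bounds F x from above.\<close>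
    define i where "i = (LEAST i. l i < F x)"
    have i: "l i < F x" unfolding i_def by (rule LeastI[where P="\<lambda>i. l i < F x", OF i])
    have "l 0 = B" by (simp add: l_def)
    then have "i \<noteq> 0" using i F(2)[of x] by (metis not_le)
    then obtain j where j: "i = Suc j" using not0_implies_Suc by blast
    have "\<not> l j < F x" using not_less_Least[of j "\<lambda>i. l i < F x"] j by (simp add: i_def)
    then have "F x powr q \<le> l j powr q" using F q by (intro powr_mono2) auto
    then have "ennreal (F x powr q) \<le> ennreal (l j powr q) * indicator (G j) x"
      using i j x by (auto simp: G_def intro!: ennreal_leI)
    also have "\<dots> \<le> (\<Sum>j. ennreal (l j powr q) * indicator (G j) x)"
      by (rule single)
    finally show ?thesis .
  qed (use q in simp)
  define r where "r = (2::real) powr (q0 - q)"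
  have r: "0 < r" "r < 1" using q by (auto simp: r_def powr_less_one)
  define A where "A = D * B powr (q - q0) * 2 powr q0"
  have A: "A \<ge> 0" using D by (simp add: A_def)
  have "(\<integral>\<^sup>+x. ennreal (F x powr q) \<partial>M) \<le> (\<integral>\<^sup>+x. (\<Sum>j. ennreal (l j powr q) * indicator (G j) x) \<partial>M)"
    by (intro nn_integral_mono pointwise)
  also have "\<dots> = (\<Sum>j. ennreal (l j powr q) * emeasure M (G j))"
    by (subst nn_integral_suminf, measurable) (simp add: nn_integral_cmult_indicator)
  also have "\<dots> \<le> (\<Sum>j. ennreal (A * r ^ j))"
  proof (intro suminf_le summableI)
    fix j
    have "ennreal (l j powr q) * emeasure M (G j) \<le> ennreal (l j powr q) * ennreal (D * l (Suc j) powr (- q0))"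
      unfolding G_def by (intro mult_left_mono weak l) simp
    also have "\<dots> = ennreal (D * (l j powr q * l (Suc j) powr (- q0)))"
      using D by (simp add: mult_ac flip: ennreal_mult)
    also have "l j powr q * l (Suc j) powr (- q0) = B powr (q - q0) * 2 powr q0 * r ^ j"
    proof -
      have "l j powr q = B powr q * 2 powr (- (real j * q))"
        using B by (simp add: l_def powr_mult powr_powr)
      moreover have "l (Suc j) powr (- q0) = B powr (- q0) * 2 powr ((real j + 1) * q0)"
        using B by (simp add: l_def powr_mult powr_powr algebra_simps)
      ultimately have "l j powr q * l (Suc j) powr (- q0)
          = (B powr q * B powr (- q0)) * (2 powr (- (real j * q)) * 2 powr ((real j + 1) * q0))"
        by simp
      also have "\<dots> = B powr (q + - q0) * 2 powr (q0 + (q0 - q) * real j)"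
        unfolding powr_add[symmetric] by (simp add: algebra_simps)
      also have "\<dots> = B powr (q - q0) * 2 powr q0 * r ^ j"
        by (simp add: r_def powr_add powr_powr[symmetric] powr_realpow)
      finally show ?thesis .
    qed
    finally show "ennreal (l j powr q) * emeasure M (G j) \<le> ennreal (A * r ^ j)"
      by (simp add: A_def mult.assoc)
  qed
  also have "\<dots> = ennreal (A / (1 - r))"
    using A r by (subst suminf_ennreal2) (auto simp: suminf_mult suminf_geometric summable_geometric intro!: summable_mult)
  finally show ?thesis by (simp add: A_def r_def)
qed

lemma extension_estimate:
  fixes \<mu> :: "'a::euclidean_space measure"
  assumes fin: "finite_measure \<mu>" and sets: "sets \<mu> = sets borel"
    and ball: "\<And>x r. r > 0 \<Longrightarrow> measure \<mu> (ball x r) \<le> C * r powr a" and C: "C \<ge> 0"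
    and \<theta>: "0 \<le> \<theta>" "\<theta> \<le> 1" and s: "s > real DIM('a) * \<theta>" and a: "a < real DIM('a)"
    and energy: "fourier_energy s \<theta> \<mu> < \<infinity>"
    and q: "q > 2 + 2 * ((real DIM('a) - a) * (2 - \<theta>) / (s - a * \<theta>))" "q > 0"
  obtains B where "B > 0"
    "\<And>f. f \<in> Lp_space 2 \<mu> \<Longrightarrow> Lp_norm (ereal q) lborel (fourier \<mu> f) \<le> ennreal B * Lp_norm 2 \<mu> f"
proof -
  interpret finite_measure \<mu> by fact
  define q0 where "q0 = 2 + 2 * ((real DIM('a) - a) * (2 - \<theta>) / (s - a * \<theta>))"
  define M where "M = measure \<mu> (space \<mu>) + 1"
  have M: "M > 0" by (simp add: M_def add_nonneg_pos)
  obtain D where D: "D > 0"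
    and est: "\<And>l E g. l > 0 \<Longrightarrow> E \<in> sets borel \<Longrightarrow> emeasure lborel E < \<infinity> \<Longrightarrow> g \<in> borel_measurable borel \<Longrightarrow>
       (\<And>x. norm (g x) \<le> indicator E x) \<Longrightarrow>
       (LINT \<xi>|\<mu>. (norm (fourier lborel g \<xi>))\<^sup>2)
         \<le> l\<^sup>2 / 2 * (measure lborel E)\<^sup>2 + D * l powr (2 - q0) * measure lborel E"
    using restricted_estimate[OF fin sets ball C \<theta> s a energy q0_def] by blast
  define A where "A = 2 * D * sqrt M powr (q - q0) * 2 powr q0 / (1 - 2 powr (q0 - q))"
  have "2 powr (q0 - q) < (1::real)" using q by (simp add: q0_def powr_less_one)
  then have A: "A > 0" using D M by (simp add: A_def)
  show thesis
  proof (rule that[of "A powr (1 / q)"])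
    show "A powr (1 / q) > 0" using A by simp
    fix f assume f: "f \<in> Lp_space 2 \<mu>"
    note [measurable] = Lp_space_2(1)[OF f] and f2 = Lp_space_2(2)[OF f]
    have int: "integrable \<mu> f" by (rule finite_measure_integrable_of_square[OF fin _ f2]) simp
    define S where "S = (LINT x|\<mu>. (norm (f x))\<^sup>2)"
    define F where "F = fourier \<mu> f"
    have [measurable]: "F \<in> borel_measurable borel"
      unfolding F_def by (rule borel_measurable_fourier) (auto intro: sigma_finite_measure_axioms simp: sets)
    have S0: "S \<ge> 0" by (simp add: S_def)
    have "Lp_norm (ereal q) lborel F \<le> ennreal (A powr (1 / q) * sqrt S)"
    proof (cases "S = 0")
      case True
      have "AE x in \<mu>. (norm (f x))\<^sup>2 = 0"
        using True f2 by (simp add: S_def integral_nonneg_eq_0_iff_AE)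
      then have "F \<xi> = 0" for \<xi>
        unfolding F_def fourier_def by (intro integral_eq_zero_AE) auto
      then show ?thesis using q True by (subst Lp_norm_le_iff) auto
    next
      case False
      then have S: "S > 0" using S0 by simp
      have F_le: "norm (F x) \<le> sqrt M * sqrt S" for x
        unfolding F_def M_def S_def by (rule norm_fourier_le_L2[OF fin f])
      \<comment> \<open>After this normalisation both the sup bound sqrt M and the weak type
        constant are independent of \<open>f\<close>, so the final constant is as well.\<close>
      define H where "H x = norm (F x) / sqrt S" for x
      have [measurable]: "H \<in> borel_measurable borel" unfolding H_def by measurable
      have "(\<integral>\<^sup>+x. ennreal (H x powr q) \<partial>lborel) \<le> ennreal A"
        unfolding A_def
      proof (rule weak_type_bounded_imp_strong_type)
        show "H x \<le> sqrt M" for x using F_le[of x] S by (simp add: H_def divide_le_eq)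
        show "q > q0" using q by (simp add: q0_def)
        fix l :: real assume l: "l > 0"
        have "{x \<in> space lborel. H x > l} = {x. norm (F x) > sqrt S * l}"
          using S by (auto simp: H_def less_divide_eq mult.commute)
        moreover have "emeasure lborel {x. norm (F x) > sqrt S * l} \<le> ennreal (2 * D * l powr (- q0))"
          unfolding F_def by (rule superlevel_measure_le[OF fin sets _ f2 S_def S l D]) (simp, rule est[OF l])
        ultimately show "emeasure lborel {x \<in> space lborel. H x > l} \<le> ennreal (2 * D * l powr (- q0))"
          by (simp only:)
      qed (use M q D S0 in \<open>auto simp: H_def\<close>)
      then have "ennreal (sqrt S powr q) * (\<integral>\<^sup>+x. ennreal (H x powr q) \<partial>lborel) \<le> ennreal (sqrt S powr q) * ennreal A"
        by (rule mult_left_mono) simp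
      also have "ennreal (sqrt S powr q) * (\<integral>\<^sup>+x. ennreal (H x powr q) \<partial>lborel) = (\<integral>\<^sup>+x. ennreal (norm (F x) powr q) \<partial>lborel)"
        using S by (subst nn_integral_cmult[symmetric]) (auto simp: H_def powr_divide simp flip: ennreal_mult)
      also have "ennreal (sqrt S powr q) * ennreal A = ennreal ((A powr (1 / q) * sqrt S) powr q)"
        using A S0 q by (simp add: powr_mult powr_powr mult.commute flip: ennreal_mult)
      finally show ?thesis using A S0 q by (subst Lp_norm_le_iff) auto
    qed
    then show "Lp_norm (ereal q) lborel (fourier \<mu> f) \<le> ennreal (A powr (1 / q)) * Lp_norm 2 \<mu> f"
      using S0 unfolding Lp_space_2(3)[OF f] by (simp add: F_def S_def ennreal_mult)
  qed
qed

section \<open>From extension to restriction\<close>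

lemma schwartz_integrable:
  fixes \<phi> :: "'a::euclidean_space \<Rightarrow> complex"
  assumes "schwartz \<phi>"
  shows "integrable lborel \<phi>"
proof -
  define d where "d = DIM('a)"
  have diff: "\<phi> differentiable (at x)" for x
    using assms unfolding schwartz_def by (metis empty_subsetI iterated_partial.simps(1) list.set(1))
  have bd: "bounded (range (\<lambda>x. norm x ^ k * norm (\<phi> x)))" for k
    using assms unfolding schwartz_def by (metis empty_subsetI iterated_partial.simps(1) list.set(1))
  have "continuous_on UNIV \<phi>"
    using diff by (simp add: continuous_at_imp_continuous_on differentiable_imp_continuous_within)
  then have [measurable]: "\<phi> \<in> borel_measurable borel"
    by (rule borel_measurable_continuous_onI)
  obtain B where B: "\<And>x. norm (\<phi> x) \<le> B"
    using bd[of 0] by (auto simp: bounded_iff)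
  obtain B' where B': "\<And>x. norm x ^ (d + 2) * norm (\<phi> x) \<le> B'"
    using bd[of "d + 2"] by (auto simp: bounded_iff)
  define h where "h u = (B + B') * 2 ^ (d + 2) * (1 + u) powr (- (real d + 2))" for u
  have BB: "B + B' \<ge> 0" using B[of 0] B'[of 0] norm_ge_zero[of "\<phi> 0"]
    by (smt (verit) mult_nonneg_nonneg zero_le_power norm_ge_zero)
  have le: "norm (\<phi> x) \<le> h (dist 0 x / 1)" for x
  proof -
    have "(1 + norm x) ^ (d + 2) \<le> (2 * max 1 (norm x)) ^ (d + 2)"
      by (intro power_mono) auto
    also have "\<dots> \<le> 2 ^ (d + 2) * (1 + norm x ^ (d + 2))"
      unfolding power_mult_distrib by (intro mult_left_mono) (auto simp: max_def)
    finally have "(1 + norm x) ^ (d + 2) * norm (\<phi> x) \<le> 2 ^ (d + 2) * (1 + norm x ^ (d + 2)) * norm (\<phi> x)"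
      by (intro mult_right_mono) auto
    also have "\<dots> = 2 ^ (d + 2) * (norm (\<phi> x) + norm x ^ (d + 2) * norm (\<phi> x))"
      by (simp add: algebra_simps)
    also have "\<dots> \<le> 2 ^ (d + 2) * (B + B')"
      by (intro mult_left_mono add_mono B B') auto
    finally have "norm (\<phi> x) \<le> 2 ^ (d + 2) * (B + B') / (1 + norm x) ^ (d + 2)"
      by (subst pos_le_divide_eq) (auto simp: mult.commute add_pos_nonneg intro!: zero_less_power)
    also have "\<dots> = h (dist 0 x / 1)"
    proof -
      have "(1 + norm x) powr (- (real d + 2)) = inverse ((1 + norm x) ^ (d + 2))"
      proof -
        have "(1 + norm x) powr real (d + 2) = (1 + norm x) ^ (d + 2)"
          by (rule powr_realpow) (simp add: add_pos_nonneg)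
        moreover have "real (d + 2) = real d + 2" by simp
        ultimately show ?thesis unfolding powr_minus by (simp only:)
      qed
      then show ?thesis by (simp add: h_def divide_inverse mult_ac)
    qed
    finally show ?thesis .
  qed
  have sum: "summable (\<lambda>n. h (real n) * (real n + 1) powr real d)"
  proof -
    have "h (real n) * (real n + 1) powr real d = (B + B') * 2 ^ (d + 2) * inverse (real (Suc n) ^ 2)" for n
    proof -
      have "(1 + real n) powr (- (real d + 2)) * (real n + 1) powr real d = (real n + 1) powr (- 2)"
        by (simp add: add.commute flip: powr_add)
      also have "\<dots> = inverse (real (Suc n) ^ 2)"
        by (simp add: powr_minus add.commute)
      finally show ?thesis by (simp add: h_def mult.assoc)
    qed
    moreover have "summable (\<lambda>n. inverse (real (Suc n) ^ 2))"
      using inverse_power_summable[of 2, where 'a=real] by (subst summable_Suc_iff) simp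
    ultimately show ?thesis by (simp add: summable_mult)
  qed
  have "(\<integral>\<^sup>+x. ennreal (norm (\<phi> x)) \<partial>lborel) \<le> (\<integral>\<^sup>+x. ennreal (h (dist (0::'a) x / 1)) \<partial>lborel)"
    by (intro nn_integral_mono ennreal_leI le)
  also have "\<dots> \<le> ennreal (unit_ball_vol (real DIM('a)) * (\<Sum>n. h (real n) * (real n + 1) powr real d) * 1 powr real d)"
  proof (rule nn_integral_radial_le)
    show "emeasure lborel (ball x r) \<le> ennreal (unit_ball_vol (real DIM('a)) * r powr real d)" if "r > 0" for x :: 'a and r
      using that by (simp add: emeasure_ball d_def powr_realpow)
    show "h v \<le> h u" if "0 \<le> u" "u \<le> v" for u v
      unfolding h_def using that BB by (intro mult_left_mono powr_mono2') auto
  qed (use sum BB in \<open>auto simp: h_def\<close>)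
  finally have "(\<integral>\<^sup>+x. ennreal (norm (\<phi> x)) \<partial>lborel) < \<infinity>"
    using le_less_trans ennreal_less_top by fastforce
  then show ?thesis by (intro integrableI_bounded) auto
qed

text \<open>Young's inequality for u / U and v / V, integrated. Working with positive upper bounds
  \<open>U\<close> and \<open>V\<close> in place of the norms avoids the degenerate cases 0 and
  \<infinity>.\<close>

lemma nn_integral_Hoelder:
  fixes u v :: "'a \<Rightarrow> real"
  assumes pq: "p > 1" "q > 1" "1 / p + 1 / q = 1" and pos: "U > 0" "V > 0"
    and [measurable]: "u \<in> borel_measurable M" "v \<in> borel_measurable M"
    and uv: "\<And>x. 0 \<le> u x" "\<And>x. 0 \<le> v x"
    and U: "(\<integral>\<^sup>+x. ennreal (u x powr p) \<partial>M) \<le> ennreal (U powr p)"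
    and V: "(\<integral>\<^sup>+x. ennreal (v x powr q) \<partial>M) \<le> ennreal (V powr q)"
  shows "(\<integral>\<^sup>+x. ennreal (u x * v x) \<partial>M) \<le> ennreal (U * V)"
proof -
  define c where "c = U * V / p * U powr (- p)"
  define c' where "c' = U * V / q * V powr (- q)"
  have c: "c \<ge> 0" "c' \<ge> 0" using pq pos by (auto simp: c_def c'_def)
  have "u x * v x \<le> c * u x powr p + c' * v x powr q" for x
  proof -
    have "(u x / U) * (v x / V) \<le> (u x / U) powr p / p + (v x / V) powr q / q"
      using pq pos uv[of x] by (intro Youngs_inequality) auto
    then have "U * V * ((u x / U) * (v x / V)) \<le> U * V * ((u x / U) powr p / p + (v x / V) powr q / q)"
      using pos by (intro mult_left_mono) auto
    moreover have "U * V * ((u x / U) * (v x / V)) = u x * v x" using pos by simp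
    moreover have "(u x / U) powr p = U powr (- p) * u x powr p" "(v x / V) powr q = V powr (- q) * v x powr q"
      using pos uv[of x] by (simp_all add: powr_divide powr_minus_divide)
    ultimately show ?thesis by (simp add: c_def c'_def distrib_left mult_ac)
  qed
  then have "(\<integral>\<^sup>+x. ennreal (u x * v x) \<partial>M)
      \<le> (\<integral>\<^sup>+x. ennreal c * ennreal (u x powr p) + ennreal c' * ennreal (v x powr q) \<partial>M)"
    using c by (intro nn_integral_mono) (auto simp flip: ennreal_mult ennreal_plus intro!: ennreal_leI)
  also have "\<dots> = ennreal c * (\<integral>\<^sup>+x. ennreal (u x powr p) \<partial>M) + ennreal c' * (\<integral>\<^sup>+x. ennreal (v x powr q) \<partial>M)"
    by (simp add: nn_integral_add nn_integral_cmult)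
  also have "\<dots> \<le> ennreal c * ennreal (U powr p) + ennreal c' * ennreal (V powr q)"
    by (intro add_mono mult_left_mono U V) auto
  also have "\<dots> = ennreal (c * U powr p + c' * V powr q)"
    using c by (simp flip: ennreal_mult ennreal_plus)
  also have "c * U powr p + c' * V powr q = U * V * (1 / p + 1 / q)"
    using pos by (simp add: c_def c'_def powr_minus field_simps)
  finally show ?thesis using pq by simp
qed

lemma bounded_in_Lp_space_2:
  fixes h :: "'a \<Rightarrow> complex"
  assumes "finite_measure M" and [measurable]: "h \<in> borel_measurable M" and "\<And>x. norm (h x) \<le> B"
  shows "h \<in> Lp_space 2 M"
proof -
  interpret finite_measure M by fact
  have "integrable M (\<lambda>x. (norm (h x))\<^sup>2)"
    by (rule integrable_const_bound[where B="B\<^sup>2"]) (auto intro!: power_mono assms)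
  then have "(\<integral>\<^sup>+x. ennreal ((norm (h x))\<^sup>2) \<partial>M) < \<infinity>"
    by (simp add: nn_integral_eq_integral)
  then show ?thesis unfolding Lp_space_def Lp_norm_2 by (auto simp: epowr_def)
qed

lemma restriction_estimate:
  fixes \<mu> :: "'a::euclidean_space measure"
  assumes fin: "finite_measure \<mu>" and sets: "sets \<mu> = sets borel"
    and pq: "p > 1" "q > 1" "1 / p + 1 / q = 1" and C: "C > 0"
    and ext: "\<And>f. f \<in> Lp_space 2 \<mu> \<Longrightarrow> Lp_norm (ereal q) lborel (fourier \<mu> f) \<le> ennreal C * Lp_norm 2 \<mu> f"
    and \<phi>: "integrable lborel \<phi>"
  shows "Lp_norm 2 \<mu> (fourier lborel \<phi>) \<le> ennreal C * Lp_norm (ereal p) lborel \<phi>"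
proof -
  interpret finite_measure \<mu> by fact
  define h where "h = fourier lborel \<phi>"
  have [measurable]: "\<phi> \<in> borel_measurable borel" using borel_measurable_integrable[OF \<phi>] by simp
  have hm: "h \<in> borel_measurable borel"
    unfolding h_def by (rule borel_measurable_fourier) (auto intro: lborel.sigma_finite_measure_axioms)
  then have [measurable]: "h \<in> borel_measurable \<mu>" by (simp add: measurable_cong_sets[OF sets refl])
  define B where "B = (LINT x|lborel. norm (\<phi> x))"
  have h_le: "norm (h x) \<le> B" for x
    unfolding h_def B_def by (rule norm_fourier_le)
  have h2: "h \<in> Lp_space 2 \<mu>" by (rule bounded_in_Lp_space_2[OF fin _ h_le]) simp
  have ch2: "(\<lambda>x. cnj (h x)) \<in> Lp_space 2 \<mu>"
    by (rule bounded_in_Lp_space_2[OF fin, where B=B]) (auto intro: h_le)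
  define S where "S = (LINT x|\<mu>. (norm (h x))\<^sup>2)"
  have S0: "S \<ge> 0" by (simp add: S_def)
  have nh: "Lp_norm 2 \<mu> h = ennreal (sqrt S)" "Lp_norm 2 \<mu> (\<lambda>x. cnj (h x)) = ennreal (sqrt S)"
    using Lp_space_2(3)[OF h2] Lp_space_2(3)[OF ch2] by (simp_all only: S_def complex_mod_cnj)
  define F where "F = fourier \<mu> (\<lambda>x. cnj (h x))"
  have [measurable]: "F \<in> borel_measurable borel"
    unfolding F_def by (rule borel_measurable_fourier) (auto intro: sigma_finite_measure_axioms simp: sets)
  have int: "integrable \<mu> (\<lambda>x. cnj (h x))"
    by (rule integrable_const_bound[where B=B]) (auto intro!: h_le)
  have "complex_of_real S = (LINT x|\<mu>. h x * cnj (h x))"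
    unfolding S_def by (simp only: complex_norm_square[symmetric] integral_complex_of_real)
  also have "\<dots> = (LINT x|lborel. \<phi> x * F x)"
    unfolding F_def h_def
    by (rule fourier_multiplication[OF sigma_finite_measure_axioms sets int[unfolded h_def] lborel.sigma_finite_measure_axioms _ \<phi>]) simp
  finally have S_eq: "complex_of_real S = (LINT x|lborel. \<phi> x * F x)" .
  have S_le: "ennreal S \<le> (\<integral>\<^sup>+x. ennreal (norm (\<phi> x) * norm (F x)) \<partial>lborel)"
    using ennreal_norm_integral_le[of lborel "\<lambda>x. \<phi> x * F x"] S0
    by (simp add: S_eq[symmetric] norm_mult)
  have main: "sqrt S \<le> C * K" if K: "K > 0" "Lp_norm (ereal p) lborel \<phi> \<le> ennreal K" for K
  proof (cases "S = 0")
    case False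
    then have S: "S > 0" using S0 by simp
    have "Lp_norm (ereal q) lborel F \<le> ennreal (C * sqrt S)"
      using ext[OF ch2, unfolded nh(2)] C S0 by (simp add: F_def ennreal_mult)
    then have "(\<integral>\<^sup>+x. ennreal (norm (F x) powr q) \<partial>lborel) \<le> ennreal ((C * sqrt S) powr q)"
      using C pq S0 by (subst (asm) Lp_norm_le_iff) auto
    moreover have "(\<integral>\<^sup>+x. ennreal (norm (\<phi> x) powr p) \<partial>lborel) \<le> ennreal (K powr p)"
      using K pq by (subst (asm) Lp_norm_le_iff) auto
    ultimately have "(\<integral>\<^sup>+x. ennreal (norm (\<phi> x) * norm (F x)) \<partial>lborel) \<le> ennreal (K * (C * sqrt S))"
      using C S K by (intro nn_integral_Hoelder[OF pq]) auto
    with S_le have "ennreal S \<le> ennreal (K * (C * sqrt S))" by (rule order_trans)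
    then have "sqrt S * sqrt S \<le> (C * K) * sqrt S"
      using K C S by (subst (asm) ennreal_le_iff) (auto simp: mult_ac)
    then show ?thesis using S by (simp only: mult_le_cancel_right_pos real_sqrt_gt_zero)
  qed (use K C in simp)
  have "ennreal (sqrt S) \<le> ennreal C * Lp_norm (ereal p) lborel \<phi>"
  proof (cases "Lp_norm (ereal p) lborel \<phi>" rule: ennreal_cases)
    case (real r)
    have "sqrt S \<le> C * r"
    \<comment> \<open>Hoelder was stated for positive bounds, so the norm \<open>r\<close>, which
      may be 0, is enlarged by e / C and e is then removed.\<close>
    proof (rule field_le_epsilon)
      fix e :: real assume e: "e > 0"
      have "sqrt S \<le> C * (r + e / C)"
        by (rule main) (use e C real in \<open>auto intro!: add_nonneg_pos ennreal_leI simp del: ennreal_plus\<close>)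
      then show "sqrt S \<le> C * r + e" using C by (simp add: distrib_left)
    qed
    then show ?thesis using real C by (simp add: ennreal_leI flip: ennreal_mult)
  qed (use C in \<open>simp add: ennreal_mult_top\<close>)
  then show ?thesis unfolding h_def[symmetric] nh .
qed

text \<open>The endpoint p = 1, whose conjugate exponent is \<infinity>: the transform is bounded by
  the L1 norm, and \<mu> is finite.\<close>

lemma restriction_estimate_L1:
  fixes \<mu> :: "'a::euclidean_space measure"
  assumes fin: "finite_measure \<mu>" and sets: "sets \<mu> = sets borel" and \<phi>: "integrable lborel \<phi>"
  shows "Lp_norm 2 \<mu> (fourier lborel \<phi>) \<le> ennreal (sqrt (measure \<mu> (space \<mu>))) * Lp_norm (ereal 1) lborel \<phi>"
proof -
  interpret finite_measure \<mu> by fact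
  define B where "B = (LINT x|lborel. norm (\<phi> x))"
  have B: "B \<ge> 0" by (simp add: B_def)
  have "(\<integral>\<^sup>+x. ennreal ((norm (fourier lborel \<phi> x))\<^sup>2) \<partial>\<mu>) \<le> (\<integral>\<^sup>+x. ennreal (B\<^sup>2) \<partial>\<mu>)"
    by (intro nn_integral_mono ennreal_leI power_mono) (auto simp: B_def norm_fourier_le)
  also have "\<dots> = ennreal ((sqrt (measure \<mu> (space \<mu>)) * B) powr 2)"
    using B by (simp add: emeasure_eq_measure power_mult_distrib mult.commute flip: ennreal_mult)
  finally have "Lp_norm 2 \<mu> (fourier lborel \<phi>) \<le> ennreal (sqrt (measure \<mu> (space \<mu>)) * B)"
    unfolding Lp_norm_2 using B by (subst epowr_le_iff) auto
  moreover have "Lp_norm (ereal 1) lborel \<phi> = ennreal B"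
    using B \<phi> by (simp add: Lp_norm_def nn_integral_eq_integral epowr_def B_def)
  ultimately show ?thesis using B by (simp add: ennreal_mult)
qed

section \<open>Extension by density\<close>

text \<open>The triangle inequality with an extra factor, which is enough for everything below.\<close>

lemma Lp_norm_quasi_triangle:
  assumes p: "p \<ge> 1" and [measurable]: "u \<in> borel_measurable M" "v \<in> borel_measurable M"
    and w: "\<And>x. norm (w x) \<le> norm (u x) + norm (v x)"
  shows "Lp_norm (ereal p) M w \<le> 4 * (Lp_norm (ereal p) M u + Lp_norm (ereal p) M v)"
proof (cases "Lp_norm (ereal p) M u = \<infinity> \<or> Lp_norm (ereal p) M v = \<infinity>")
  case False
  then obtain U V where U: "Lp_norm (ereal p) M u = ennreal U" "U \<ge> 0"
    and V: "Lp_norm (ereal p) M v = ennreal V" "V \<ge> 0"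
    by (metis ennreal_cases infinity_ennreal_def)
  have pu: "(\<integral>\<^sup>+x. ennreal (norm (u x) powr p) \<partial>M) \<le> ennreal (U powr p)"
    using p U by (subst Lp_norm_le_iff[symmetric]) auto
  have pv: "(\<integral>\<^sup>+x. ennreal (norm (v x) powr p) \<partial>M) \<le> ennreal (V powr p)"
    using p V by (subst Lp_norm_le_iff[symmetric]) auto
  have max_le: "(a + b) powr p \<le> 2 powr p * (a powr p + b powr p)" if "a \<ge> 0" "b \<ge> 0" for a b :: real
  proof -
    have "(a + b) powr p \<le> (2 * max a b) powr p" using that p by (intro powr_mono2) auto
    also have "\<dots> = 2 powr p * max a b powr p" using that by (simp add: powr_mult)
    also have "\<dots> \<le> 2 powr p * (a powr p + b powr p)"
      by (intro mult_left_mono) (auto simp: max_def)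
    finally show ?thesis .
  qed
  have "(\<integral>\<^sup>+x. ennreal (norm (w x) powr p) \<partial>M)
      \<le> (\<integral>\<^sup>+x. ennreal (2 powr p) * (ennreal (norm (u x) powr p) + ennreal (norm (v x) powr p)) \<partial>M)"
  proof (rule nn_integral_mono)
    fix x
    have "norm (w x) powr p \<le> (norm (u x) + norm (v x)) powr p"
      using p by (intro powr_mono2 w) auto
    also have "\<dots> \<le> 2 powr p * (norm (u x) powr p + norm (v x) powr p)"
      by (rule max_le) auto
    finally show "ennreal (norm (w x) powr p) \<le> ennreal (2 powr p) * (ennreal (norm (u x) powr p) + ennreal (norm (v x) powr p))"
      by (simp flip: ennreal_mult ennreal_plus add: ennreal_leI)
  qed
  also have "\<dots> = ennreal (2 powr p) * ((\<integral>\<^sup>+x. ennreal (norm (u x) powr p) \<partial>M) + (\<integral>\<^sup>+x. ennreal (norm (v x) powr p) \<partial>M))"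
    by (simp add: nn_integral_cmult nn_integral_add)
  also have "\<dots> \<le> ennreal (2 powr p) * (ennreal (U powr p) + ennreal (V powr p))"
    by (intro mult_left_mono add_mono pu pv) auto
  also have "\<dots> = ennreal (2 powr p * (U powr p + V powr p))"
    by (simp flip: ennreal_mult ennreal_plus)
  also have "\<dots> \<le> ennreal ((4 * (U + V)) powr p)"
  proof (rule ennreal_leI)
    \<comment> \<open>The factor 4 is 2 * 2: one 2 from replacing a sum by twice the maximum, the
      other from U powr p + V powr p \<le> 2 (U + V) powr p \<le> 2 powr p * (U + V) powr p.\<close>
    have "2 powr 1 \<le> 2 powr p" using p by (intro powr_mono) auto
    then have "2 * (U + V) powr p \<le> 2 powr p * (U + V) powr p"
      by (intro mult_right_mono) auto
    moreover have "U powr p \<le> (U + V) powr p" "V powr p \<le> (U + V) powr p"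
      using U V p by (auto intro: powr_mono2)
    ultimately have "2 powr p * (U powr p + V powr p) \<le> 2 powr p * (2 powr p * (U + V) powr p)"
      by (intro mult_left_mono) auto
    also have "\<dots> = (4 * (U + V)) powr p"
    proof -
      have "(2 * (2 * (U + V))) powr p = 2 powr p * (2 powr p * (U + V) powr p)"
        using U V by (simp only: powr_mult)
      then show ?thesis by simp
    qed
    finally show "2 powr p * (U powr p + V powr p) \<le> (4 * (U + V)) powr p" .
  qed
  finally have "Lp_norm (ereal p) M w \<le> ennreal (4 * (U + V))"
    using p U V by (subst Lp_norm_le_iff) auto
  also have "\<dots> = 4 * (Lp_norm (ereal p) M u + Lp_norm (ereal p) M v)"
    using U V by (simp add: ennreal_mult)
  finally show ?thesis .
qed (auto simp: ennreal_mult_eq_top_iff)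

lemma Lp_norm_2_square_le_iff:
  "c \<ge> 0 \<Longrightarrow> (\<integral>\<^sup>+x. ennreal ((norm (f x))\<^sup>2) \<partial>M) \<le> ennreal (c\<^sup>2) \<longleftrightarrow> Lp_norm 2 M f \<le> ennreal c"
  unfolding Lp_norm_2 by (subst epowr_le_iff) auto

text \<open>Completeness with an explicit rate: a rapidly convergent subsequence has an almost
  everywhere limit, and Fatou's lemma along that subsequence transfers the Cauchy bound to the
  limit.\<close>

lemma Riesz_Fischer_2:
  fixes h :: "nat \<Rightarrow> 'a \<Rightarrow> complex"
  assumes [measurable]: "\<And>n. h n \<in> borel_measurable M"
    and e: "e \<longlonglongrightarrow> 0" "\<And>n. e n \<ge> 0"
    and Cauchy: "\<And>m n. Lp_norm 2 M (\<lambda>x. h m x - h n x) \<le> ennreal (e m + e n)"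
  obtains F where "F \<in> borel_measurable M" "\<And>n. Lp_norm 2 M (\<lambda>x. h n x - F x) \<le> ennreal (e n)"
proof -
  have "\<exists>r. e r \<le> (1/4) ^ k" for k
  proof -
    have "\<forall>\<^sub>F n in sequentially. e n < (1/4) ^ k" using e(1) by (rule order_tendstoD) simp
    then show ?thesis by (auto dest!: eventually_happens intro: less_imp_le)
  qed
  then obtain r where r: "\<And>k. e (r k) \<le> (1/4) ^ k" by metis
  define d where "d k x = h (r (Suc k)) x - h (r k) x" for k x
  have [measurable]: "d k \<in> borel_measurable M" for k unfolding d_def by measurable
  have d_le: "(\<integral>\<^sup>+x. ennreal ((norm (d k x))\<^sup>2) \<partial>M) \<le> ennreal ((2 * (1/4) ^ k)\<^sup>2)" for k
  proof -
    have "(1/4::real) ^ Suc k \<le> (1/4) ^ k" by simp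
    then have "e (r (Suc k)) + e (r k) \<le> 2 * (1/4) ^ k" using r[of k] r[of "Suc k"] by linarith
    then have "Lp_norm 2 M (d k) \<le> ennreal (2 * (1/4) ^ k)"
      using Cauchy[of "r (Suc k)" "r k"] unfolding d_def[abs_def] by (meson ennreal_leI order_trans)
    then show ?thesis by (subst Lp_norm_2_square_le_iff) auto
  qed
  have "(\<integral>\<^sup>+x. (\<Sum>k. ennreal (4 ^ k * (norm (d k x))\<^sup>2)) \<partial>M) = (\<Sum>k. \<integral>\<^sup>+x. ennreal (4 ^ k * (norm (d k x))\<^sup>2) \<partial>M)"
    by (rule nn_integral_suminf) measurable
  also have "\<dots> \<le> (\<Sum>k. ennreal (4 * (1/4) ^ k))"
  proof (intro suminf_le summableI)
    fix k
    have "(\<integral>\<^sup>+x. ennreal (4 ^ k * (norm (d k x))\<^sup>2) \<partial>M) = ennreal (4 ^ k) * (\<integral>\<^sup>+x. ennreal ((norm (d k x))\<^sup>2) \<partial>M)"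
      by (subst nn_integral_cmult[symmetric]) (auto simp: ennreal_mult)
    also have "\<dots> \<le> ennreal (4 ^ k) * ennreal ((2 * (1/4) ^ k)\<^sup>2)"
      by (intro mult_left_mono d_le) simp
    also have "\<dots> = ennreal (4 * (1/4) ^ k)"
    proof -
      have "4 ^ k * (2 * (1/4) ^ k)\<^sup>2 = 4 * ((4 * (1/4)) ^ k * (1/4::real) ^ k)"
        unfolding power_mult_distrib by (simp add: power2_eq_square)
      then show ?thesis by (simp flip: ennreal_mult)
    qed
    finally show "(\<integral>\<^sup>+x. ennreal (4 ^ k * (norm (d k x))\<^sup>2) \<partial>M) \<le> ennreal (4 * (1/4) ^ k)" .
  qed
  also have "\<dots> < \<infinity>"
    by (subst suminf_ennreal2) (auto intro!: summable_mult summable_geometric)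
  finally have "AE x in M. (\<Sum>k. ennreal (4 ^ k * (norm (d k x))\<^sup>2)) \<noteq> \<infinity>"
    by (intro nn_integral_PInf_AE) auto
  then have conv: "AE x in M. convergent (\<lambda>k. h (r k) x)"
  proof eventually_elim
    case (elim x)
    then have "summable (\<lambda>k. 4 ^ k * (norm (d k x))\<^sup>2)"
      by (intro summable_suminf_not_top) auto
    then have "(\<lambda>k. 4 ^ k * (norm (d k x))\<^sup>2) \<longlonglongrightarrow> 0" by (rule summable_LIMSEQ_zero)
    then have "\<forall>\<^sub>F k in sequentially. 4 ^ k * (norm (d k x))\<^sup>2 < 1" by (rule order_tendstoD) simp
    then have "\<forall>\<^sub>F k in sequentially. norm (d k x) \<le> (1/2) ^ k"
    proof eventually_elim
      case (elim k)
      have "(4::real) ^ k = (2 ^ k)\<^sup>2" by (simp add: power2_eq_square flip: power_mult_distrib)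
      with elim have "(2 ^ k * norm (d k x))\<^sup>2 \<le> 1\<^sup>2" by (simp add: power_mult_distrib)
      then have "2 ^ k * norm (d k x) \<le> 1" by (rule power2_le_imp_le) simp
      then show ?case by (simp add: power_one_over field_simps)
    qed
    then have "summable (\<lambda>k. d k x)"
      by (rule summable_comparison_test_ev) (simp add: summable_geometric)
    then have "convergent (\<lambda>n. \<Sum>k<n. d k x)" by (simp add: summable_iff_convergent)
    moreover have "(\<Sum>k<n. d k x) = h (r n) x - h (r 0) x" for n
      unfolding d_def by (rule sum_lessThan_telescope)
    ultimately have "convergent (\<lambda>n. h (r n) x - h (r 0) x)" by simp
    then have "convergent (\<lambda>n. h (r n) x - h (r 0) x + h (r 0) x)"
      by (intro convergent_add convergent_const)
    then show ?case by simp
  qed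
  define F where "F x = lim (\<lambda>k. h (r k) x)" for x
  have [measurable]: "F \<in> borel_measurable M" unfolding F_def by measurable
  have r0: "(\<lambda>k. e (r k)) \<longlonglongrightarrow> 0"
  proof (rule tendsto_sandwich[of "\<lambda>_. 0" _ _ "\<lambda>k. (1/4) ^ k"])
    show "(\<lambda>k. (1/4::real) ^ k) \<longlonglongrightarrow> 0" by (rule LIMSEQ_power_zero) simp
  qed (use r e in auto)
  \<comment> \<open>The slack \<open>t\<close> dominates e (r k) for all large k; it is let go to 0
    afterwards.\<close>
  have le_add: "Lp_norm 2 M (\<lambda>x. h n x - F x) \<le> ennreal (e n + t)" if t: "t > 0" for n t
  proof -
    have "(\<integral>\<^sup>+x. ennreal ((norm (h n x - F x))\<^sup>2) \<partial>M) = (\<integral>\<^sup>+x. liminf (\<lambda>k. ennreal ((norm (h n x - h (r k) x))\<^sup>2)) \<partial>M)"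
    proof (rule nn_integral_cong_AE, use conv in eventually_elim)
      fix x assume "convergent (\<lambda>k. h (r k) x)"
      then have "(\<lambda>k. h (r k) x) \<longlonglongrightarrow> F x" by (simp add: F_def convergent_LIMSEQ_iff)
      then have "(\<lambda>k. ennreal ((norm (h n x - h (r k) x))\<^sup>2)) \<longlonglongrightarrow> ennreal ((norm (h n x - F x))\<^sup>2)"
        by (intro tendsto_intros)
      then show "ennreal ((norm (h n x - F x))\<^sup>2) = liminf (\<lambda>k. ennreal ((norm (h n x - h (r k) x))\<^sup>2))"
        using lim_imp_Liminf[OF sequentially_bot] by force
    qed
    also have "\<dots> \<le> liminf (\<lambda>k. \<integral>\<^sup>+x. ennreal ((norm (h n x - h (r k) x))\<^sup>2) \<partial>M)"
      by (rule nn_integral_liminf) measurable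
    also have "\<dots> \<le> liminf (\<lambda>k. ennreal ((e n + t)\<^sup>2))"
    proof (rule Liminf_mono)
      have "\<forall>\<^sub>F k in sequentially. e (r k) < t" using r0 t by (rule order_tendstoD)
      then show "\<forall>\<^sub>F k in sequentially. (\<integral>\<^sup>+x. ennreal ((norm (h n x - h (r k) x))\<^sup>2) \<partial>M) \<le> ennreal ((e n + t)\<^sup>2)"
      proof eventually_elim
        case (elim k)
        have "Lp_norm 2 M (\<lambda>x. h n x - h (r k) x) \<le> ennreal (e n + e (r k))" by (rule Cauchy)
        also have "\<dots> \<le> ennreal (e n + t)" using elim by (intro ennreal_leI) simp
        finally show ?case using e(2)[of n] t by (subst Lp_norm_2_square_le_iff) auto
      qed
    qed
    also have "\<dots> = ennreal ((e n + t)\<^sup>2)" by (simp add: Liminf_const)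
    finally show ?thesis using e(2)[of n] t by (subst (asm) Lp_norm_2_square_le_iff) auto
  qed
  have "Lp_norm 2 M (\<lambda>x. h n x - F x) \<le> ennreal (e n)" for n
  proof (rule ennreal_le_epsilon)
    fix t :: real assume "t > 0"
    then show "Lp_norm 2 M (\<lambda>x. h n x - F x) \<le> ennreal (e n) + ennreal t"
      using le_add[of t n] e(2)[of n] by simp
  qed
  then show thesis using that[of F] by simp
qed


lemma Lp_norm_2_quasi_triangle:
  assumes "u \<in> borel_measurable M" "v \<in> borel_measurable M" "\<And>x. norm (w x) \<le> norm (u x) + norm (v x)"
  shows "Lp_norm 2 M w \<le> 4 * (Lp_norm 2 M u + Lp_norm 2 M v)"
  using Lp_norm_quasi_triangle[of 2 u M v w] assms by simp

text \<open>\<open>F\<close> is the limit along one approximating sequence, and every other sequence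
  is compared with that one term by term. The factor 16 comes from two quasi-triangle inequalities,
  between \<open>F\<close> and the transform of \<phi> n and between \<phi> n and
  \<open>f\<close>.\<close>

lemma fourier_extension_exists:
  fixes \<mu> :: "'a::euclidean_space measure"
  assumes fin: "finite_measure \<mu>" and sets: "sets \<mu> = sets borel" and p: "p \<ge> 1" and C: "C > 0"
    and bound: "\<And>\<phi>. integrable lborel \<phi> \<Longrightarrow>
      Lp_norm 2 \<mu> (fourier lborel \<phi>) \<le> ennreal C * Lp_norm (ereal p) lborel \<phi>"
    and f: "f \<in> Lp_space (ereal p) lborel"
  shows "\<exists>F. fourier_extension \<mu> (ereal p) f F \<and> Lp_norm 2 \<mu> F \<le> ennreal (16 * C) * Lp_norm (ereal p) lborel f"
proof (cases "\<exists>\<phi> :: nat \<Rightarrow> 'a \<Rightarrow> complex. (\<forall>n. schwartz (\<phi> n)) \<and> (\<lambda>n. Lp_norm (ereal p) lborel (\<lambda>x. \<phi> n x - f x)) \<longlonglongrightarrow> 0")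
  case False
  \<comment> \<open>Without an approximating sequence the convergence clause is vacuous, and the
    zero function meets the norm bound.\<close>
  have "Lp_norm 2 \<mu> (\<lambda>_. 0) = 0" unfolding Lp_norm_2 by (simp add: epowr_def)
  moreover from this have "(\<lambda>_. 0) \<in> Lp_space 2 \<mu>" unfolding Lp_space_def by simp
  ultimately show ?thesis using False unfolding fourier_extension_def by (intro exI[of _ "\<lambda>_. 0"]) auto
next
  case True
  define N where "N u = Lp_norm (ereal p) lborel u" for u :: "'a \<Rightarrow> complex"
  have [measurable]: "f \<in> borel_measurable borel" using f by (simp add: Lp_space_def)
  have schwartz_measurable: "\<phi> \<in> borel_measurable borel" if "schwartz \<phi>" for \<phi> :: "'a \<Rightarrow> complex"
    using borel_measurable_integrable[OF schwartz_integrable[OF that]] by simp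
  have fourier_measurable: "fourier lborel \<phi> \<in> borel_measurable \<mu>" if "schwartz \<phi>" for \<phi> :: "'a \<Rightarrow> complex"
    unfolding measurable_cong_sets[OF sets refl]
    by (rule borel_measurable_fourier) (auto intro: lborel.sigma_finite_measure_axioms schwartz_measurable that)
  \<comment> \<open>Measuring both functions by their distance to \<open>f\<close> serves twice:
    within one sequence it gives the Cauchy property, between two sequences the independence of the
    limit.\<close>
  have diff: "Lp_norm 2 \<mu> (\<lambda>x. fourier lborel \<phi> x - fourier lborel \<psi> x)
      \<le> ennreal (4 * C) * (N (\<lambda>x. \<phi> x - f x) + N (\<lambda>x. \<psi> x - f x))"
    if \<phi>: "schwartz \<phi>" and \<psi>: "schwartz \<psi>" for \<phi> \<psi> :: "'a \<Rightarrow> complex"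
  proof -
    note [measurable] = schwartz_measurable[OF \<phi>] schwartz_measurable[OF \<psi>]
    note int = schwartz_integrable[OF \<phi>] schwartz_integrable[OF \<psi>]
    have N_le: "N (\<lambda>x. \<phi> x - \<psi> x) \<le> 4 * (N (\<lambda>x. \<phi> x - f x) + N (\<lambda>x. \<psi> x - f x))"
      unfolding N_def
    proof (rule Lp_norm_quasi_triangle[OF p])
      show "norm (\<phi> x - \<psi> x) \<le> norm (\<phi> x - f x) + norm (\<psi> x - f x)" for x
        using norm_triangle_ineq4[of "\<phi> x - f x" "\<psi> x - f x"] by simp
    qed simp_all
    have kernel: "integrable lborel (\<lambda>y. cis (- (2 * pi * (x \<bullet> y))) * \<eta> y)"
      if \<eta>: "integrable lborel \<eta>" for \<eta> :: "'a \<Rightarrow> complex" and x :: 'a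
    proof (rule Bochner_Integration.integrable_bound[OF \<eta>])
      have [measurable]: "\<eta> \<in> borel_measurable borel" using borel_measurable_integrable[OF \<eta>] by simp
      show "(\<lambda>y. cis (- (2 * pi * (x \<bullet> y))) * \<eta> y) \<in> borel_measurable lborel" by measurable
    qed (simp add: norm_mult)
    have "fourier lborel \<phi> x - fourier lborel \<psi> x = fourier lborel (\<lambda>x. \<phi> x - \<psi> x) x" for x
      unfolding fourier_def right_diff_distrib
      by (rule Bochner_Integration.integral_diff[OF kernel[OF int(1)] kernel[OF int(2)], symmetric])
    then have "Lp_norm 2 \<mu> (\<lambda>x. fourier lborel \<phi> x - fourier lborel \<psi> x)
      = Lp_norm 2 \<mu> (fourier lborel (\<lambda>x. \<phi> x - \<psi> x))" by simp
    also have "\<dots> \<le> ennreal C * N (\<lambda>x. \<phi> x - \<psi> x)"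
      unfolding N_def by (rule bound) (use int in simp)
    also have "\<dots> \<le> ennreal C * (4 * (N (\<lambda>x. \<phi> x - f x) + N (\<lambda>x. \<psi> x - f x)))"
      by (intro mult_left_mono N_le) simp
    finally show ?thesis using C by (simp add: ennreal_mult mult_ac)
  qed
  from True obtain \<phi>0 :: "nat \<Rightarrow> 'a \<Rightarrow> complex" where \<phi>0: "\<And>n. schwartz (\<phi>0 n)"
    and lim0: "(\<lambda>n. N (\<lambda>x. \<phi>0 n x - f x)) \<longlonglongrightarrow> 0" unfolding N_def by blast
  have "\<forall>\<^sub>F n in sequentially. N (\<lambda>x. \<phi>0 n x - f x) < 1" using lim0 by (rule order_tendstoD) simp
  then obtain n0 where n0: "\<And>n. n \<ge> n0 \<Longrightarrow> N (\<lambda>x. \<phi>0 n x - f x) < 1"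
    by (auto simp: eventually_sequentially)
  \<comment> \<open>Dropping the first terms makes all distances to \<open>f\<close> finite, so that
    \<open>enn2real\<close> loses nothing.\<close>
  define \<phi> where "\<phi> n = \<phi>0 (n + n0)" for n
  have \<phi>: "schwartz (\<phi> n)" for n unfolding \<phi>_def by (rule \<phi>0)
  note [measurable] = schwartz_measurable[OF \<phi>] fourier_measurable[OF \<phi>]
  define a where "a n = enn2real (N (\<lambda>x. \<phi> n x - f x))" for n
  have a: "N (\<lambda>x. \<phi> n x - f x) = ennreal (a n)" "a n \<ge> 0" for n
    using n0[of "n + n0"] by (auto simp: a_def \<phi>_def dest: less_trans[OF _ ennreal_one_less_top])
  have a_lim: "a \<longlonglongrightarrow> 0"
    unfolding a_def \<phi>_def using LIMSEQ_ignore_initial_segment[OF lim0, of n0]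
    by (intro tendsto_enn2real) auto
  define e where "e n = 4 * C * a n" for n
  have e: "e \<longlonglongrightarrow> 0" "\<And>n. e n \<ge> 0"
    unfolding e_def using a C tendsto_mult_left[OF a_lim, of "4 * C"] by auto
  obtain F where [measurable]: "F \<in> borel_measurable \<mu>"
    and F: "\<And>n. Lp_norm 2 \<mu> (\<lambda>x. fourier lborel (\<phi> n) x - F x) \<le> ennreal (e n)"
  proof (rule Riesz_Fischer_2[where h="\<lambda>n. fourier lborel (\<phi> n)" and e=e and M=\<mu>])
    fix m n
    have "Lp_norm 2 \<mu> (\<lambda>x. fourier lborel (\<phi> m) x - fourier lborel (\<phi> n) x)
      \<le> ennreal (4 * C) * (ennreal (a m) + ennreal (a n))"
      using diff[OF \<phi> \<phi>, of m n] by (simp only: a(1))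
    also have "\<dots> = ennreal (e m + e n)"
      using a C by (simp add: e_def distrib_left flip: ennreal_mult ennreal_plus)
    finally show "Lp_norm 2 \<mu> (\<lambda>x. fourier lborel (\<phi> m) x - fourier lborel (\<phi> n) x) \<le> ennreal (e m + e n)" .
  qed (use e in auto)
  obtain r where r: "N f = ennreal r" "r \<ge> 0"
    using f unfolding Lp_space_def N_def by (cases "Lp_norm (ereal p) lborel f" rule: ennreal_cases) auto
  have F_le: "Lp_norm 2 \<mu> F \<le> ennreal (4 * (4 * C * (a n + r) + e n))" for n
  proof -
    have "Lp_norm 2 \<mu> F \<le> 4 * (Lp_norm 2 \<mu> (fourier lborel (\<phi> n)) + Lp_norm 2 \<mu> (\<lambda>x. fourier lborel (\<phi> n) x - F x))"
    proof (rule Lp_norm_2_quasi_triangle)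
      show "norm (F x) \<le> norm (fourier lborel (\<phi> n) x) + norm (fourier lborel (\<phi> n) x - F x)" for x
        using norm_triangle_ineq4[of "fourier lborel (\<phi> n) x" "fourier lborel (\<phi> n) x - F x"] by simp
    qed simp_all
    also have "\<dots> \<le> 4 * (ennreal C * ennreal (4 * (a n + r)) + ennreal (e n))"
    proof (intro mult_left_mono add_mono F)
      have "N (\<phi> n) \<le> 4 * (N (\<lambda>x. \<phi> n x - f x) + N f)"
        unfolding N_def
      proof (rule Lp_norm_quasi_triangle[OF p])
        show "norm (\<phi> n x) \<le> norm (\<phi> n x - f x) + norm (f x)" for x
          using norm_triangle_ineq[of "\<phi> n x - f x" "f x"] by simp
      qed simp_all
      also have "\<dots> = ennreal (4 * (a n + r))"
        using a r by (simp add: ennreal_mult ennreal_plus)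
      finally have "ennreal C * N (\<phi> n) \<le> ennreal C * ennreal (4 * (a n + r))"
        by (rule mult_left_mono) simp
      then show "Lp_norm 2 \<mu> (fourier lborel (\<phi> n)) \<le> ennreal C * ennreal (4 * (a n + r))"
        using bound[OF schwartz_integrable[OF \<phi>[of n]]] unfolding N_def by (rule order_trans[rotated])
    qed simp
    also have "\<dots> = ennreal (4 * (4 * C * (a n + r) + e n))"
    proof -
      have "ennreal C * ennreal (4 * (a n + r)) + ennreal (e n) = ennreal (C * (4 * (a n + r)) + e n)"
        using a[of n] r e(2)[of n] C by (simp add: ennreal_mult[symmetric] ennreal_plus[symmetric] del: ennreal_plus)
      also have "C * (4 * (a n + r)) + e n = 4 * C * (a n + r) + e n" by simp
      finally have eq: "ennreal C * ennreal (4 * (a n + r)) + ennreal (e n) = ennreal (4 * C * (a n + r) + e n)" .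
      have "4 * C * (a n + r) + e n \<ge> 0" using a[of n] r e(2)[of n] C by simp
      then show ?thesis unfolding eq by (subst ennreal_mult) auto
    qed
    finally show ?thesis .
  qed
  have F_bound: "Lp_norm 2 \<mu> F \<le> ennreal (16 * C) * N f"
  proof -
    have "(\<lambda>n. 4 * (4 * C * (a n + r) + e n)) \<longlonglongrightarrow> 4 * (4 * C * (0 + r) + 0)"
      by (intro tendsto_intros a_lim e)
    then have "(\<lambda>n. ennreal (4 * (4 * C * (a n + r) + e n))) \<longlonglongrightarrow> ennreal (4 * (4 * C * (0 + r) + 0))"
      by (rule tendsto_ennrealI)
    then have "Lp_norm 2 \<mu> F \<le> ennreal (4 * (4 * C * (0 + r) + 0))"
      by (rule LIMSEQ_le_const) (use F_le in blast)
    also have "\<dots> = ennreal (16 * C) * N f"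
      using C r by (simp flip: ennreal_mult)
    finally show ?thesis .
  qed
  then have "Lp_norm 2 \<mu> F < \<infinity>"
    using r C by (auto simp: ennreal_mult_less_top intro: le_less_trans simp flip: ennreal_mult)
  then have F2: "F \<in> Lp_space 2 \<mu>" by (simp add: Lp_space_def)
  have "(\<lambda>n. Lp_norm 2 \<mu> (\<lambda>\<xi>. fourier lborel (\<psi> n) \<xi> - F \<xi>)) \<longlonglongrightarrow> 0"
    if \<psi>: "\<And>n. schwartz (\<psi> n)" and lim: "(\<lambda>n. N (\<lambda>x. \<psi> n x - f x)) \<longlonglongrightarrow> 0"
    for \<psi> :: "nat \<Rightarrow> 'a \<Rightarrow> complex"
  proof (rule tendsto_sandwich[of "\<lambda>_. 0" _ _
        "\<lambda>n. 4 * (ennreal (4 * C) * (N (\<lambda>x. \<psi> n x - f x) + ennreal (a n)) + ennreal (e n))"])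
    note [measurable] = fourier_measurable[OF \<psi>]
    have "(\<lambda>n. 4 * (ennreal (4 * C) * (N (\<lambda>x. \<psi> n x - f x) + ennreal (a n)) + ennreal (e n)))
        \<longlonglongrightarrow> 4 * (ennreal (4 * C) * (0 + ennreal 0) + ennreal 0)"
      by (intro ennreal_tendsto_cmult tendsto_add tendsto_ennrealI lim a_lim e) auto
    then show "(\<lambda>n. 4 * (ennreal (4 * C) * (N (\<lambda>x. \<psi> n x - f x) + ennreal (a n)) + ennreal (e n))) \<longlonglongrightarrow> 0"
      by simp
    have "Lp_norm 2 \<mu> (\<lambda>\<xi>. fourier lborel (\<psi> n) \<xi> - F \<xi>)
      \<le> 4 * (ennreal (4 * C) * (N (\<lambda>x. \<psi> n x - f x) + ennreal (a n)) + ennreal (e n))" for n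
    proof -
      have "Lp_norm 2 \<mu> (\<lambda>\<xi>. fourier lborel (\<psi> n) \<xi> - F \<xi>)
        \<le> 4 * (Lp_norm 2 \<mu> (\<lambda>\<xi>. fourier lborel (\<psi> n) \<xi> - fourier lborel (\<phi> n) \<xi>) + Lp_norm 2 \<mu> (\<lambda>\<xi>. fourier lborel (\<phi> n) \<xi> - F \<xi>))"
      proof (rule Lp_norm_2_quasi_triangle)
        show "norm (fourier lborel (\<psi> n) x - F x)
          \<le> norm (fourier lborel (\<psi> n) x - fourier lborel (\<phi> n) x) + norm (fourier lborel (\<phi> n) x - F x)" for x
          using norm_triangle_ineq[of "fourier lborel (\<psi> n) x - fourier lborel (\<phi> n) x" "fourier lborel (\<phi> n) x - F x"] by simp
      qed simp_all
      also have "\<dots> \<le> 4 * (ennreal (4 * C) * (N (\<lambda>x. \<psi> n x - f x) + ennreal (a n)) + ennreal (e n))"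
        using diff[OF \<psi> \<phi>, of n n] by (intro mult_left_mono add_mono F) (simp_all add: a(1))
      finally show ?thesis .
    qed
    then show "\<forall>\<^sub>F n in sequentially. Lp_norm 2 \<mu> (\<lambda>\<xi>. fourier lborel (\<psi> n) \<xi> - F \<xi>)
      \<le> 4 * (ennreal (4 * C) * (N (\<lambda>x. \<psi> n x - f x) + ennreal (a n)) + ennreal (e n))" by simp
  qed auto
  with F2 have "fourier_extension \<mu> (ereal p) f F" unfolding fourier_extension_def N_def by blast
  with F_bound show ?thesis unfolding N_def by blast
qed

section \<open>Finiteness of the Fourier spectrum\<close>

lemma norm_cis_minus_1_le: "norm (cis t - 1) \<le> \<bar>t\<bar>"
  using iexp_approx1[of t 0] by (simp add: cis_conv_exp)

text \<open>Test the extension estimate on indicator functions of balls (Knapp's example).\<close>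

lemma extension_estimate_imp_frostman:
  fixes \<mu> :: "'a::euclidean_space measure"
  assumes fin: "finite_measure \<mu>" and sets: "sets \<mu> = sets borel" and q: "q > 0" and B: "B > 0"
    and ext: "\<And>f. f \<in> Lp_space 2 \<mu> \<Longrightarrow> Lp_norm (ereal q) lborel (fourier \<mu> f) \<le> ennreal B * Lp_norm 2 \<mu> f"
  obtains C where "C > 0" "\<And>x r. r > 0 \<Longrightarrow> measure \<mu> (ball x r) \<le> C * r powr (2 * real DIM('a) / q)"
proof -
  interpret finite_measure \<mu> by fact
  note [measurable_cong] = sets
  define d where "d = DIM('a)"
  define v where "v = unit_ball_vol (real d)"
  have v: "v > 0" by (simp add: v_def)
  define K where "K = (2 * B) powr q * (4 * pi) ^ d / v"
  have K: "K > 0" using B v by (simp add: K_def)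
  show thesis
  proof
    show "K powr (2 / q) > 0" using K by simp
    fix x :: 'a and r :: real assume r: "r > 0"
    define m where "m = measure \<mu> (ball x r)"
    show "measure \<mu> (ball x r) \<le> K powr (2 / q) * r powr (2 * real DIM('a) / q)"
    proof (cases "m = 0")
      case False
      then have m: "m > 0" unfolding m_def using zero_less_measure_iff by blast
      define f where "f = (\<lambda>y. complex_of_real (indicator (ball x r) y))"
      have [measurable]: "ball x r \<in> sets borel" by simp
      have [measurable]: "f \<in> borel_measurable \<mu>" unfolding f_def by measurable
      have f: "f \<in> Lp_space 2 \<mu>"
        by (rule bounded_in_Lp_space_2[OF fin, where B=1]) (auto simp: f_def)
      define F where "F = fourier \<mu> f"
      have [measurable]: "F \<in> borel_measurable borel"
        unfolding F_def by (rule borel_measurable_fourier) (auto intro: sigma_finite_measure_axioms simp: sets)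
      have "(LINT y|\<mu>. (norm (f y))\<^sup>2) = (LINT y|\<mu>. indicator (ball x r) y)"
        by (intro Bochner_Integration.integral_cong) (auto simp: f_def split: split_indicator)
      then have nf: "Lp_norm 2 \<mu> f = ennreal (sqrt m)"
        unfolding Lp_space_2(3)[OF f] by (simp add: m_def sets)
      \<comment> \<open>For \<xi> in this dual ball and y in the ball around x, the phase 2 pi
        (\<xi> \<bullet> (x - y)) is at most 1/2 in absolute value. There is thus no cancellation
        beyond half the mass, and the transform is at least m / 2.\<close>
      define \<rho> where "\<rho> = 1 / (4 * pi * r)"
      have \<rho>: "\<rho> > 0" using r by (simp add: \<rho>_def)
      have lower: "m / 2 \<le> norm (F \<xi>)" if \<xi>: "\<xi> \<in> ball 0 \<rho>" for \<xi>
      proof -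
        have int: "integrable \<mu> (\<lambda>y. cis (2 * pi * (\<xi> \<bullet> (x - y))) * f y)"
          by (rule integrable_const_bound[where B=1]) (auto simp: f_def norm_mult)
        have intf: "integrable \<mu> f" by (rule integrable_const_bound[where B=1]) (auto simp: f_def)
        have "cis (2 * pi * (\<xi> \<bullet> x)) * F \<xi> = (LINT y|\<mu>. cis (2 * pi * (\<xi> \<bullet> x)) * (cis (- (2 * pi * (\<xi> \<bullet> y))) * f y))"
          unfolding F_def fourier_def by simp
        also have "\<dots> = (LINT y|\<mu>. cis (2 * pi * (\<xi> \<bullet> (x - y))) * f y)"
          by (simp add: cis_mult inner_diff_right right_diff_distrib flip: mult.assoc)
        finally have eq: "cis (2 * pi * (\<xi> \<bullet> x)) * F \<xi> = (LINT y|\<mu>. cis (2 * pi * (\<xi> \<bullet> (x - y))) * f y)" .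
        have "(LINT y|\<mu>. f y) = complex_of_real m"
          unfolding f_def integral_complex_of_real by (simp add: m_def sets)
        then have "norm (cis (2 * pi * (\<xi> \<bullet> x)) * F \<xi> - complex_of_real m)
          = norm (LINT y|\<mu>. cis (2 * pi * (\<xi> \<bullet> (x - y))) * f y - f y)"
          unfolding eq using int intf by simp
        also have "\<dots> \<le> (LINT y|\<mu>. 1 / 2 * indicator (ball x r) y)"
        proof (rule order_trans[OF integral_norm_bound integral_mono])
          show "integrable \<mu> (\<lambda>y. norm (cis (2 * pi * (\<xi> \<bullet> (x - y))) * f y - f y))"
            using int intf by simp
          show "integrable \<mu> (\<lambda>y. 1 / 2 * indicator (ball x r) y :: real)"
            by (rule integrable_const_bound[where B=1]) (auto split: split_indicator)
          fix y
          have "norm (cis (2 * pi * (\<xi> \<bullet> (x - y))) - 1) \<le> 1 / 2" if y: "y \<in> ball x r"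
          proof -
            have "\<bar>\<xi> \<bullet> (x - y)\<bar> \<le> norm \<xi> * norm (x - y)" by (rule Cauchy_Schwarz_ineq2)
            also have "\<dots> \<le> \<rho> * r" using y \<xi> \<rho> by (intro mult_mono) (auto simp: dist_norm)
            also have "\<dots> = 1 / (4 * pi)" using r by (simp add: \<rho>_def)
            finally have "2 * pi * \<bar>\<xi> \<bullet> (x - y)\<bar> \<le> 2 * pi * (1 / (4 * pi))"
              by (intro mult_left_mono) auto
            then have "\<bar>2 * pi * (\<xi> \<bullet> (x - y))\<bar> \<le> 1 / 2" by (simp add: abs_mult)
            then show ?thesis using norm_cis_minus_1_le order_trans by blast
          qed
          then show "norm (cis (2 * pi * (\<xi> \<bullet> (x - y))) * f y - f y) \<le> 1 / 2 * indicator (ball x r) y"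
            by (auto simp: f_def split: split_indicator)
        qed
        also have "\<dots> = m / 2" by (simp add: m_def sets)
        finally have "norm (cis (2 * pi * (\<xi> \<bullet> x)) * F \<xi> - complex_of_real m) \<le> m / 2" .
        moreover have "norm (complex_of_real m) \<le> norm (cis (2 * pi * (\<xi> \<bullet> x)) * F \<xi>) + norm (cis (2 * pi * (\<xi> \<bullet> x)) * F \<xi> - complex_of_real m)"
          using norm_triangle_ineq4[of "cis (2 * pi * (\<xi> \<bullet> x)) * F \<xi>" "cis (2 * pi * (\<xi> \<bullet> x)) * F \<xi> - complex_of_real m"] by simp
        ultimately show ?thesis using m by (simp add: norm_mult)
      qed
      \<comment> \<open>Compare the contribution of the dual ball, of volume v \<rho> ^ d, with the
        extension bound (B sqrt m) powr q. Cancelling m powr (q / 2) leaves m powr (q / 2) \<le> K r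
        ^ d.\<close>
      have "ennreal ((m / 2) powr q * (v * \<rho> ^ d)) = (\<integral>\<^sup>+\<xi>. ennreal ((m / 2) powr q) * indicator (ball (0::'a) \<rho>) \<xi> \<partial>lborel)"
        using \<rho> v by (simp add: nn_integral_cmult_indicator emeasure_ball d_def v_def ennreal_mult)
      also have "\<dots> \<le> (\<integral>\<^sup>+\<xi>. ennreal (norm (F \<xi>) powr q) \<partial>lborel)"
        using lower m q by (intro nn_integral_mono) (auto split: split_indicator intro!: ennreal_leI powr_mono2)
      also have "\<dots> \<le> ennreal ((B * sqrt m) powr q)"
      proof (subst Lp_norm_le_iff[symmetric])
        show "Lp_norm (ereal q) lborel F \<le> ennreal (B * sqrt m)"
          using ext[OF f, unfolded nf] B m by (simp add: F_def ennreal_mult)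
      qed (use q B m in auto)
      finally have "(m / 2) powr q * (v * \<rho> ^ d) \<le> (B * sqrt m) powr q"
        by (subst (asm) ennreal_le_iff) auto
      moreover have "(m / 2) powr q = m powr (q / 2) * m powr (q / 2) / 2 powr q"
        using m by (simp add: powr_divide flip: powr_add)
      moreover have "(B * sqrt m) powr q = B powr q * m powr (q / 2)"
        using m B by (simp add: powr_mult powr_powr flip: powr_half_sqrt)
      ultimately have "m powr (q / 2) * (m powr (q / 2) * (v * \<rho> ^ d) / 2 powr q) \<le> m powr (q / 2) * B powr q"
        by (simp add: mult_ac)
      then have "m powr (q / 2) * (v * \<rho> ^ d) / 2 powr q \<le> B powr q"
        using m by (simp only: mult_le_cancel_left_pos powr_gt_zero)
      then have "m powr (q / 2) \<le> B powr q * 2 powr q / (v * \<rho> ^ d)"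
        using v \<rho> by (simp add: divide_le_eq le_divide_eq)
      also have "\<dots> = K * r ^ d"
        using r v B by (simp add: K_def \<rho>_def powr_mult power_divide power_mult_distrib field_simps)
      finally have "(m powr (q / 2)) powr (2 / q) \<le> (K * r ^ d) powr (2 / q)"
        using q by (intro powr_mono2) auto
      moreover have "(m powr (q / 2)) powr (2 / q) = m" using m q by (simp add: powr_powr)
      moreover have "(K * r ^ d) powr (2 / q) = K powr (2 / q) * r powr (2 * real d / q)"
        using r K by (simp add: powr_mult powr_powr mult.commute flip: powr_realpow)
      ultimately show ?thesis by (simp add: m_def d_def)
    qed (use K in \<open>simp add: m_def\<close>)
  qed
qed

lemma frostman_set_obtain:
  fixes \<mu> :: "'a::euclidean_space measure"
  assumes "frostman_dim \<mu> = ereal \<alpha>" "b < \<alpha>"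
  obtains a C where "b < a" "a \<le> \<alpha>" "C > 0" "\<And>x r. r > 0 \<Longrightarrow> measure \<mu> (ball x r) \<le> C * r powr a"
proof -
  let ?A = "{a::real. \<exists>C>0. \<forall>x. \<forall>r>0. measure \<mu> (ball x r) \<le> C * r powr a}"
  have sup: "(SUP a\<in>?A. ereal a) = ereal \<alpha>" using assms(1) by (simp add: frostman_dim_def)
  then have "ereal b < (SUP a\<in>?A. ereal a)" using assms(2) by simp
  then obtain a where a: "a \<in> ?A" "b < a" by (auto simp: less_SUP_iff)
  have "ereal a \<le> (SUP a\<in>?A. ereal a)" using a(1) by (rule SUP_upper)
  then have "a \<le> \<alpha>" using sup by simp
  with a that show thesis by blast
qed

text \<open>The condition \<open>t \<ge> 0\<close> excludes the default value 0 that the spectrum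
  takes when no \<open>s\<close> has finite energy.\<close>

lemma fourier_spectrum_obtain:
  assumes "ereal t < fourier_spectrum \<mu> \<theta>" "t \<ge> 0"
  obtains s where "t < s" "fourier_energy s \<theta> \<mu> < \<infinity>"
  using assms by (auto simp: fourier_spectrum_def less_SUP_iff split: if_splits)

text \<open>If arbitrarily large \<open>s\<close> had finite energy, the endpoint exponent would
  tend to 2 and the extension estimate would hold for every q > 2. Knapp's example then gives the
  Frostman exponent 2 d / q, which exceeds \<alpha> for q close to 2.\<close>

lemma fourier_spectrum_finite:
  fixes \<mu> :: "'a::euclidean_space measure"
  assumes fin: "finite_measure \<mu>" and sets: "sets \<mu> = sets borel"
    and dim: "frostman_dim \<mu> = ereal \<alpha>" "0 < \<alpha>" "\<alpha> < real DIM('a)" and \<theta>: "0 \<le> \<theta>" "\<theta> \<le> 1"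
  shows "fourier_spectrum \<mu> \<theta> \<noteq> \<infinity>"
proof
  assume inf: "fourier_spectrum \<mu> \<theta> = \<infinity>"
  define d where "d = real DIM('a)"
  have d: "d > 0" "\<alpha> < d" using dim by (auto simp: d_def)
  \<comment> \<open>Chosen so that the resulting Frostman exponent 2 d / q is the midpoint of
    \<alpha> and d; as the midpoint is below d, q exceeds 2.\<close>
  define q where "q = 2 * d / ((\<alpha> + d) / 2)"
  have q2: "q > 2" using d dim by (simp add: q_def less_divide_eq)
  have dq: "2 * d / q = (\<alpha> + d) / 2" using d dim by (simp add: q_def)
  obtain a C where a: "0 < a" "a \<le> \<alpha>" and C: "C > 0" and ball: "\<And>x r. r > 0 \<Longrightarrow> measure \<mu> (ball x r) \<le> C * r powr a"
    using frostman_set_obtain[OF dim(1,2)] by metis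
  \<comment> \<open>The endpoint exponent lies below \<open>q\<close> exactly when s - a \<theta> >
    X. The extra summand d in the lower bound for \<open>s\<close> below secures s > d
    \<theta>.\<close>
  define X where "X = 2 * ((d - a) * (2 - \<theta>)) / (q - 2)"
  have X: "X > 0" using a d \<theta> q2 by (simp add: X_def)
  obtain s where s: "d + a * \<theta> + X < s" "fourier_energy s \<theta> \<mu> < \<infinity>"
    using fourier_spectrum_obtain[of "d + a * \<theta> + X" \<mu> \<theta>] inf d a \<theta> X by auto
  have sa: "s - a * \<theta> > X" using s d by simp
  have "2 * ((d - a) * (2 - \<theta>)) < (q - 2) * (s - a * \<theta>)"
    using sa q2 by (simp add: X_def divide_less_eq mult.commute)
  then have q: "q > 2 + 2 * ((d - a) * (2 - \<theta>) / (s - a * \<theta>))"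
    using sa X by (simp add: less_diff_eq[symmetric] add.commute[of 2] divide_less_eq)
  have sd: "s > real DIM('a) * \<theta>"
  proof -
    have "d * \<theta> \<le> d * 1" using d \<theta> by (intro mult_left_mono) auto
    moreover have "a * \<theta> \<ge> 0" using a \<theta> by simp
    ultimately have "d * \<theta> < s" using s X by linarith
    then show ?thesis by (simp add: d_def)
  qed
  have ad: "a < real DIM('a)" using a d by (simp add: d_def)
  obtain B where B: "B > 0"
    "\<And>f. f \<in> Lp_space 2 \<mu> \<Longrightarrow> Lp_norm (ereal q) lborel (fourier \<mu> f) \<le> ennreal B * Lp_norm 2 \<mu> f"
    using extension_estimate[OF fin sets ball _ \<theta> sd ad s(2) q[unfolded d_def]] C q2 by auto
  obtain C' where "C' > 0" "\<And>x r. r > 0 \<Longrightarrow> measure \<mu> (ball x r) \<le> C' * r powr ((\<alpha> + d) / 2)"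
    using extension_estimate_imp_frostman[OF fin sets _ B] q2 dq unfolding d_def by (metis less_trans zero_less_numeral)
  then have "ereal ((\<alpha> + d) / 2) \<le> frostman_dim \<mu>"
    unfolding frostman_dim_def by (intro SUP_upper) auto
  then show False using dim d by simp
qed

section \<open>The ranges of exponents\<close>

lemma less_1_plus_ereal_iff: "ereal r < 1 + S \<longleftrightarrow> ereal (r - 1) < S"
  by (cases S) (auto simp: one_ereal_def)

lemma two_plus_less_ereal_iff: "2 + 2 * I < ereal r \<longleftrightarrow> I < ereal ((r - 2) / 2)"
  by (cases I) auto

lemma two_plus_less_infinity_iff: "2 + 2 * I < (\<infinity>::ereal) \<longleftrightarrow> I < \<infinity>"
  by (cases I) auto

context
  fixes \<mu> :: "'a::euclidean_space measure" and \<alpha> :: real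
  assumes fin: "finite_measure \<mu>" and sets: "sets \<mu> = sets borel"
    and dim: "frostman_dim \<mu> = ereal \<alpha>" "0 < \<alpha>" "\<alpha> < real DIM('a)"
begin

definition spectrum_real :: "real \<Rightarrow> real" where
  "spectrum_real \<theta> = real_of_ereal (fourier_spectrum \<mu> \<theta>)"

definition exponent_term :: "real \<Rightarrow> real" where
  "exponent_term \<theta> = (real DIM('a) - \<alpha>) * (2 - \<theta>) / (spectrum_real \<theta> - \<alpha> * \<theta>)"

lemma admissible:
  assumes "\<theta> \<in> admissible_thetas \<mu>"
  shows "0 \<le> \<theta>" "\<theta> \<le> 1" "fourier_spectrum \<mu> \<theta> = ereal (spectrum_real \<theta>)"
    "real DIM('a) * \<theta> < spectrum_real \<theta>" "\<alpha> * \<theta> < spectrum_real \<theta>" "exponent_term \<theta> > 0"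
proof -
  show \<theta>: "0 \<le> \<theta>" "\<theta> \<le> 1" using assms by (auto simp: admissible_thetas_def)
  have gt: "ereal (real DIM('a) * \<theta>) < fourier_spectrum \<mu> \<theta>"
    using assms by (simp add: admissible_thetas_def)
  show eq: "fourier_spectrum \<mu> \<theta> = ereal (spectrum_real \<theta>)"
    using gt fourier_spectrum_finite[OF fin sets dim \<theta>]
    by (cases "fourier_spectrum \<mu> \<theta>") (auto simp: spectrum_real_def)
  show gt': "real DIM('a) * \<theta> < spectrum_real \<theta>" using gt by (simp add: eq)
  have "\<alpha> * \<theta> \<le> real DIM('a) * \<theta>" using dim \<theta> by (intro mult_right_mono) auto
  with gt' show less: "\<alpha> * \<theta> < spectrum_real \<theta>" by simp
  show "exponent_term \<theta> > 0" using less \<theta> dim by (simp add: exponent_term_def)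
qed

text \<open>A strict inequality against an infimum is witnessed by a single \<theta>, whether or not
  the infimum is attained. Finiteness of the spectrum turns the quotients into real numbers.\<close>

lemma extension_range_iff:
  "ereal r \<in> extension_range \<mu> \<alpha> \<longleftrightarrow> (\<exists>\<theta>\<in>admissible_thetas \<mu>. 2 + 2 * exponent_term \<theta> < r)"
  "\<infinity> \<in> extension_range \<mu> \<alpha> \<longleftrightarrow> admissible_thetas \<mu> \<noteq> {}"
  "- \<infinity> \<notin> extension_range \<mu> \<alpha>"
proof -
  have eq: "(INF \<theta> \<in> admissible_thetas \<mu>.
           ereal ((real DIM('a) - \<alpha>) * (2 - \<theta>)) / (fourier_spectrum \<mu> \<theta> - ereal (\<alpha> * \<theta>)))
    = (INF \<theta> \<in> admissible_thetas \<mu>. ereal (exponent_term \<theta>))"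
  proof (intro INF_cong refl)
    fix \<theta> assume "\<theta> \<in> admissible_thetas \<mu>"
    from admissible(3,5)[OF this]
    show "ereal ((real DIM('a) - \<alpha>) * (2 - \<theta>)) / (fourier_spectrum \<mu> \<theta> - ereal (\<alpha> * \<theta>)) = ereal (exponent_term \<theta>)"
      by (simp add: exponent_term_def)
  qed
  show "ereal r \<in> extension_range \<mu> \<alpha> \<longleftrightarrow> (\<exists>\<theta>\<in>admissible_thetas \<mu>. 2 + 2 * exponent_term \<theta> < r)"
    unfolding extension_range_def eq mem_Collect_eq two_plus_less_ereal_iff INF_less_iff
    by (auto simp: less_divide_eq algebra_simps)
  show "\<infinity> \<in> extension_range \<mu> \<alpha> \<longleftrightarrow> admissible_thetas \<mu> \<noteq> {}"
    unfolding extension_range_def eq mem_Collect_eq two_plus_less_infinity_iff INF_less_iff by auto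
  show "- \<infinity> \<notin> extension_range \<mu> \<alpha>" by (simp add: extension_range_def)
qed

lemma restriction_range_iff:
  "ereal r \<in> restriction_range \<mu> \<alpha> \<longleftrightarrow>
    1 \<le> r \<and> (\<exists>\<theta>\<in>admissible_thetas \<mu>. r < 1 + 1 / (1 + 2 * exponent_term \<theta>))"
  "\<infinity> \<notin> restriction_range \<mu> \<alpha>" "- \<infinity> \<notin> restriction_range \<mu> \<alpha>"
proof -
  have eq: "(fourier_spectrum \<mu> \<theta> - ereal (\<alpha> * \<theta>)) /
           (fourier_spectrum \<mu> \<theta> + ereal (4 * (real DIM('a) - \<alpha>)) - ereal (\<theta> * (2 * real DIM('a) - \<alpha>)))
    = ereal (1 / (1 + 2 * exponent_term \<theta>))" if \<theta>: "\<theta> \<in> admissible_thetas \<mu>" for \<theta>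
  proof -
    \<comment> \<open>The denominator of the restriction quotient is u + 2 v, and
      \<open>exponent_term \<theta>\<close> is v / u. The quotient is therefore 1 / (1 + 2 v /
      u).\<close>
    define u where "u = spectrum_real \<theta> - \<alpha> * \<theta>"
    define v where "v = (real DIM('a) - \<alpha>) * (2 - \<theta>)"
    have u: "u > 0" and v: "v > 0" using admissible[OF \<theta>] dim by (auto simp: u_def v_def)
    have "spectrum_real \<theta> + 4 * (real DIM('a) - \<alpha>) - \<theta> * (2 * real DIM('a) - \<alpha>) = u + 2 * v"
      by (simp add: u_def v_def algebra_simps)
    moreover have "u + 2 * v \<noteq> 0" using u v by simp
    moreover have "u / (u + 2 * v) = 1 / (1 + 2 * exponent_term \<theta>)"
      using u v by (simp add: exponent_term_def u_def[symmetric] v_def[symmetric] field_simps)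
    ultimately show ?thesis unfolding admissible(3)[OF \<theta>] by (simp add: u_def[symmetric])
  qed
  then have "(SUP \<theta> \<in> admissible_thetas \<mu>.
           (fourier_spectrum \<mu> \<theta> - ereal (\<alpha> * \<theta>)) /
           (fourier_spectrum \<mu> \<theta> + ereal (4 * (real DIM('a) - \<alpha>)) - ereal (\<theta> * (2 * real DIM('a) - \<alpha>))))
    = (SUP \<theta> \<in> admissible_thetas \<mu>. ereal (1 / (1 + 2 * exponent_term \<theta>)))"
    by (intro SUP_cong refl)
  note range = restriction_range_def[of \<mu> \<alpha>, unfolded this]
  show "ereal r \<in> restriction_range \<mu> \<alpha> \<longleftrightarrow>
    1 \<le> r \<and> (\<exists>\<theta>\<in>admissible_thetas \<mu>. r < 1 + 1 / (1 + 2 * exponent_term \<theta>))"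
    unfolding range mem_Collect_eq less_1_plus_ereal_iff less_SUP_iff
    by (auto simp: one_ereal_def diff_less_eq add.commute)
  show "\<infinity> \<notin> restriction_range \<mu> \<alpha>" "- \<infinity> \<notin> restriction_range \<mu> \<alpha>"
    unfolding range by auto
qed

text \<open>The ranges correspond separately for each \<theta>: for finite q > 1 the conjugate
  exponent is 1 + 1 / (q - 1), and q > 2 + 2 t says q - 1 > 1 + 2 t. The pair (\<infinity>, 1)
  belongs to both ranges as soon as some \<theta> is admissible, and the pair (1, \<infinity>) to
  neither.\<close>

lemma conjugate_ranges:
  assumes "conjugate_exponents q q'"
  shows "q \<in> extension_range \<mu> \<alpha> \<longleftrightarrow> q' \<in> restriction_range \<mu> \<alpha>"
proof -
  have q: "1 \<le> q" "1 \<le> q'" "1 / q + 1 / q' = 1" using assms by (auto simp: conjugate_exponents_def)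
  show ?thesis
  proof (cases q)
    case PInf
    have "q' \<noteq> \<infinity>" using q PInf by auto
    then obtain p where p: "q' = ereal p" using q by (cases q') auto
    then have "p = 1" using q PInf by (auto simp: one_ereal_def split: if_splits)
    have "0 < 1 / (1 + 2 * exponent_term \<theta>)" if "\<theta> \<in> admissible_thetas \<mu>" for \<theta>
      using admissible(6)[OF that] by simp
    then show ?thesis using \<open>p = 1\<close> by (auto simp: p PInf extension_range_iff restriction_range_iff)
  next
    case (real r)
    have r: "r \<ge> 1" using q real by (simp add: one_ereal_def)
    show ?thesis
    proof (cases q')
      case PInf
      then have "r = 1" using q real r by (auto simp: one_ereal_def split: if_splits)
      have "\<not> 2 + 2 * exponent_term \<theta> < r" if "\<theta> \<in> admissible_thetas \<mu>" for \<theta>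
        using admissible(6)[OF that] \<open>r = 1\<close> by simp
      then show ?thesis by (auto simp: real PInf extension_range_iff restriction_range_iff)
    next
      case (real p)
      have p: "p \<ge> 1" using q real by (simp add: one_ereal_def)
      have conj: "1 / r + 1 / p = 1" using q real \<open>q = ereal r\<close> r p by (simp add: one_ereal_def)
      have "r \<noteq> 1" using conj p by auto
      then have r1: "r > 1" using r by simp
      have "1 / p = (r - 1) / r" using conj r1 by (simp add: field_simps)
      then have p_eq: "p = 1 + 1 / (r - 1)" using r1 p by (simp add: field_simps)
      have "2 + 2 * exponent_term \<theta> < r \<longleftrightarrow> p < 1 + 1 / (1 + 2 * exponent_term \<theta>)"
        if "\<theta> \<in> admissible_thetas \<mu>" for \<theta>
      proof -
        have "p < 1 + 1 / (1 + 2 * exponent_term \<theta>) \<longleftrightarrow> 1 / (r - 1) < 1 / (1 + 2 * exponent_term \<theta>)"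
          by (simp add: p_eq)
        also have "\<dots> \<longleftrightarrow> 1 + 2 * exponent_term \<theta> < r - 1"
          using r1 admissible(6)[OF that] by (simp add: divide_less_eq less_divide_eq)
        finally show ?thesis by auto
      qed
      then show ?thesis using p by (auto simp: real \<open>q = ereal r\<close> extension_range_iff restriction_range_iff)
    qed (use q in simp)
  qed (use q in simp)
qed

section \<open>The estimates on the full ranges of exponents\<close>

text \<open>The endpoint exponent depends continuously on \<open>a\<close> and \<open>s\<close>, so
  a strict inequality at \<alpha> and at the spectrum survives for nearby values at which the
  Frostman bound and the energy bound really hold.\<close>

lemma extension_estimate_in_range:
  assumes "q \<in> extension_range \<mu> \<alpha>"
  obtains C where "C > 0"
    "\<And>f. f \<in> Lp_space 2 \<mu> \<Longrightarrow> Lp_norm q lborel (fourier \<mu> f) \<le> ennreal C * Lp_norm 2 \<mu> f"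
proof (cases q)
  case (real r)
  then obtain \<theta> where \<theta>: "\<theta> \<in> admissible_thetas \<mu>" and r: "2 + 2 * exponent_term \<theta> < r"
    using assms by (auto simp: extension_range_iff)
  note adm = admissible[OF \<theta>]
  define d where "d = real DIM('a)"
  define D where "D = spectrum_real \<theta>"
  have D: "d * \<theta> < D" "\<alpha> * \<theta> < D" using adm by (simp_all add: d_def D_def)
  have r2: "r > 2" using r adm(6) by simp
  have "2 * ((d - \<alpha>) * (2 - \<theta>) / (D - \<alpha> * \<theta>)) < r - 2"
    using r by (simp add: exponent_term_def d_def D_def)
  then have gap: "2 * ((d - \<alpha>) * (2 - \<theta>)) < (r - 2) * (D - \<alpha> * \<theta>)"
    using D by (simp add: divide_less_eq)
  define g where "g = (r - 2) * (D - \<alpha> * \<theta>) - 2 * ((d - \<alpha>) * (2 - \<theta>))"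
  have g: "g > 0" using gap by (simp add: g_def)
  \<comment> \<open>Here \<open>g\<close> is the slack in the inequality to be preserved. Lowering
    \<alpha> by at most e raises its left side by at most 4 e, and lowering D by e costs (r - 2) e
    on the right, together (r + 2) e. The second entry of the minimum keeps \<open>s\<close> above d
    \<theta>.\<close>
  define e where "e = min (g / (r + 2)) (D - d * \<theta>)"
  have e: "e > 0" "e * (r + 2) \<le> g" "e \<le> D - d * \<theta>"
  proof -
    show "e > 0" "e \<le> D - d * \<theta>" using g D r2 by (auto simp: e_def)
    have "e \<le> g / (r + 2)" by (simp add: e_def)
    then show "e * (r + 2) \<le> g" using r2 by (simp add: pos_le_divide_eq)
  qed
  obtain a C where a: "\<alpha> - e < a" "a \<le> \<alpha>" and C: "C > 0" "\<And>x r. r > 0 \<Longrightarrow> measure \<mu> (ball x r) \<le> C * r powr a"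
    using frostman_set_obtain[OF dim(1), of "\<alpha> - e"] e by auto
  have "D - e \<ge> 0" using e adm(1) by (smt (verit) d_def mult_nonneg_nonneg of_nat_0_le_iff)
  then obtain s where s: "D - e < s" "fourier_energy s \<theta> \<mu> < \<infinity>"
    using fourier_spectrum_obtain[of "D - e" \<mu> \<theta>] e adm(3) by (auto simp: D_def)
  have sd: "s > real DIM('a) * \<theta>" using s e by (simp add: d_def)
  have ad: "a < real DIM('a)" using a dim by simp
  have sa: "s - a * \<theta> > 0"
  proof -
    have "a * \<theta> \<le> real DIM('a) * \<theta>" using ad adm by (intro mult_right_mono) auto
    with sd show ?thesis by simp
  qed
  have "2 * ((d - a) * (2 - \<theta>)) < (r - 2) * (s - a * \<theta>)"
  proof -
    have "2 * ((d - a) * (2 - \<theta>)) \<le> 2 * ((d - \<alpha> + e) * (2 - \<theta>))"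
      using a adm by (intro mult_left_mono mult_right_mono) auto
    also have "\<dots> \<le> 2 * ((d - \<alpha>) * (2 - \<theta>)) + 4 * e"
      using e adm by (simp add: algebra_simps)
    also have "\<dots> \<le> (r - 2) * (D - \<alpha> * \<theta>) - (r - 2) * e"
      using e by (simp add: g_def algebra_simps)
    also have "\<dots> = (r - 2) * (D - e - \<alpha> * \<theta>)" by (simp add: algebra_simps)
    also have "\<dots> < (r - 2) * (s - a * \<theta>)"
    proof (intro mult_strict_left_mono)
      have "a * \<theta> \<le> \<alpha> * \<theta>" using a adm by (intro mult_right_mono) auto
      then show "D - e - \<alpha> * \<theta> < s - a * \<theta>" using s by simp
    qed (use r2 in simp)
    finally show ?thesis .
  qed
  then have "2 * ((d - a) * (2 - \<theta>) / (s - a * \<theta>)) < r - 2"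
    using sa by (simp add: divide_less_eq)
  then have "r > 2 + 2 * ((real DIM('a) - a) * (2 - \<theta>) / (s - a * \<theta>))"
    by (simp add: d_def)
  then show thesis
    using extension_estimate[OF fin sets C(2) _ adm(1,2) sd ad s(2), of r] C(1) r2 that real by auto
next
  case PInf
  interpret finite_measure \<mu> by (rule fin)
  define M where "M = measure \<mu> (space \<mu>) + 1"
  have M: "M > 0" by (simp add: M_def add_nonneg_pos)
  show thesis
  proof (rule that[of "sqrt M"])
    fix f assume f: "f \<in> Lp_space 2 \<mu>"
    have "fourier \<mu> f \<in> borel_measurable borel"
      by (rule borel_measurable_fourier[OF sigma_finite_measure_axioms sets Lp_space_2(1)[OF f]])
    then have [measurable]: "fourier \<mu> f \<in> borel_measurable lborel" by simp
    have "Lp_norm q lborel (fourier \<mu> f) \<le> ennreal (sqrt M * sqrt (LINT x|\<mu>. (norm (f x))\<^sup>2))"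
      unfolding PInf Lp_norm_def using norm_fourier_le_L2[OF fin f]
      by (auto intro!: esssup_I ennreal_leI simp: M_def)
    then show "Lp_norm q lborel (fourier \<mu> f) \<le> ennreal (sqrt M) * Lp_norm 2 \<mu> f"
      unfolding Lp_space_2(3)[OF f] using M by (simp add: ennreal_mult)
  qed (use M in simp)
next
  case MInf
  then show thesis using assms extension_range_iff(3) by simp
qed

lemma restriction_estimate_in_range:
  assumes "q' \<in> restriction_range \<mu> \<alpha>"
  obtains p C where "q' = ereal p" "p \<ge> 1" "C > 0"
    "\<And>\<phi>. integrable lborel \<phi> \<Longrightarrow>
      Lp_norm 2 \<mu> (fourier lborel \<phi>) \<le> ennreal C * Lp_norm (ereal p) lborel \<phi>"
proof -
  obtain p where p: "q' = ereal p" using assms restriction_range_iff(2,3) by (cases q') auto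
  have p1: "p \<ge> 1" using assms by (simp add: p restriction_range_iff)
  show thesis
  proof (cases "p = 1")
    case True
    show thesis
    proof (rule that[OF p p1, of "sqrt (measure \<mu> (space \<mu>)) + 1"])
      fix \<phi> :: "'a \<Rightarrow> complex" assume \<phi>: "integrable lborel \<phi>"
      have "ennreal (sqrt (measure \<mu> (space \<mu>))) * Lp_norm (ereal 1) lborel \<phi>
        \<le> ennreal (sqrt (measure \<mu> (space \<mu>)) + 1) * Lp_norm (ereal 1) lborel \<phi>"
        by (intro mult_right_mono ennreal_leI) auto
      with restriction_estimate_L1[OF fin sets \<phi>]
      show "Lp_norm 2 \<mu> (fourier lborel \<phi>) \<le> ennreal (sqrt (measure \<mu> (space \<mu>)) + 1) * Lp_norm (ereal p) lborel \<phi>"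
        unfolding True by (rule order_trans)
    qed (simp add: add_nonneg_pos)
  next
    case False
    then have p2: "p > 1" using p1 by simp
    define q where "q = p / (p - 1)"
    have q: "q > 1" "1 / p + 1 / q = 1" using p2 by (auto simp: q_def field_simps)
    have "conjugate_exponents (ereal q) q'"
      using p2 q by (simp add: conjugate_exponents_def p one_ereal_def add.commute)
    with assms have "ereal q \<in> extension_range \<mu> \<alpha>" using conjugate_ranges by blast
    then obtain C where C: "C > 0"
      "\<And>f. f \<in> Lp_space 2 \<mu> \<Longrightarrow> Lp_norm (ereal q) lborel (fourier \<mu> f) \<le> ennreal C * Lp_norm 2 \<mu> f"
      using extension_estimate_in_range by blast
    show thesis
      by (rule that[OF p p1 C(1)]) (rule restriction_estimate[OF fin sets p2 q C])
  qed
qed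

end

theorem theorem3p1:
  fixes \<mu> :: "'a::euclidean_space measure" and \<alpha> :: real
  assumes "finite_measure \<mu>"
    and "sets \<mu> = sets borel"
    and "emeasure \<mu> UNIV \<noteq> 0"
    and "\<exists>K. compact K \<and> emeasure \<mu> (- K) = 0"
    and "frostman_dim \<mu> = ereal \<alpha>"
    and "0 < \<alpha>" and "\<alpha> < real DIM('a)"
  shows
    "(\<forall>q \<in> extension_range \<mu> \<alpha>. \<exists>C::real. C > 0 \<and>
        (\<forall>f \<in> Lp_space 2 \<mu>. Lp_norm q lborel (fourier \<mu> f) \<le> ennreal C * Lp_norm 2 \<mu> f)) \<and>
     (\<forall>q q'. conjugate_exponents q q' \<longrightarrow>
        (q \<in> extension_range \<mu> \<alpha> \<longleftrightarrow> q' \<in> restriction_range \<mu> \<alpha>)) \<and>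
     (\<forall>q' \<in> restriction_range \<mu> \<alpha>. \<exists>C::real. C > 0 \<and>
        (\<forall>\<phi>. schwartz \<phi> \<longrightarrow>
           Lp_norm 2 \<mu> (fourier lborel \<phi>) \<le> ennreal C * Lp_norm q' lborel \<phi>) \<and>
        (\<forall>f \<in> Lp_space q' lborel. \<exists>F. fourier_extension \<mu> q' f F \<and>
           Lp_norm 2 \<mu> F \<le> ennreal C * Lp_norm q' lborel f))"
proof (intro conjI ballI allI impI)
  note hyps = assms(1,2,5,6,7)
  fix q assume "q \<in> extension_range \<mu> \<alpha>"
  then show "\<exists>C::real. C > 0 \<and>
        (\<forall>f \<in> Lp_space 2 \<mu>. Lp_norm q lborel (fourier \<mu> f) \<le> ennreal C * Lp_norm 2 \<mu> f)"
    using extension_estimate_in_range[OF hyps] by metis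
next
  note hyps = assms(1,2,5,6,7)
  fix q q' assume "conjugate_exponents q q'"
  then show "q \<in> extension_range \<mu> \<alpha> \<longleftrightarrow> q' \<in> restriction_range \<mu> \<alpha>"
    by (rule conjugate_ranges[OF hyps])
next
  note hyps = assms(1,2,5,6,7)
  fix q' assume "q' \<in> restriction_range \<mu> \<alpha>"
  then obtain p C where p: "q' = ereal p" "p \<ge> 1" and C: "C > 0"
    and est: "\<And>\<phi>. integrable lborel \<phi> \<Longrightarrow>
      Lp_norm 2 \<mu> (fourier lborel \<phi>) \<le> ennreal C * Lp_norm (ereal p) lborel \<phi>"
    by (rule restriction_estimate_in_range[OF hyps]) blast
  show "\<exists>C::real. C > 0 \<and>
        (\<forall>\<phi>. schwartz \<phi> \<longrightarrow>
           Lp_norm 2 \<mu> (fourier lborel \<phi>) \<le> ennreal C * Lp_norm q' lborel \<phi>) \<and>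
        (\<forall>f \<in> Lp_space q' lborel. \<exists>F. fourier_extension \<mu> q' f F \<and>
           Lp_norm 2 \<mu> F \<le> ennreal C * Lp_norm q' lborel f)"
  \<comment> \<open>The factor lost in the extension by density also covers the bound for Schwartz
    functions, so one constant serves both claims.\<close>
  proof (intro exI[of _ "16 * C"] conjI allI impI ballI)
    fix \<phi> :: "'a \<Rightarrow> complex" assume "schwartz \<phi>"
    then have "Lp_norm 2 \<mu> (fourier lborel \<phi>) \<le> ennreal C * Lp_norm q' lborel \<phi>"
      unfolding p by (intro est schwartz_integrable)
    also have "\<dots> \<le> ennreal (16 * C) * Lp_norm q' lborel \<phi>"
      using C by (intro mult_right_mono ennreal_leI) auto
    finally show "Lp_norm 2 \<mu> (fourier lborel \<phi>) \<le> ennreal (16 * C) * Lp_norm q' lborel \<phi>" .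
  next
    fix f :: "'a \<Rightarrow> complex" assume "f \<in> Lp_space q' lborel"
    then show "\<exists>F. fourier_extension \<mu> q' f F \<and> Lp_norm 2 \<mu> F \<le> ennreal (16 * C) * Lp_norm q' lborel f"
      unfolding p by (intro fourier_extension_exists[OF assms(1,2) p(2) C est])
  qed (use C in simp)
qed

end
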